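(* Let $\mathcal X,\mathcal Y$ be finite sets, let $P_{XY}$ (hypothesis $H_0$) and $P_{\bar X\bar Y}$ (hypothesis $H_1$) be probability measures on $\mathcal X\times\mathcal Y$, let $K\ge1$ be an integer and $R\ge 0$. Write $U_{[1:k]}=(U_{[1]},\dots,U_{[k]})$ and $V_{[1:k]}=(V_{[1]},\dots,V_{[k]})$ (empty if $k=0$). Let $\mathscr S(R)$ be the set of all tuples of random variables $(U_{[1:K]},V_{[1:K]})$ with values in finite sets $\mathcal U_{[k]},\mathcal V_{[k]}$ (of arbitrary finite cardinality), jointly distributed with $(X,Y)\sim P_{XY}$, such that for every $k\in\{1,\dots,K\}$ $$U_{[k]}-\big(X,U_{[1:k-1]},V_{[1:k-1]}\big)-Y\quad\text{and}\quad V_{[k]}-\big(Y,U_{[1:k]},V_{[1:k-1]}\big)-X$$ are Markov chains, and $$R\ \ge\ \sum_{k=1}^K\Big[I\big(X;U_{[k]}\,\big|\,U_{[1:k-1]}V_{[1:k-1]}\big)+I\big(Y;V_{[k]}\,\big|\,U_{[1:k]}V_{[1:k-1]}\big)\Big].$$ For such a tuple let $\mathscr L(U_{[1:K]},V_{[1:K]})$ be the set of all $(\tilde U_{[1:K]},\tilde V_{[1:K]},\tilde X,\tilde Y)$ on the same alphabets with $$P_{\tilde U_{[1:K]}\tilde V_{[1:K]}\tilde X}=P_{U_{[1:K]}V_{[1:K]}X},\qquad P_{\tilde U_{[1:K]}\tilde V_{[1:K]}\tilde Y}=P_{U_{[1:K]}V_{[1:K]}Y},$$ and let $$P_{\bar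 U_{[1:K]}\bar V_{[1:K]}\bar X\bar Y}=P_{\bar X\bar Y}\prod_{k=1}^K P_{U_{[k]}|U_{[1:k-1]}V_{[1:k-1]}X}\;P_{V_{[k]}|U_{[1:k]}V_{[1:k-1]}Y}.$$ Then, for $K$ rounds of interaction and total exchange rate $R$ (over all $K$ rounds), $$\lim_{\epsilon\to0}\ \liminf_{n\to\infty}-\frac1n\log\beta_n(R,\epsilon\,|\,K)\ \ge\ \sup_{\mathscr S(R)}\ \min_{\mathscr L(U_{[1:K]},V_{[1:K]})}\ \mathcal D\Big(P_{\tilde U_{[1:K]}\tilde V_{[1:K]}\tilde X\tilde Y}\,\Big\|\,P_{\bar U_{[1:K]}\bar V_{[1:K]}\bar X\bar Y}\Big).$$
   Context: All logarithms and exponentials are in base 2; $I(\cdot;\cdot|\cdot)$ is (conditional) mutual information and $\mathcal D(\cdot\|\cdot)$ is Kullback–Leibler divergence (equal to $+\infty$ when absolute continuity fails). Collaborative hypothesis testing. Node $A$ observes $X^n$ and node $B$ observes $Y^n$, where $(X_i,Y_i)_{i=1}^n$ are i.i.d. with law $P_{XY}$ under $H_0$ and $P_{\bar X\bar Y}$ under $H_1$. A $K$-round code of blocklength $n$ consists of encoders, for $k=1,\dots,K$, $$f_{[k]}:\mathcal X^n\times\prod_{i=1}^{k-1}\{1,\dots,|g_{[i]}|\}\to\{1,\dots,|f_{[k]}|\},\qquad g_{[k]}:\mathcal Y^n\times\prod_{i=1}^{k}\{1,\dots,|f_{[i]}|\}\to\{1,\dots,|g_{[k]}|\},$$ and a decision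 map $\phi:\mathcal X^n\times\prod_{i=1}^K\{1,\dots,|g_{[i]}|\}\to\{0,1\}$, where $|f_{[k]}|,|g_{[k]}|$ denote the sizes of the ranges. The messages are produced successively: $f_{[1]}$ is evaluated at $X^n$, then $g_{[1]}$ at $Y^n$ and the message of $f_{[1]}$, then $f_{[2]}$ at $X^n$ and the message of $g_{[1]}$, and so on. The error probabilities are $$\alpha_n=\Pr[\phi(X^n,g_{[1:K]})=1\mid (X_i,Y_i)\text{ i.i.d. }\sim P_{XY}],\qquad \beta_n=\Pr[\phi(X^n,g_{[1:K]})=0\mid (X_i,Y_i)\text{ i.i.d. }\sim P_{\bar X\bar Y}],$$ where $g_{[1:K]}$ denotes the tuple of all messages sent by node $B$. For $0<\epsilon<1$, a number $E$ is a feasible exponent for $(R,\epsilon)$ with $K$ rounds if for every $\varepsilon>0$ and all sufficiently large $n$ there is a $K$-round code of blocklength $n$ with $$-\tfrac1n\log\beta_n\ge E-\varepsilon,\qquad \tfrac1n\sum_{k=1}^K\log\big(|f_{[k]}||g_{[k]}|\big)\le R+\varepsilon,\qquad \alpha_n\le\epsilon .$$ The expression $\liminf_{n\to\infty}-\frac1n\log\beta_n(R,\epsilon|K)$ denotes the optimal error exponent for $(R,\epsilon)$, i.e. the supremum (in $[0,+\infty]$) of all feasible exponents. It is nondecreasing in $\epsilon$; $\lim_{\epsilon\to0}$ means $\epsilon\downarrow0$. In the definition of $P_{\bar U_{[1:K]}\bar V_{[1:K]}\bar X\bar Y}$, the conditional laws of $U_{[k]},V_{[k]}$ are those under $P_{XY}$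 (fixed arbitrarily as stochastic kernels where the conditioning event has probability zero under $H_0$). *)

theory Defs
  imports "HOL-Probability.Probability"
begin

definition tuples :: "(nat \<Rightarrow> 'a set) \<Rightarrow> nat \<Rightarrow> 'a list set" where
  "tuples A k = {as. length as = k \<and> (\<forall>i<k. as ! i \<in> A (Suc i))}"


section \<open>Interactive codes\<close>

text \<open>
  The round index \<open>k\<close> runs from 1 to \<open>K\<close>; \<open>enc_A c k xs gs\<close> is node A's message in round \<open>k\<close>,
  given the list \<open>gs\<close> of the messages of B in rounds \<open>1, ..., k - 1\<close>, and \<open>enc_B c k ys fs\<close> is
  node B's message, given the messages \<open>fs\<close> of A in rounds \<open>1, ..., k\<close>.  The message sets are
  \<open>{1..size_A c k}\<close> and \<open>{1..size_B c k}\<close>.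
\<close>

record ('x, 'y) code =
  enc_A :: "nat \<Rightarrow> 'x list \<Rightarrow> nat list \<Rightarrow> nat"
  enc_B :: "nat \<Rightarrow> 'y list \<Rightarrow> nat list \<Rightarrow> nat"
  size_A :: "nat \<Rightarrow> nat"
  size_B :: "nat \<Rightarrow> nat"
  decision :: "'x list \<Rightarrow> nat list \<Rightarrow> nat"

definition is_code :: "nat \<Rightarrow> nat \<Rightarrow> ('x, 'y) code \<Rightarrow> bool" where
  "is_code K n c \<longleftrightarrow>
     (\<forall>k\<in>{1..K}. \<forall>xs gs. length xs = n \<longrightarrow> gs \<in> tuples (\<lambda>i. {1..size_B c i}) (k - 1) \<longrightarrow>
        enc_A c k xs gs \<in> {1..size_A c k}) \<and>
     (\<forall>k\<in>{1..K}. \<forall>ys fs. length ys = n \<longrightarrow> fs \<in> tuples (\<lambda>i. {1..size_A c i}) k \<longrightarrow>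
        enc_B c k ys fs \<in> {1..size_B c k}) \<and>
     (\<forall>xs gs. length xs = n \<longrightarrow> gs \<in> tuples (\<lambda>i. {1..size_B c i}) K \<longrightarrow>
        decision c xs gs \<in> {0, 1})"

primrec transcript :: "('x, 'y) code \<Rightarrow> 'x list \<Rightarrow> 'y list \<Rightarrow> nat \<Rightarrow> nat list \<times> nat list" where
  "transcript c xs ys 0 = ([], [])"
| "transcript c xs ys (Suc k) =
     (let (fs, gs) = transcript c xs ys k;
          f = enc_A c (Suc k) xs gs;
          g = enc_B c (Suc k) ys (fs @ [f])
      in (fs @ [f], gs @ [g]))"

definition prob_decide ::
    "nat \<Rightarrow> nat \<Rightarrow> ('x, 'y) code \<Rightarrow> ('x \<times> 'y) pmf \<Rightarrow> nat \<Rightarrow> real" where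
  "prob_decide K n c W d =
     measure_pmf.prob (replicate_pmf n W)
       {zs. decision c (map fst zs) (snd (transcript c (map fst zs) (map snd zs) K)) = d}"

definition code_rate :: "nat \<Rightarrow> nat \<Rightarrow> ('x, 'y) code \<Rightarrow> real" where
  "code_rate K n c = (1 / real n) * (\<Sum>k=1..K. log 2 (real (size_A c k * size_B c k)))"

definition neg_log_rate :: "nat \<Rightarrow> real \<Rightarrow> ereal" where
  "neg_log_rate n \<beta> = (if \<beta> = 0 then \<infinity> else ereal (- (1 / real n) * log 2 \<beta>))"

definition feasible_exponent ::
    "('x \<times> 'y) pmf \<Rightarrow> ('x \<times> 'y) pmf \<Rightarrow> nat \<Rightarrow> real \<Rightarrow> real \<Rightarrow> real \<Rightarrow> bool" where
  "feasible_exponent P Q K R \<epsilon> E \<longleftrightarrow>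
     (\<forall>\<delta>>0. \<forall>\<^sub>F n in sequentially. \<exists>c :: ('x, 'y) code. is_code K n c \<and>
        neg_log_rate n (prob_decide K n c Q 0) \<ge> ereal (E - \<delta>) \<and>
        code_rate K n c \<le> R + \<delta> \<and>
        prob_decide K n c P 1 \<le> \<epsilon>)"

definition optimal_exponent ::
    "('x \<times> 'y) pmf \<Rightarrow> ('x \<times> 'y) pmf \<Rightarrow> nat \<Rightarrow> real \<Rightarrow> real \<Rightarrow> ereal" where
  "optimal_exponent P Q K R \<epsilon> = (SUP E\<in>{E. feasible_exponent P Q K R \<epsilon> E}. ereal E)"


section \<open>Information quantities in base 2\<close>

definition markov_chain :: "'w pmf \<Rightarrow> ('w \<Rightarrow> 'a) \<Rightarrow> ('w \<Rightarrow> 'b) \<Rightarrow> ('w \<Rightarrow> 'c) \<Rightarrow> bool" where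
  "markov_chain p A B C \<longleftrightarrow>
     (\<forall>a b c. \<P>(\<omega> in measure_pmf p. A \<omega> = a \<and> C \<omega> = c \<bar> B \<omega> = b) =
        \<P>(\<omega> in measure_pmf p. A \<omega> = a \<bar> B \<omega> = b) * \<P>(\<omega> in measure_pmf p. C \<omega> = c \<bar> B \<omega> = b))"

definition cond_mutual_info ::
    "'w pmf \<Rightarrow> ('w \<Rightarrow> 'a) \<Rightarrow> ('w \<Rightarrow> 'b) \<Rightarrow> ('w \<Rightarrow> 'c) \<Rightarrow> real" where
  "cond_mutual_info p A B C =
     prob_space.conditional_mutual_information (measure_pmf p) 2
       (count_space UNIV) (count_space UNIV) (count_space UNIV) A B C"

text \<open>
  The library's \<open>KL_divergence b M N\<close> is the divergence of \<open>N\<close> from \<open>M\<close> (arguments swapped), and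
  has no meaningful value without absolute continuity.
\<close>

definition divergence :: "'w pmf \<Rightarrow> 'w pmf \<Rightarrow> ereal" where
  "divergence p q =
     (if absolutely_continuous (measure_pmf q) (measure_pmf p)
      then ereal (KL_divergence 2 (measure_pmf q) (measure_pmf p)) else \<infinity>)"


section \<open>Auxiliary random variables\<close>

text \<open>
  A joint law of \<open>(U\<^sub>1, ..., U\<^sub>K)\<close>, \<open>(V\<^sub>1, ..., V\<^sub>K)\<close>, \<open>X\<close> and \<open>Y\<close> is a probability mass function on
  quadruples \<open>(us, vs, x, y)\<close>.  The finite alphabets \<open>\<U> k\<close> and \<open>\<V> k\<close> are taken as sets of natural
  numbers, which is no restriction since they are only relevant up to bijection.
\<close>

type_synonym ('x, 'y) outcome = "nat list \<times> nat list \<times> 'x \<times> 'y"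

definition rv_U :: "nat \<Rightarrow> ('x, 'y) outcome \<Rightarrow> nat" where
  "rv_U k = (\<lambda>(us, vs, x, y). us ! (k - 1))"

definition rv_V :: "nat \<Rightarrow> ('x, 'y) outcome \<Rightarrow> nat" where
  "rv_V k = (\<lambda>(us, vs, x, y). vs ! (k - 1))"

definition rv_U_upto :: "nat \<Rightarrow> ('x, 'y) outcome \<Rightarrow> nat list" where
  "rv_U_upto k = (\<lambda>(us, vs, x, y). take k us)"

definition rv_V_upto :: "nat \<Rightarrow> ('x, 'y) outcome \<Rightarrow> nat list" where
  "rv_V_upto k = (\<lambda>(us, vs, x, y). take k vs)"

definition rv_X :: "('x, 'y) outcome \<Rightarrow> 'x" where
  "rv_X = (\<lambda>(us, vs, x, y). x)"

definition rv_Y :: "('x, 'y) outcome \<Rightarrow> 'y" where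
  "rv_Y = (\<lambda>(us, vs, x, y). y)"

definition exchange_rate :: "nat \<Rightarrow> ('x, 'y) outcome pmf \<Rightarrow> real" where
  "exchange_rate K p =
     (\<Sum>k=1..K.
        cond_mutual_info p rv_X (rv_U k) (\<lambda>\<omega>. (rv_U_upto (k - 1) \<omega>, rv_V_upto (k - 1) \<omega>)) +
        cond_mutual_info p rv_Y (rv_V k) (\<lambda>\<omega>. (rv_U_upto k \<omega>, rv_V_upto (k - 1) \<omega>)))"

definition laws_on ::
    "nat \<Rightarrow> (nat \<Rightarrow> nat set) \<Rightarrow> (nat \<Rightarrow> nat set) \<Rightarrow> ('x, 'y) outcome pmf set" where
  "laws_on K \<U> \<V> = {p. set_pmf p \<subseteq> tuples \<U> K \<times> tuples \<V> K \<times> UNIV}"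

definition aux_set ::
    "('x \<times> 'y) pmf \<Rightarrow> nat \<Rightarrow> real \<Rightarrow>
      ((nat \<Rightarrow> nat set) \<times> (nat \<Rightarrow> nat set) \<times> ('x, 'y) outcome pmf) set" where
  "aux_set P K R = {(\<U>, \<V>, p).
     (\<forall>k\<in>{1..K}. finite (\<U> k) \<and> finite (\<V> k)) \<and>
     p \<in> laws_on K \<U> \<V> \<and>
     map_pmf (\<lambda>\<omega>. (rv_X \<omega>, rv_Y \<omega>)) p = P \<and>
     (\<forall>k\<in>{1..K}.
        markov_chain p (rv_U k)
          (\<lambda>\<omega>. (rv_X \<omega>, rv_U_upto (k - 1) \<omega>, rv_V_upto (k - 1) \<omega>)) rv_Y \<and>
        markov_chain p (rv_V k)
          (\<lambda>\<omega>. (rv_Y \<omega>, rv_U_upto k \<omega>, rv_V_upto (k - 1) \<omega>)) rv_X) \<and>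
     R \<ge> exchange_rate K p}"

definition matching_laws ::
    "nat \<Rightarrow> (nat \<Rightarrow> nat set) \<Rightarrow> (nat \<Rightarrow> nat set) \<Rightarrow> ('x, 'y) outcome pmf \<Rightarrow>
      ('x, 'y) outcome pmf set" where
  "matching_laws K \<U> \<V> p = {p' \<in> laws_on K \<U> \<V>.
     map_pmf (\<lambda>\<omega>. (rv_U_upto K \<omega>, rv_V_upto K \<omega>, rv_X \<omega>)) p' =
       map_pmf (\<lambda>\<omega>. (rv_U_upto K \<omega>, rv_V_upto K \<omega>, rv_X \<omega>)) p \<and>
     map_pmf (\<lambda>\<omega>. (rv_U_upto K \<omega>, rv_V_upto K \<omega>, rv_Y \<omega>)) p' =
       map_pmf (\<lambda>\<omega>. (rv_U_upto K \<omega>, rv_V_upto K \<omega>, rv_Y \<omega>)) p}"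

definition is_cond_law :: "'w pmf \<Rightarrow> ('w \<Rightarrow> 'a) \<Rightarrow> ('w \<Rightarrow> 'b) \<Rightarrow> ('b \<Rightarrow> 'a pmf) \<Rightarrow> bool" where
  "is_cond_law p A B \<kappa> \<longleftrightarrow>
     (\<forall>b. measure_pmf.prob p {\<omega>. B \<omega> = b} > 0 \<longrightarrow>
        \<kappa> b = map_pmf A (cond_pmf p {\<omega>. B \<omega> = b}))"

text \<open>
  All versions of the conditional laws of \<open>U\<^sub>k\<close> and \<open>V\<^sub>k\<close>: they are unconstrained, except for taking
  values in the alphabets, where the conditioning event has probability zero.
\<close>

definition cond_kernels ::
    "nat \<Rightarrow> (nat \<Rightarrow> nat set) \<Rightarrow> (nat \<Rightarrow> nat set) \<Rightarrow> ('x, 'y) outcome pmf \<Rightarrow>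
      ((nat \<Rightarrow> nat list \<times> nat list \<times> 'x \<Rightarrow> nat pmf) \<times>
       (nat \<Rightarrow> nat list \<times> nat list \<times> 'y \<Rightarrow> nat pmf)) set" where
  "cond_kernels K \<U> \<V> p = {(\<kappa>, \<eta>). \<forall>k\<in>{1..K}.
     is_cond_law p (rv_U k) (\<lambda>\<omega>. (rv_U_upto (k - 1) \<omega>, rv_V_upto (k - 1) \<omega>, rv_X \<omega>)) (\<kappa> k) \<and>
     is_cond_law p (rv_V k) (\<lambda>\<omega>. (rv_U_upto k \<omega>, rv_V_upto (k - 1) \<omega>, rv_Y \<omega>)) (\<eta> k) \<and>
     (\<forall>b. set_pmf (\<kappa> k b) \<subseteq> \<U> k) \<and> (\<forall>b. set_pmf (\<eta> k b) \<subseteq> \<V> k)}"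

primrec aux_pmf ::
    "(nat \<Rightarrow> nat list \<times> nat list \<times> 'x \<Rightarrow> nat pmf) \<Rightarrow>
     (nat \<Rightarrow> nat list \<times> nat list \<times> 'y \<Rightarrow> nat pmf) \<Rightarrow>
     'x \<Rightarrow> 'y \<Rightarrow> nat \<Rightarrow> (nat list \<times> nat list) pmf" where
  "aux_pmf \<kappa> \<eta> x y 0 = return_pmf ([], [])"
| "aux_pmf \<kappa> \<eta> x y (Suc k) =
     do {
       (us, vs) \<leftarrow> aux_pmf \<kappa> \<eta> x y k;
       u \<leftarrow> \<kappa> (Suc k) (us, vs, x);
       v \<leftarrow> \<eta> (Suc k) (us @ [u], vs, y);
       return_pmf (us @ [u], vs @ [v])
     }"

definition bar_law ::
    "('x \<times> 'y) pmf \<Rightarrow> nat \<Rightarrow>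
     (nat \<Rightarrow> nat list \<times> nat list \<times> 'x \<Rightarrow> nat pmf) \<Rightarrow>
     (nat \<Rightarrow> nat list \<times> nat list \<times> 'y \<Rightarrow> nat pmf) \<Rightarrow> ('x, 'y) outcome pmf" where
  "bar_law Q K \<kappa> \<eta> =
     do {
       (x, y) \<leftarrow> Q;
       (us, vs) \<leftarrow> aux_pmf \<kappa> \<eta> x y K;
       return_pmf (us, vs, x, y)
     }"

text \<open>
  The infimum is attained: the laws in \<open>matching_laws K \<U> \<V> p\<close> are a nonempty compact set of
  probability vectors on a finite set, and the divergence is lower semicontinuous.  Its value does
  not depend on the version \<open>(\<kappa>, \<eta>)\<close>, since the laws in \<open>matching_laws K \<U> \<V> p\<close> charge no outcome
  at which the versions can differ.
\<close>

definition exponent_bound ::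
    "('x \<times> 'y) pmf \<Rightarrow> ('x \<times> 'y) pmf \<Rightarrow> nat \<Rightarrow> real \<Rightarrow> ereal" where
  "exponent_bound P Q K R =
     (SUP (\<U>, \<V>, p) \<in> aux_set P K R.
       SUP (\<kappa>, \<eta>) \<in> cond_kernels K \<U> \<V> p.
         INF p' \<in> matching_laws K \<U> \<V> p. divergence p' (bar_law Q K \<kappa> \<eta>))"

end

theory Submission
  imports Defs "HOL-Real_Asymp.Real_Asymp"
begin

text \<open>
  Each message is produced by rejection sampling: from \<open>M \<approx> 2\<^bsup>n(I + 2\<gamma>)\<^esup>\<close> codewords drawn from the
  law of \<open>U\<^sub>k\<close> given the past, the first one is sent that is accepted with probability
  proportional to the likelihood ratio of \<open>U\<^sub>k\<close> given (past, \<open>X\<close>) and \<open>U\<^sub>k\<close> given the past, where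
  sequences of too large information density are never accepted.  Averaged over codebooks, a
  history \<open>(us, vs)\<close> then arises from \<open>(x, y)\<close> with at most \<open>\<tau>\<^bsup>2K\<^esup>\<close> times its probability under the
  product kernels, and with at least \<open>\<theta>\<^bsup>2K\<^esup>\<close> times it if all information densities are close to
  their means, where \<open>\<tau> \<approx> 2\<^bsup>n\<gamma>\<^esup>\<close> and \<open>\<theta> \<rightarrow> 1\<close>.  The hypothesis \<open>H\<^sub>0\<close> is accepted if \<open>(us, vs, x)\<close> and
  \<open>(us, vs, y)\<close> are both typical.  Under \<open>H\<^sub>0\<close> this has probability tending to \<open>1\<close>; under \<open>H\<^sub>1\<close>
  its probability is at most \<open>\<tau>\<^bsup>2K\<^esup>\<close> times that of the same event under the \<open>n\<close>-fold product of the
  law with bars, which Sanov's theorem bounds.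

  Codebooks and coin flips are derandomised one message at a time, from the root of the protocol
  tree downwards, so that the linear functional \<open>(1 - \<alpha>) - w * \<beta>\<close> of the code never drops below its average.
\<close>

text \<open>The obstacle is that one message law must serve both hypotheses. A codeword that is
  merely typical with \<open>x\<close> has no controlled conditional law; acceptance by likelihood
  ratio makes the law of the history comparable with the product kernels pointwise in
  \<open>(x, y)\<close>, whatever the source law. The upper comparison serves \<beta>, the lower one
  \<alpha>, so histories of too large density may be lost.

  Linearity lets one code serve both errors: for \<open>w = 2 powr (n * (E - \<delta>))\<close>, a
  lower bound tending to 1 on \<open>1 - \<alpha> - w * \<beta>\<close> forces \<alpha> to 0 and
  \<beta> below \<open>1 / w\<close>. The two nonnegative parts are carried along separately, since
  each message multiplies the first by \<theta> and the second by \<tau>.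

  In a tree every node has its own codebook, so choices after different transcripts never interfere.
  A alone decides but cannot see \<open>y\<close>; hence the typicality test of B is built into the
  acceptance rule of its last message.\<close>

section \<open>Rejection sampling with a greedily chosen codebook\<close>

text \<open>The mean of \<open>h\<close> at the first accepted codeword when each \<open>u\<close>
  is accepted with probability \<open>r u\<close> by an independent coin; if none is accepted the
  payoff is 0, the worth of a failure.\<close>

primrec accept_first :: "('u \<Rightarrow> real) \<Rightarrow> ('u \<Rightarrow> real) \<Rightarrow> 'u list \<Rightarrow> real" where
  "accept_first r h [] = 0"
| "accept_first r h (u # us) = r u * h u + (1 - r u) * accept_first r h us"

text \<open>A mean over the stopping position is a convex combination of the codeword values and 0,
  so the best of these reaches it. This removes the coins: a deterministic index, or failure, does
  at least as well.\<close>

lemma accept_first_le_max: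
  assumes "\<And>u. 0 \<le> r u" "\<And>u. r u \<le> 1"
  shows "accept_first r h us \<le> 0 \<or> (\<exists>i<length us. accept_first r h us \<le> h (us ! i))"
proof (induction us)
  case (Cons u us)
  have conv: "r u * h u + (1 - r u) * z \<le> max (h u) z" for z
    by (rule convex_bound_le) (use assms in auto)
  from Cons.IH show ?case
  proof
    assume "accept_first r h us \<le> 0"
    then have "accept_first r h (u # us) \<le> max (h u) 0"
      using conv[of "accept_first r h us"] by auto
    then show ?thesis by (cases "h u \<le> 0") (auto intro!: exI[of _ 0])
  next
    assume "\<exists>i<length us. accept_first r h us \<le> h (us ! i)"
    then obtain i where i: "i < length us" "accept_first r h us \<le> h (us ! i)" by blast
    show ?thesis
    proof (cases "h u \<le> accept_first r h us")
      case True
      then have "accept_first r h (u # us) \<le> h ((u # us) ! Suc i)"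
        using conv[of "accept_first r h us"] i by auto
      then show ?thesis using i by (intro disjI2 exI[of _ "Suc i"]) auto
    next
      case False
      then have "accept_first r h (u # us) \<le> h ((u # us) ! 0)"
        using conv[of "accept_first r h us"] by auto
      then show ?thesis by (intro disjI2 exI[of _ 0]) auto
    qed
  qed
qed auto

lemma exists_ge_expectation:
  fixes F :: "'u \<Rightarrow> real"
  assumes "finite (set_pmf \<rho>)"
  shows "\<exists>u. F u \<ge> (\<Sum>u\<in>set_pmf \<rho>. pmf \<rho> u * F u)"
proof (rule ccontr)
  let ?E = "\<Sum>u\<in>set_pmf \<rho>. pmf \<rho> u * F u"
  assume "\<not> ?thesis"
  then have less: "F u < ?E" for u by (auto simp: not_le)
  have "?E < (\<Sum>u\<in>set_pmf \<rho>. pmf \<rho> u * ?E)"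
    using assms less by (intro sum_strict_mono) (auto simp: set_pmf_not_empty pmf_positive)
  also have "\<dots> = ?E"
    using assms by (simp add: sum_distrib_right[symmetric] sum_pmf_eq_1)
  finally show False by simp
qed

text \<open>
  The greedy choice of the codewords: \<open>(\<Sum>u. \<rho> u * r x u * h x u) * (\<Sum>j<M. (1 - q x) ^ j)\<close> is the
  average of \<open>accept_first (r x) (h x)\<close> over i.i.d. codewords with law \<open>\<rho>\<close>, where \<open>q x\<close> is the mean of \<open>r x\<close>.
\<close>

lemma exists_codebook:
  fixes r h :: "'x \<Rightarrow> 'u \<Rightarrow> real"
  assumes fin: "finite (set_pmf \<rho>)" "finite X"
    and r: "\<And>x u. 0 \<le> r x u" "\<And>x u. r x u \<le> 1"
    and w: "\<And>x. 0 \<le> w x"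
  shows "\<exists>us. length us = M \<and>
    (\<Sum>x\<in>X. w x * ((\<Sum>u\<in>set_pmf \<rho>. pmf \<rho> u * (r x u * h x u)) *
        (\<Sum>j<M. (1 - (\<Sum>u\<in>set_pmf \<rho>. pmf \<rho> u * r x u)) ^ j)))
      \<le> (\<Sum>x\<in>X. w x * accept_first (r x) (h x) us)"
  using w
proof (induction M arbitrary: w)
  case 0
  show ?case by simp
next
  case (Suc M)
  define H where "H x = (\<Sum>u\<in>set_pmf \<rho>. pmf \<rho> u * (r x u * h x u))" for x
  define q where "q x = (\<Sum>u\<in>set_pmf \<rho>. pmf \<rho> u * r x u)" for x
  define G where "G x = H x * (\<Sum>j<M. (1 - q x) ^ j)" for x
  \<comment> \<open>The payoff once the leading codeword is \<open>u\<close> while the other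
    \<open>M\<close> are still averaged; \<open>G\<close> is that average.\<close>
  define F where "F u = (\<Sum>x\<in>X. w x * (r x u * h x u + (1 - r x u) * G x))" for u
  obtain u where u: "F u \<ge> (\<Sum>u\<in>set_pmf \<rho>. pmf \<rho> u * F u)"
    using exists_ge_expectation[OF fin(1)] by blast
  have one: "(\<Sum>u\<in>set_pmf \<rho>. pmf \<rho> u) = 1"
    using fin by (simp add: sum_pmf_eq_1)
  have avg: "(\<Sum>u\<in>set_pmf \<rho>. pmf \<rho> u * (r x u * h x u + (1 - r x u) * G x)) = H x + (1 - q x) * G x" for x
  proof -
    have "(\<Sum>u\<in>set_pmf \<rho>. pmf \<rho> u * (r x u * h x u + (1 - r x u) * G x))
      = H x + ((\<Sum>u\<in>set_pmf \<rho>. pmf \<rho> u) - q x) * G x"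
      unfolding H_def q_def
      by (simp add: algebra_simps sum.distrib sum_subtractf sum_distrib_left)
    then show ?thesis using one by simp
  qed
  have "(\<Sum>u\<in>set_pmf \<rho>. pmf \<rho> u * F u)
      = (\<Sum>x\<in>X. w x * (\<Sum>u\<in>set_pmf \<rho>. pmf \<rho> u * (r x u * h x u + (1 - r x u) * G x)))"
    unfolding F_def sum_distrib_left by (subst sum.swap) (simp add: mult.left_commute)
  also have "\<dots> = (\<Sum>x\<in>X. w x * (H x * (\<Sum>j<Suc M. (1 - q x) ^ j)))"
  proof (intro sum.cong refl)
    fix x
    have "H x + (1 - q x) * G x = H x * (\<Sum>j<Suc M. (1 - q x) ^ j)"
      unfolding G_def sum.lessThan_Suc_shift by (simp add: algebra_simps sum_distrib_left sum_subtractf)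
    then show "w x * (\<Sum>u\<in>set_pmf \<rho>. pmf \<rho> u * (r x u * h x u + (1 - r x u) * G x))
      = w x * (H x * (\<Sum>j<Suc M. (1 - q x) ^ j))" using avg by simp
  qed
  finally have le: "(\<Sum>x\<in>X. w x * (H x * (\<Sum>j<Suc M. (1 - q x) ^ j))) \<le> F u"
    using u by simp
  \<comment> \<open>The weight of \<open>x\<close> shrinks to the part on which \<open>u\<close> is
    refused; for this the induction carries arbitrary weights.\<close>
  have "\<And>x. 0 \<le> w x * (1 - r x u)" using Suc.prems r by simp
  from Suc.IH[OF this] obtain us where us: "length us = M \<and>
    (\<Sum>x\<in>X. w x * (1 - r x u) * G x) \<le> (\<Sum>x\<in>X. w x * (1 - r x u) * accept_first (r x) (h x) us)"
    unfolding G_def H_def q_def by (rule exE)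
  have "F u = (\<Sum>x\<in>X. w x * (r x u * h x u)) + (\<Sum>x\<in>X. w x * (1 - r x u) * G x)"
    unfolding F_def sum.distrib[symmetric] by (intro sum.cong refl) (simp add: algebra_simps)
  also have "\<dots> \<le> (\<Sum>x\<in>X. w x * (r x u * h x u)) + (\<Sum>x\<in>X. w x * (1 - r x u) * accept_first (r x) (h x) us)"
    using us by simp
  also have "\<dots> = (\<Sum>x\<in>X. w x * accept_first (r x) (h x) (u # us))"
    unfolding sum.distrib[symmetric] by (intro sum.cong refl) (simp add: algebra_simps)
  finally show ?case
    using le us unfolding H_def q_def by (intro exI[of _ "u # us"]) auto
qed

text \<open>The sum divided by \<open>c\<close> is the factor by which the law of the accepted
  codeword differs from the target kernel. Each summand is at most 1; and the sum decreases in
  \<open>q\<close>, so the worst case \<open>q = 1 / c\<close> gives the chance of a success among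
  \<open>M\<close> trials of rate \<open>1 / c\<close>.\<close>

lemma geometric_sum_bounds:
  fixes c q :: real
  assumes "c \<ge> 1" "0 \<le> q" "q \<le> 1 / c"
  shows "1 - (1 - 1 / c) ^ M \<le> (\<Sum>j<M. (1 - q) ^ j) / c" "(\<Sum>j<M. (1 - q) ^ j) / c \<le> real M / c"
proof -
  have "1 / c \<le> 1" using assms by simp
  then have q1: "0 \<le> 1 - q" "1 - q \<le> 1" "0 \<le> 1 - 1 / c" using assms by linarith+
  have "(\<Sum>j<M. (1 - q) ^ j) \<le> (\<Sum>j<M. 1)"
    using q1 by (intro sum_mono power_le_one) auto
  then show "(\<Sum>j<M. (1 - q) ^ j) / c \<le> real M / c"
    using assms by (intro divide_right_mono) auto
  have "1 - (1 - 1 / c) ^ M = (1 - (1 - 1 / c)) * (\<Sum>j<M. (1 - 1 / c) ^ j)"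
    by (rule one_diff_power_eq)
  also have "\<dots> = (\<Sum>j<M. (1 - 1 / c) ^ j) / c" by simp
  also have "\<dots> \<le> (\<Sum>j<M. (1 - q) ^ j) / c"
    using assms q1 by (intro divide_right_mono sum_mono power_mono) auto
  finally show "1 - (1 - 1 / c) ^ M \<le> (\<Sum>j<M. (1 - q) ^ j) / c" .
qed

text \<open>
  Rejection sampling: the codeword \<open>u\<close> is accepted with probability \<open>pmf (\<kappa> x) u / (c * pmf \<rho> u)\<close>,
  so that the first accepted codeword has law \<open>\<kappa> x\<close> up to the factors \<open>\<theta>\<close> and \<open>\<tau>\<close>.  The index
  \<open>Suc M\<close> signals failure.
\<close>

lemma covering_step:
  fixes \<kappa> :: "'x \<Rightarrow> 'u pmf" and \<rho> :: "'u pmf" and a b :: "'x \<Rightarrow> 'u \<Rightarrow> real"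
  assumes fin: "finite (set_pmf \<rho>)" "finite X"
    and c: "c \<ge> 1"
    and good: "\<And>x u. good x u \<Longrightarrow> pmf (\<kappa> x) u \<le> c * pmf \<rho> u"
    and a: "\<And>x u. 0 \<le> a x u" and b: "\<And>x u. 0 \<le> b x u"
    and \<theta>: "\<theta> \<le> 1 - (1 - 1 / c) ^ M" and \<tau>: "real M / c \<le> \<tau>"
  shows "\<exists>us f. length us = M \<and> (\<forall>x. f x \<in> {1..Suc M}) \<and>
    (\<Sum>x\<in>X. measure_pmf.expectation (\<kappa> x) (\<lambda>u. if good x u then \<theta> * a x u - \<tau> * b x u else 0))
    \<le> (\<Sum>x\<in>X. if f x \<le> M then a x (us ! (f x - 1)) - b x (us ! (f x - 1)) else 0)"
proof -
  define r where "r x u = (if good x u then pmf (\<kappa> x) u / (c * pmf \<rho> u) else 0)" for x u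
  define h where "h x u = a x u - b x u" for x u
  have pos: "pmf \<rho> u > 0 \<longleftrightarrow> u \<in> set_pmf \<rho>" for u by (simp add: pmf_positive_iff)
  have r0: "0 \<le> r x u" for x u unfolding r_def using c by simp
  have r1: "r x u \<le> 1" for x u
    unfolding r_def using c good[of x u] pmf_nonneg[of \<rho> u]
    by (cases "pmf \<rho> u = 0") (auto simp: divide_le_eq)
  \<comment> \<open>Where \<open>\<rho>\<close> vanishes, \<open>good\<close> forces
    \<open>\<kappa> x\<close> to vanish too, so the quotient \<open>0 / 0 = 0\<close> in
    \<open>r\<close> does no harm.\<close>
  have pr: "pmf \<rho> u * r x u = (if good x u then pmf (\<kappa> x) u / c else 0)" for x u
  proof (cases "pmf \<rho> u = 0")
    case True
    then show ?thesis using good[of x u] pmf_nonneg[of "\<kappa> x" u] by auto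
  qed (auto simp: r_def)
  define q where "q x = (\<Sum>u\<in>set_pmf \<rho>. pmf \<rho> u * r x u)" for x
  have q0: "0 \<le> q x" for x unfolding q_def using r0 by (simp add: sum_nonneg)
  have qc: "q x \<le> 1 / c" for x
  proof -
    have "q x \<le> (\<Sum>u\<in>set_pmf \<rho>. pmf (\<kappa> x) u / c)"
      unfolding q_def pr using c by (intro sum_mono) auto
    also have "\<dots> = measure_pmf.prob (\<kappa> x) (set_pmf \<rho>) / c"
      using fin by (simp add: sum_divide_distrib[symmetric] measure_measure_pmf_finite)
    also have "\<dots> \<le> 1 / c"
      using c by (intro divide_right_mono) auto
    finally show ?thesis .
  qed
  obtain us where us: "length us = M"
    "(\<Sum>x\<in>X. ((\<Sum>u\<in>set_pmf \<rho>. pmf \<rho> u * (r x u * h x u)) * (\<Sum>j<M. (1 - q x) ^ j)))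
      \<le> (\<Sum>x\<in>X. accept_first (r x) (h x) us)"
    using exists_codebook[OF fin, where r = r and w = "\<lambda>_. 1" and M = M and h = h] r0 r1 unfolding q_def by auto
  \<comment> \<open>The sender knows \<open>x\<close>, the payoffs and the codebook, hence can
    compute the mean and take an index that reaches it; a mean of at most 0 is reached by
    failure.\<close>
  define f where "f x = (if accept_first (r x) (h x) us \<le> 0 then Suc M
     else Suc (SOME i. i < M \<and> accept_first (r x) (h x) us \<le> h x (us ! i)))" for x
  have f: "f x \<in> {1..Suc M} \<and> accept_first (r x) (h x) us \<le> (if f x \<le> M then h x (us ! (f x - 1)) else 0)" for x
  proof (cases "accept_first (r x) (h x) us \<le> 0")
    case False
    then have "\<exists>i. i < M \<and> accept_first (r x) (h x) us \<le> h x (us ! i)"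
      using accept_first_le_max[of "r x" "h x" us] r0 r1 us(1) by auto
    from someI_ex[OF this] show ?thesis using False unfolding f_def by auto
  qed (auto simp: f_def)
  have "measure_pmf.expectation (\<kappa> x) (\<lambda>u. if good x u then \<theta> * a x u - \<tau> * b x u else 0)
     \<le> (\<Sum>u\<in>set_pmf \<rho>. pmf \<rho> u * (r x u * h x u)) * (\<Sum>j<M. (1 - q x) ^ j)" for x
  proof -
    let ?S = "(\<Sum>j<M. (1 - q x) ^ j) / c"
    \<comment> \<open>One factor \<open>?S\<close> multiplies both payoffs; it is bounded below
      against \<open>a\<close> and above against \<open>b\<close>, since they enter with opposite
      signs.\<close>
    have S: "\<theta> \<le> ?S" "?S \<le> \<tau>"
      using geometric_sum_bounds[OF c q0[of x] qc[of x], of M] \<theta> \<tau> by linarith+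
    have supp: "u \<in> set_pmf \<rho>" if "u \<in> set_pmf (\<kappa> x)" "good x u" for u
    proof -
      have "pmf (\<kappa> x) u > 0" using that by (simp add: pmf_positive)
      then have "c * pmf \<rho> u > 0" using good[OF that(2)] by linarith
      then show ?thesis using c by (simp add: zero_less_mult_iff pos)
    qed
    have "measure_pmf.expectation (\<kappa> x) (\<lambda>u. if good x u then \<theta> * a x u - \<tau> * b x u else 0)
      = (\<Sum>u\<in>set_pmf \<rho>. (if good x u then \<theta> * a x u - \<tau> * b x u else 0) * pmf (\<kappa> x) u)"
      by (subst integral_measure_pmf_real[OF fin(1)]) (use supp in \<open>auto split: if_splits\<close>)
    also have "\<dots> \<le> (\<Sum>u\<in>set_pmf \<rho>. ?S * (if good x u then h x u * pmf (\<kappa> x) u else 0))"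
    proof (intro sum_mono)
      fix u
      have "\<theta> * a x u - \<tau> * b x u \<le> ?S * a x u - ?S * b x u"
        using mult_right_mono[OF S(1) a[of x u]] mult_right_mono[OF S(2) b[of x u]] by linarith
      from mult_right_mono[OF this pmf_nonneg[of "\<kappa> x" u]]
      show "(if good x u then \<theta> * a x u - \<tau> * b x u else 0) * pmf (\<kappa> x) u
        \<le> ?S * (if good x u then h x u * pmf (\<kappa> x) u else 0)"
        by (cases "good x u") (simp_all add: h_def right_diff_distrib mult.commute mult.left_commute)
    qed
    also have "\<dots> = (\<Sum>u\<in>set_pmf \<rho>. pmf \<rho> u * r x u * h x u) * (\<Sum>j<M. (1 - q x) ^ j)"
      unfolding pr sum_distrib_right by (intro sum.cong) auto
    finally show ?thesis by (simp only: mult.assoc)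
  qed
  note le = this
  have "(\<Sum>x\<in>X. measure_pmf.expectation (\<kappa> x) (\<lambda>u. if good x u then \<theta> * a x u - \<tau> * b x u else 0))
    \<le> (\<Sum>x\<in>X. accept_first (r x) (h x) us)"
    by (rule order_trans[OF sum_mono[OF le] us(2)])
  also have "\<dots> \<le> (\<Sum>x\<in>X. if f x \<le> M then h x (us ! (f x - 1)) else 0)"
    using f by (intro sum_mono) auto
  finally show ?thesis
    using us(1) f unfolding h_def by (intro exI[of _ us] exI[of _ f]) auto
qed

text \<open>A node fixes both messages of a round and branches on the pair, so subtrees belonging to
  different transcripts can be built independently. \<open>Dec d\<close> accepts the null hypothesis
  where \<open>d\<close> holds.\<close>

datatype ('x, 'y) ptree =
  Dec "'x \<Rightarrow> bool"
| Round "'x \<Rightarrow> nat" "nat \<Rightarrow> 'y \<Rightarrow> nat" "nat \<times> nat \<Rightarrow> ('x, 'y) ptree"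

primrec accepts :: "('x, 'y) ptree \<Rightarrow> 'x \<Rightarrow> 'y \<Rightarrow> bool" where
  "accepts (Dec d) x y = d x"
| "accepts (Round f g s) x y = accepts (s (f x, g (f x) y)) x y"

text \<open>The list holds the indices of the rounds still to come. Ranges and subtrees are
  constrained at all arguments, reachable or not, so the range lemmas ask nothing of the values of
  received messages.\<close>

primrec well_sized :: "(nat \<Rightarrow> nat) \<Rightarrow> (nat \<Rightarrow> nat) \<Rightarrow> nat list \<Rightarrow> ('x, 'y) ptree \<Rightarrow> bool" where
  "well_sized m m' [] t \<longleftrightarrow> (\<exists>d. t = Dec d)"
| "well_sized m m' (k # ks) t \<longleftrightarrow> (\<exists>f g s. t = Round f g s \<and> (\<forall>x. f x \<in> {1..m k}) \<and>
     (\<forall>i y. g i y \<in> {1..m' k}) \<and> (\<forall>ij. well_sized m m' ks (s ij)))"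

text \<open>Attached below the failure index, where it makes the payoff exactly 0.\<close>

lemma exists_rejecting_ptree:
  assumes "\<And>k. m k \<ge> 1" "\<And>k. m' k \<ge> 1"
  shows "\<exists>t :: ('x, 'y) ptree. well_sized m m' ks t \<and> (\<forall>x y. \<not> accepts t x y)"
proof (induction ks)
  case Nil
  show ?case by (intro exI[of _ "Dec (\<lambda>_. False)"]) auto
next
  case (Cons k ks)
  then obtain t :: "('x, 'y) ptree" where "well_sized m m' ks t" "\<forall>x y. \<not> accepts t x y" by blast
  then show ?case
    using assms by (intro exI[of _ "Round (\<lambda>_. 1) (\<lambda>_ _. 1) (\<lambda>_. t)"]) auto
qed

section \<open>Replacing one random message by a deterministic one\<close>

lemma sum_by_fibres:
  fixes F :: "'i \<Rightarrow> 'x \<Rightarrow> real"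
  assumes "finite I" "\<And>x. f x \<in> I"
  shows "(\<Sum>x\<in>X. F (f x) x) = (\<Sum>i\<in>I. \<Sum>x\<in>X. if f x = i then F i x else 0)"
  using assms by (subst sum.swap) (simp add: sum.delta')


text \<open>The codebook is chosen for the payoff of an idealised remaining protocol of value
  \<open>V\<close>, up to the factors \<open>A\<close> and \<open>B\<close>. Each index then gets
  its own continuation, by \<open>IH\<close> applied to the payoffs restricted to the inputs that
  send this index. Continuations are abstract (\<open>Z\<close>, \<open>acc\<close>) because the
  same argument serves both nodes, \<open>x\<close> being the input of the sender.\<close>

lemma half_round:
  fixes V :: "'u \<Rightarrow> 'x \<Rightarrow> 'y \<Rightarrow> real" and acc :: "'t \<Rightarrow> 'x \<Rightarrow> 'y \<Rightarrow> bool"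
    and a b :: "'x \<Rightarrow> 'y \<Rightarrow> real"
  assumes fin: "finite (set_pmf \<rho>)" "finite X" "\<And>x. finite (set_pmf (\<kappa> x))"
    and c: "c \<ge> 1"
    and good: "\<And>x u. good x u \<Longrightarrow> pmf (\<kappa> x) u \<le> c * pmf \<rho> u"
    and \<theta>: "\<theta> \<le> 1 - (1 - 1 / c) ^ M" and \<tau>: "real M / c \<le> \<tau>"
    and AB: "0 \<le> A" "0 \<le> B"
    and V: "\<And>u x y. 0 \<le> V u x y"
    and rej: "\<exists>t. Z t \<and> (\<forall>x y. \<not> acc t x y)"
    and IH: "\<And>u a b. (\<And>x y. 0 \<le> a x y) \<Longrightarrow> (\<And>x y. 0 \<le> b x y) \<Longrightarrow> \<exists>t. Z t \<and>
      (\<Sum>x\<in>X. \<Sum>y\<in>Y. (A * a x y - B * b x y) * V u x y)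
      \<le> (\<Sum>x\<in>X. \<Sum>y\<in>Y. if acc t x y then a x y - b x y else 0)"
    and ab: "\<And>x y. 0 \<le> a x y" "\<And>x y. 0 \<le> b x y"
  shows "\<exists>f T. (\<forall>x. f x \<in> {1..Suc M}) \<and> (\<forall>i. Z (T i)) \<and>
    (\<Sum>x\<in>X. \<Sum>y\<in>Y. (\<theta> * A * a x y - \<tau> * B * b x y) *
        measure_pmf.expectation (\<kappa> x) (\<lambda>u. if good x u then V u x y else 0))
    \<le> (\<Sum>x\<in>X. \<Sum>y\<in>Y. if acc (T (f x)) x y then a x y - b x y else 0)"
proof -
  \<comment> \<open>The sender does not see \<open>y\<close>, so a codeword is worth the sum over
    \<open>y\<close>; \<open>A\<close> and \<open>B\<close> are the factors incurred by the later
    messages.\<close>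
  define a' where "a' x u = (\<Sum>y\<in>Y. A * a x y * V u x y)" for x u
  define b' where "b' x u = (\<Sum>y\<in>Y. B * b x y * V u x y)" for x u
  have a'0: "0 \<le> a' x u" and b'0: "0 \<le> b' x u" for x u
    unfolding a'_def b'_def using ab AB V by (auto intro!: sum_nonneg)
  obtain us f where usf: "length us = M" "\<forall>x. f x \<in> {1..Suc M}"
    "(\<Sum>x\<in>X. measure_pmf.expectation (\<kappa> x) (\<lambda>u. if good x u then \<theta> * a' x u - \<tau> * b' x u else 0))
    \<le> (\<Sum>x\<in>X. if f x \<le> M then a' x (us ! (f x - 1)) - b' x (us ! (f x - 1)) else 0)"
    using covering_step[where good = good and \<kappa> = \<kappa> and a = a' and b = b', OF fin(1,2) c good a'0 b'0 \<theta> \<tau>]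
    by iprover
  define G where "G i = (\<Sum>x\<in>X. if f x = i then (if i \<le> M then a' x (us ! (i - 1)) - b' x (us ! (i - 1)) else 0) else 0)" for i
  have "\<exists>t. Z t \<and> G i \<le> (\<Sum>x\<in>X. if f x = i then (\<Sum>y\<in>Y. if acc t x y then a x y - b x y else 0) else 0)" for i
  proof (cases "i \<le> M")
    case True
    \<comment> \<open>The payoffs are set to 0 off the fibre of \<open>i\<close>; nonnegativity
      survives, which is all that \<open>IH\<close> asks.\<close>
    have "\<exists>t. Z t \<and>
      (\<Sum>x\<in>X. \<Sum>y\<in>Y. (A * (if f x = i then a x y else 0) - B * (if f x = i then b x y else 0)) * V (us ! (i - 1)) x y)
      \<le> (\<Sum>x\<in>X. \<Sum>y\<in>Y. if acc t x y then (if f x = i then a x y else 0) - (if f x = i then b x y else 0) else 0)"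
      by (rule IH) (use ab in auto)
    then obtain t where t: "Z t" 
      "(\<Sum>x\<in>X. \<Sum>y\<in>Y. (A * (if f x = i then a x y else 0) - B * (if f x = i then b x y else 0)) * V (us ! (i - 1)) x y)
      \<le> (\<Sum>x\<in>X. \<Sum>y\<in>Y. if acc t x y then (if f x = i then a x y else 0) - (if f x = i then b x y else 0) else 0)"
      by iprover
    have "G i = (\<Sum>x\<in>X. \<Sum>y\<in>Y. (A * (if f x = i then a x y else 0) - B * (if f x = i then b x y else 0)) * V (us ! (i - 1)) x y)"
      unfolding G_def
    proof (intro sum.cong refl)
      fix x
      have "a' x (us ! (i - 1)) - b' x (us ! (i - 1)) = (\<Sum>y\<in>Y. (A * a x y - B * b x y) * V (us ! (i - 1)) x y)"
        unfolding a'_def b'_def sum_subtractf[symmetric] left_diff_distrib ..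
      then show "(if f x = i then (if i \<le> M then a' x (us ! (i - 1)) - b' x (us ! (i - 1)) else 0) else 0)
        = (\<Sum>y\<in>Y. (A * (if f x = i then a x y else 0) - B * (if f x = i then b x y else 0)) * V (us ! (i - 1)) x y)"
        using True by (cases "f x = i") simp_all
    qed
    also note t(2)
    also have "(\<Sum>x\<in>X. \<Sum>y\<in>Y. if acc t x y then (if f x = i then a x y else 0) - (if f x = i then b x y else 0) else 0)
      = (\<Sum>x\<in>X. if f x = i then (\<Sum>y\<in>Y. if acc t x y then a x y - b x y else 0) else 0)"
      by (intro sum.cong refl) (auto intro!: sum.cong sum.neutral)
    finally show ?thesis using t(1) by (intro exI[of _ t] conjI)
  next
    case False
    \<comment> \<open>Among the indices that are sent only the failure index \<open>Suc M\<close> is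
      left: nothing is promised there, and a rejecting continuation delivers it.\<close>
    obtain t where t: "Z t" "\<forall>x y. \<not> acc t x y" using rej by blast
    have "G i = 0" using False unfolding G_def by (simp cong: if_cong)
    then show ?thesis using t by (intro exI[of _ t]) (simp cong: if_cong)
  qed
  from choice[OF allI[OF this]] obtain T where T: "\<forall>i. Z (T i) \<and>
      G i \<le> (\<Sum>x\<in>X. if f x = i then (\<Sum>y\<in>Y. if acc (T i) x y then a x y - b x y else 0) else 0)"
    by (rule exE)
  have swap: "(\<Sum>y\<in>Y. (\<theta> * A * a x y - \<tau> * B * b x y) *
        measure_pmf.expectation (\<kappa> x) (\<lambda>u. if good x u then V u x y else 0))
      = measure_pmf.expectation (\<kappa> x) (\<lambda>u. if good x u then \<theta> * a' x u - \<tau> * b' x u else 0)" for x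
  proof -
    have int: "integrable (measure_pmf (\<kappa> x)) F" for F :: "'u \<Rightarrow> real"
      by (rule integrable_measure_pmf_finite[OF fin(3)])
    have "(\<Sum>y\<in>Y. (\<theta> * A * a x y - \<tau> * B * b x y) *
        measure_pmf.expectation (\<kappa> x) (\<lambda>u. if good x u then V u x y else 0))
      = measure_pmf.expectation (\<kappa> x) (\<lambda>u. \<Sum>y\<in>Y. (\<theta> * A * a x y - \<tau> * B * b x y) * (if good x u then V u x y else 0))"
      by (subst Bochner_Integration.integral_sum) (auto intro!: int)
    also have "\<dots> = measure_pmf.expectation (\<kappa> x) (\<lambda>u. if good x u then \<theta> * a' x u - \<tau> * b' x u else 0)"
    proof (intro Bochner_Integration.integral_cong refl)
      fix u
      have "\<theta> * a' x u - \<tau> * b' x u = (\<Sum>y\<in>Y. (\<theta> * A * a x y - \<tau> * B * b x y) * V u x y)"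
        unfolding a'_def b'_def sum_distrib_left sum_subtractf[symmetric] left_diff_distrib mult.assoc ..
      then show "(\<Sum>y\<in>Y. (\<theta> * A * a x y - \<tau> * B * b x y) * (if good x u then V u x y else 0))
        = (if good x u then \<theta> * a' x u - \<tau> * b' x u else 0)"
        by (cases "good x u") simp_all
    qed
    finally show ?thesis .
  qed
  have "(\<Sum>x\<in>X. \<Sum>y\<in>Y. (\<theta> * A * a x y - \<tau> * B * b x y) *
        measure_pmf.expectation (\<kappa> x) (\<lambda>u. if good x u then V u x y else 0))
    \<le> (\<Sum>x\<in>X. if f x \<le> M then a' x (us ! (f x - 1)) - b' x (us ! (f x - 1)) else 0)"
    unfolding swap by (rule usf(3))
  also have "\<dots> = (\<Sum>i\<in>{1..Suc M}. G i)"
    unfolding G_def by (rule sum_by_fibres) (use usf(2) in auto)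
  also have "\<dots> \<le> (\<Sum>i\<in>{1..Suc M}. \<Sum>x\<in>X. if f x = i then (\<Sum>y\<in>Y. if acc (T i) x y then a x y - b x y else 0) else 0)"
    by (intro sum_mono T[rule_format, THEN conjunct2])
  also have "\<dots> = (\<Sum>x\<in>X. \<Sum>y\<in>Y. if acc (T (f x)) x y then a x y - b x y else 0)"
    by (rule sum_by_fibres[symmetric]) (use usf(2) in auto)
  finally show ?thesis using usf(2) T by (intro exI[of _ f] exI[of _ T] conjI allI) auto
qed

text \<open>Blocklength and information quantities are absent here: \<open>X\<close> and
  \<open>Y\<close> will be sets of blocks, a state will be the history of letters so far, and
  likelihood ratios are controlled only through the tests \<open>goodA\<close> and
  \<open>goodB\<close>.\<close>

locale covering_scheme =
  fixes X :: "'x set" and Y :: "'y set"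
    and \<kappa> :: "nat \<Rightarrow> 's \<Rightarrow> 'x \<Rightarrow> 'u pmf" and \<eta> :: "nat \<Rightarrow> 's \<Rightarrow> 'y \<Rightarrow> 'v pmf"
    and \<rho> :: "nat \<Rightarrow> 's \<Rightarrow> 'u pmf" and \<sigma> :: "nat \<Rightarrow> 's \<Rightarrow> 'v pmf"
    and stepA :: "'s \<Rightarrow> 'u \<Rightarrow> 's" and stepB :: "'s \<Rightarrow> 'v \<Rightarrow> 's"
    and goodA :: "nat \<Rightarrow> 's \<Rightarrow> 'u \<Rightarrow> 'x \<Rightarrow> bool" and goodB :: "nat \<Rightarrow> 's \<Rightarrow> 'v \<Rightarrow> 'y \<Rightarrow> bool"
    and final :: "'s \<Rightarrow> 'x \<Rightarrow> bool"
    and c d :: "nat \<Rightarrow> real" and M N :: "nat \<Rightarrow> nat" and \<theta> \<tau> :: real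
  assumes finite_XY: "finite X" "finite Y"
    and finite_kernels: "\<And>k s x. finite (set_pmf (\<kappa> k s x))" "\<And>k s y. finite (set_pmf (\<eta> k s y))"
      "\<And>k s. finite (set_pmf (\<rho> k s))" "\<And>k s. finite (set_pmf (\<sigma> k s))"
    and cd: "\<And>k. c k \<ge> 1" "\<And>k. d k \<ge> 1"
    and goodA: "\<And>k s x u. goodA k s u x \<Longrightarrow> pmf (\<kappa> k s x) u \<le> c k * pmf (\<rho> k s) u"
    and goodB: "\<And>k s y v. goodB k s v y \<Longrightarrow> pmf (\<eta> k s y) v \<le> d k * pmf (\<sigma> k s) v"
    and \<theta>: "0 \<le> \<theta>" "\<And>k. \<theta> \<le> 1 - (1 - 1 / c k) ^ M k" "\<And>k. \<theta> \<le> 1 - (1 - 1 / d k) ^ N k"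
    and \<tau>: "0 \<le> \<tau>" "\<And>k. real (M k) / c k \<le> \<tau>" "\<And>k. real (N k) / d k \<le> \<tau>"
begin

text \<open>The probability, given the inputs, that letters drawn exactly from the kernels pass
  every remaining test and \<open>final\<close>: the ideal protocol against which the deterministic
  one is measured.\<close>

primrec val :: "nat list \<Rightarrow> 's \<Rightarrow> 'x \<Rightarrow> 'y \<Rightarrow> real" where
  "val [] s x y = of_bool (final s x)"
| "val (k # ks) s x y =
     measure_pmf.expectation (\<kappa> k s x) (\<lambda>u. if goodA k s u x then
       measure_pmf.expectation (\<eta> k (stepA s u) y) (\<lambda>v. if goodB k (stepA s u) v y then
         val ks (stepB (stepA s u) v) x y else 0) else 0)"

lemma val_nonneg: "0 \<le> val ks s x y"
  by (induction ks arbitrary: s) auto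

text \<open>A round consists of two messages, and each costs a factor \<theta> on \<open>a\<close>
  and \<tau> on \<open>b\<close>, whence the exponent \<open>2 * length ks\<close>. State and
  payoffs vary in the induction because every branch has its own.\<close>

lemma exists_ptree:
  fixes a b :: "'x \<Rightarrow> 'y \<Rightarrow> real"
  assumes "\<And>x y. 0 \<le> a x y" "\<And>x y. 0 \<le> b x y"
  shows "\<exists>t. well_sized (\<lambda>k. Suc (M k)) (\<lambda>k. Suc (N k)) ks t \<and>
    (\<Sum>x\<in>X. \<Sum>y\<in>Y. (\<theta> ^ (2 * length ks) * a x y - \<tau> ^ (2 * length ks) * b x y) * val ks s x y)
    \<le> (\<Sum>x\<in>X. \<Sum>y\<in>Y. if accepts t x y then a x y - b x y else 0)"
  using assms
proof (induction ks arbitrary: s a b)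
  case Nil
  \<comment> \<open>The leaf takes the best decision, the sign of the payoff summed over
    \<open>y\<close>. It does at least as well as \<open>final\<close>, so \<open>final\<close>
    enters the bound but not the decision map.\<close>
  define d where "d x \<longleftrightarrow> 0 \<le> (\<Sum>y\<in>Y. a x y - b x y)" for x
  have "(\<Sum>y\<in>Y. (a x y - b x y) * of_bool (final s x)) \<le> (\<Sum>y\<in>Y. if d x then a x y - b x y else 0)" for x
    by (cases "final s x"; cases "d x") (auto simp: d_def)
  then have "(\<Sum>x\<in>X. \<Sum>y\<in>Y. (a x y - b x y) * of_bool (final s x))
      \<le> (\<Sum>x\<in>X. \<Sum>y\<in>Y. if d x then a x y - b x y else 0)"
    by (rule sum_mono)
  then show ?case
    by (intro exI[of _ "Dec d"]) simp
next
  case (Cons k ks)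
  let ?m = "\<lambda>k. Suc (M k)" and ?n = "\<lambda>k. Suc (N k)"
  define A where "A = \<theta> ^ (2 * length ks)"
  define B where "B = \<tau> ^ (2 * length ks)"
  have AB: "0 \<le> A" "0 \<le> B" "0 \<le> \<theta> * A" "0 \<le> \<tau> * B" using \<theta>(1) \<tau>(1) by (auto simp: A_def B_def)
  obtain t0 :: "('x, 'y) ptree" where t0: "well_sized ?m ?n ks t0" "\<forall>x y. \<not> accepts t0 x y"
    using exists_rejecting_ptree[of ?m ?n ks] by auto
  define W where "W s x y = measure_pmf.expectation (\<eta> k s y)
    (\<lambda>v. if goodB k s v y then val ks (stepB s v) x y else 0)" for s x y
  have W0: "0 \<le> W s x y" for s x y unfolding W_def by (auto simp: val_nonneg)
  \<comment> \<open>What follows a message of A is a reply map of B together with one subtree per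
    reply; the half round of B is therefore settled before that of A.\<close>
  define Z where "Z = (\<lambda>gT :: ('y \<Rightarrow> nat) \<times> (nat \<Rightarrow> ('x, 'y) ptree).
     (\<forall>y. fst gT y \<in> {1..Suc (N k)}) \<and> (\<forall>j. well_sized ?m ?n ks (snd gT j)))"
  define acc where "acc gT x y = accepts (snd gT (fst gT y)) x y"
    for gT :: "('y \<Rightarrow> nat) \<times> (nat \<Rightarrow> ('x, 'y) ptree)" and x y
  have B_step: "\<exists>gT. Z gT \<and>
      (\<Sum>x\<in>X. \<Sum>y\<in>Y. (\<theta> * A * a x y - \<tau> * B * b x y) * W s x y)
      \<le> (\<Sum>x\<in>X. \<Sum>y\<in>Y. if acc gT x y then a x y - b x y else 0)"
    if ab: "\<And>x y. 0 \<le> a x y" "\<And>x y. 0 \<le> b x y" for a b s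
  proof -
    have "\<exists>g T. (\<forall>y. g y \<in> {1..Suc (N k)}) \<and> (\<forall>j. well_sized ?m ?n ks (T j)) \<and>
      (\<Sum>y\<in>Y. \<Sum>x\<in>X. (\<theta> * A * a x y - \<tau> * B * b x y) *
        measure_pmf.expectation (\<eta> k s y) (\<lambda>v. if goodB k s v y then val ks (stepB s v) x y else 0))
      \<le> (\<Sum>y\<in>Y. \<Sum>x\<in>X. if accepts (T (g y)) x y then a x y - b x y else 0)"
    \<comment> \<open>The sender is now B, so \<open>x\<close> and \<open>y\<close> exchange roles;
      the sums are swapped back afterwards.\<close>
    proof (rule half_round[where a = "\<lambda>y x. a x y" and b = "\<lambda>y x. b x y" and c = "d k" and
          \<rho> = "\<sigma> k s" and V = "\<lambda>v y x. val ks (stepB s v) x y" and acc = "\<lambda>t y x. accepts t x y"])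
      show "\<exists>t. well_sized ?m ?n ks t \<and>
        (\<Sum>y\<in>Y. \<Sum>x\<in>X. (A * a y x - B * b y x) * val ks (stepB s v) x y)
        \<le> (\<Sum>y\<in>Y. \<Sum>x\<in>X. if accepts t x y then a y x - b y x else 0)"
        if "\<And>y x. 0 \<le> a y x" "\<And>y x. 0 \<le> b y x" for v and a b :: "'y \<Rightarrow> 'x \<Rightarrow> real"
        using Cons.IH[of "\<lambda>x y. a y x" "\<lambda>x y. b y x" "stepB s v"] that
        unfolding A_def B_def by (simp add: sum.swap[of _ Y X])
    qed (use finite_kernels finite_XY cd goodB \<theta> \<tau> AB val_nonneg t0 ab in auto)
    then obtain g T where gT: "Z (g, T)"
      "(\<Sum>y\<in>Y. \<Sum>x\<in>X. (\<theta> * A * a x y - \<tau> * B * b x y) * W s x y)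
      \<le> (\<Sum>y\<in>Y. \<Sum>x\<in>X. if acc (g, T) x y then a x y - b x y else 0)"
      unfolding Z_def acc_def W_def fst_conv snd_conv by iprover
    show ?thesis
      by (rule exI[of _ "(g, T)"], subst (1 2) sum.swap, rule conjI[OF gT])
  qed
  have "\<exists>f T. (\<forall>x. f x \<in> {1..Suc (M k)}) \<and> (\<forall>i. Z (T i)) \<and>
    (\<Sum>x\<in>X. \<Sum>y\<in>Y. (\<theta> * (\<theta> * A) * a x y - \<tau> * (\<tau> * B) * b x y) *
        measure_pmf.expectation (\<kappa> k s x) (\<lambda>u. if goodA k s u x then W (stepA s u) x y else 0))
    \<le> (\<Sum>x\<in>X. \<Sum>y\<in>Y. if acc (T (f x)) x y then a x y - b x y else 0)"
  proof (rule half_round[where c = "c k" and \<rho> = "\<rho> k s"])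
    show "\<exists>gT. Z gT \<and> (\<forall>x y. \<not> acc gT x y)"
      using t0 by (intro exI[of _ "(\<lambda>_. 1, \<lambda>_. t0)"]) (auto simp: Z_def acc_def)
  qed (use finite_kernels finite_XY cd goodA \<theta> \<tau> AB W0 B_step Cons.prems in auto)
  then obtain f T where f: "\<And>x. f x \<in> {1..Suc (M k)}" and T: "\<And>i. Z (T i)" and
    le: "(\<Sum>x\<in>X. \<Sum>y\<in>Y. (\<theta> * (\<theta> * A) * a x y - \<tau> * (\<tau> * B) * b x y) * val (k # ks) s x y)
    \<le> (\<Sum>x\<in>X. \<Sum>y\<in>Y. if acc (T (f x)) x y then a x y - b x y else 0)"
    unfolding W_def val.simps by iprover
  define t where "t = Round f (\<lambda>i. fst (T i)) (\<lambda>(i, j). snd (T i) j)"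
  have "well_sized ?m ?n (k # ks) t"
    using f T unfolding t_def Z_def by auto
  moreover have "accepts t x y = acc (T (f x)) x y" for x y
    unfolding t_def acc_def by simp
  moreover have "\<theta> ^ (2 * length (k # ks)) = \<theta> * (\<theta> * A)" "\<tau> ^ (2 * length (k # ks)) = \<tau> * (\<tau> * B)"
    unfolding A_def B_def by (simp_all add: mult.assoc)
  ultimately show ?case using le by (intro exI[of _ t]) (simp only:)
qed

end

section \<open>Interactive protocols as trees\<close>

text \<open>A's own messages are recomputed from \<open>x\<close> on the way down, so the list of
  B's messages determines the node, as the signature of an encoder requires. The value 1 is a filler
  for lists that reach a leaf.\<close>

primrec msgA :: "nat list \<Rightarrow> ('x, 'y) ptree \<Rightarrow> 'x \<Rightarrow> nat" where
  "msgA [] t x = (case t of Dec d \<Rightarrow> 1 | Round f g s \<Rightarrow> f x)"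
| "msgA (j # gs) t x = (case t of Dec d \<Rightarrow> 1 | Round f g s \<Rightarrow> msgA gs (s (f x, j)) x)"

text \<open>The list ends with A's message of the current round, so a list of length
  \<open>k\<close> is answered at depth \<open>k - 1\<close>, one node higher than in
  \<open>msgA\<close>.\<close>

primrec msgB :: "nat list \<Rightarrow> ('x, 'y) ptree \<Rightarrow> 'y \<Rightarrow> nat" where
  "msgB [] t y = 1"
| "msgB (i # fs) t y = (case t of Dec d \<Rightarrow> 1 | Round f g s \<Rightarrow>
     if fs = [] then g i y else msgB fs (s (i, g i y)) y)"

primrec verdict :: "nat list \<Rightarrow> ('x, 'y) ptree \<Rightarrow> 'x \<Rightarrow> nat" where
  "verdict [] t x = (case t of Dec d \<Rightarrow> if d x then 0 else 1 | Round f g s \<Rightarrow> 1)"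
| "verdict (j # gs) t x = (case t of Dec d \<Rightarrow> 1 | Round f g s \<Rightarrow> verdict gs (s (f x, j)) x)"

primrec path :: "nat \<Rightarrow> ('x, 'y) ptree \<Rightarrow> 'x \<Rightarrow> 'y \<Rightarrow> nat list \<times> nat list" where
  "path 0 t x y = ([], [])"
| "path (Suc k) t x y = (case t of Dec d \<Rightarrow> ([], []) | Round f g s \<Rightarrow>
     (let i = f x; j = g i y; (fs, gs) = path k (s (i, j)) x y in (i # fs, j # gs)))"

definition code_of_ptree ::
    "(nat \<Rightarrow> nat) \<Rightarrow> (nat \<Rightarrow> nat) \<Rightarrow> ('x list, 'y list) ptree \<Rightarrow> ('x, 'y) code" where
  "code_of_ptree m m' t =
     \<lparr>enc_A = (\<lambda>k xs gs. msgA gs t xs), enc_B = (\<lambda>k ys fs. msgB fs t ys), size_A = m, size_B = m',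
      decision = (\<lambda>xs gs. verdict gs t xs)\<rparr>"

text \<open>\<open>path\<close> grows at the front and \<open>transcript\<close> at the end; peeling
  off the last round rather than the first reconciles the two.\<close>

lemma path_Suc:
  assumes "well_sized m m' ks t" "k < length ks"
  shows "path (Suc k) t x y = (let (fs, gs) = path k t x y; i = msgA gs t x in
           (fs @ [i], gs @ [msgB (fs @ [i]) t y]))"
  using assms
proof (induction k arbitrary: ks t)
  case 0
  then show ?case by (cases ks) (auto simp: Let_def)
next
  case (Suc k)
  then obtain k0 ks' where ks: "ks = k0 # ks'" by (cases ks) auto
  from Suc.prems(1) obtain f g s where t: "t = Round f g s" and ws: "\<And>ij. well_sized m m' ks' (s ij)"
    unfolding ks by auto
  obtain fs gs where p: "path k (s (f x, g (f x) y)) x y = (fs, gs)" by fastforce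
  show ?case
    using Suc.IH[OF ws, of "(f x, g (f x) y)"] Suc.prems(2)
    unfolding t ks path.simps(2)[of "Suc k"] path.simps(2)[of k "Round f g s"]
    by (simp add: Let_def p)
qed

lemma msgA_range:
  "well_sized m m' ks t \<Longrightarrow> length gs < length ks \<Longrightarrow> msgA gs t x \<in> {1..m (ks ! length gs)}"
proof (induction gs arbitrary: ks t)
  case Nil
  then show ?case by (cases ks) auto
next
  case (Cons j gs)
  then obtain k0 ks' where ks: "ks = k0 # ks'" by (cases ks) auto
  with Cons.prems obtain f g s where t: "t = Round f g s" and
    ws: "\<And>ij. well_sized m m' ks' (s ij)"
    by auto
  show ?case
    using Cons.IH[OF ws, of "(f x, j)"] Cons.prems(2) unfolding ks t by auto
qed

lemma msgB_range:
  "well_sized m m' ks t \<Longrightarrow> fs \<noteq> [] \<Longrightarrow> length fs \<le> length ks \<Longrightarrow>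
    msgB fs t y \<in> {1..m' (ks ! (length fs - 1))}"
proof (induction fs arbitrary: ks t)
  case (Cons i fs)
  then obtain k0 ks' where ks: "ks = k0 # ks'" by (cases ks) auto
  with Cons.prems obtain f g s where t: "t = Round f g s" and
    ws: "\<And>ij. well_sized m m' ks' (s ij)" and g: "\<And>i y. g i y \<in> {1..m' k0}"
    by auto
  show ?case
    using Cons.IH[OF ws, of "(i, g i y)"] Cons.prems(3) g[of i y] unfolding ks t
    by (cases fs) auto
qed simp

lemma verdict_range: "verdict gs t x \<in> {0, 1}"
  by (induction gs arbitrary: t) (auto split: ptree.splits)

lemma verdict_path:
  "well_sized m m' ks t \<Longrightarrow>
    verdict (snd (path (length ks) t x y)) t x = (if accepts t x y then 0 else 1)"
proof (induction ks arbitrary: t)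
  case (Cons k ks)
  then obtain f g s where t: "t = Round f g s" and ws: "\<And>ij. well_sized m m' ks (s ij)"
    by auto
  show ?case
    using Cons.IH[OF ws, of "(f x, g (f x) y)"] unfolding t
    by (auto simp: Let_def split: prod.splits)
qed auto

lemma transcript_code_of_ptree:
  assumes "well_sized m m' ks t" "k \<le> length ks"
  shows "transcript (code_of_ptree m m' t) xs ys k = path k t xs ys"
  using assms(2)
proof (induction k)
  case (Suc k)
  then show ?case
    using path_Suc[OF assms(1), of k xs ys] by (simp add: code_of_ptree_def Let_def split: prod.splits)
qed simp

lemma is_code_of_ptree:
  assumes "well_sized m m' [1..<Suc K] t"
  shows "is_code K n (code_of_ptree m m' t)"
proof -
  have "msgA gs t xs \<in> {1..m k}" if "k \<in> {1..K}" "gs \<in> tuples A (k - 1)" for k gs A xs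
    \<comment> \<open>Round \<open>k\<close> sits at position \<open>k - 1\<close> of
      \<open>[1..<Suc K]\<close>, and \<open>gs\<close> has length \<open>k - 1\<close>.\<close>
    using msgA_range[OF assms, of gs xs] that by (auto simp: tuples_def nth_append simp del: upt_Suc)
  moreover have "msgB fs t ys \<in> {1..m' k}" if "k \<in> {1..K}" "fs \<in> tuples A k" for k fs A ys
  proof -
    have "length fs = k" using that by (auto simp: tuples_def)
    then show ?thesis
      using msgB_range[OF assms, of fs ys] that by (cases fs) (auto simp del: upt_Suc)
  qed
  ultimately show ?thesis
    using verdict_range[of _ t] unfolding is_code_def code_of_ptree_def
    by (auto simp del: upt_Suc)
qed

lemma decision_code_of_ptree:
  assumes "well_sized m m' [1..<Suc K] t"
  shows "decision (code_of_ptree m m' t) xs (snd (transcript (code_of_ptree m m' t) xs ys K))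
    = (if accepts t xs ys then 0 else 1)"
  using verdict_path[OF assms, of xs ys] transcript_code_of_ptree[OF assms, of K xs ys]
  by (simp add: code_of_ptree_def del: upt_Suc)

section \<open>Independent sequences\<close>

lemma expectation_bind_pmf:
  fixes h :: "'b \<Rightarrow> real"
  assumes "finite (set_pmf p)" "\<And>x. x \<in> set_pmf p \<Longrightarrow> finite (set_pmf (f x))"
  shows "measure_pmf.expectation (bind_pmf p f) h =
    measure_pmf.expectation p (\<lambda>x. measure_pmf.expectation (f x) h)"
  using assms
  by (subst pmf_expectation_bind[of "set_pmf p"]) (auto simp: integral_measure_pmf[of "set_pmf p"])

lemma expectation_finite_pmf:
  fixes h :: "'a \<Rightarrow> real"
  assumes "finite (set_pmf p)"
  shows "measure_pmf.expectation p h = (\<Sum>x\<in>set_pmf p. pmf p x * h x)"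
  using assms by (subst integral_measure_pmf[of "set_pmf p"]) auto

lemma expectation_mono_pmf:
  fixes f g :: "'a \<Rightarrow> real"
  assumes "finite (set_pmf p)" "\<And>x. x \<in> set_pmf p \<Longrightarrow> f x \<le> g x"
  shows "measure_pmf.expectation p f \<le> measure_pmf.expectation p g"
  using assms by (simp add: expectation_finite_pmf sum_mono mult_left_mono)

lemma prob_eq_expectation:
  "measure_pmf.prob p {x. Z x} = measure_pmf.expectation p (\<lambda>x. of_bool (Z x))"
proof -
  have "(\<lambda>x. of_bool (Z x) :: real) = indicator {x. Z x}" by (auto simp: indicator_def)
  then show ?thesis by simp
qed

text \<open>Independent coordinates with different laws: at each position a kernel sees the past of
  that position.\<close>

primrec seq_pmf :: "'a pmf list \<Rightarrow> 'a list pmf" where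
  "seq_pmf [] = return_pmf []"
| "seq_pmf (p # ps) = do {x \<leftarrow> p; xs \<leftarrow> seq_pmf ps; return_pmf (x # xs)}"

lemma set_seq_pmf: "set_pmf (seq_pmf ps) = {xs. list_all2 (\<lambda>x p. x \<in> set_pmf p) xs ps}"
  by (induction ps) (auto simp: list_all2_Cons2)

lemma finite_set_seq_pmf: "(\<And>p. p \<in> set ps \<Longrightarrow> finite (set_pmf p)) \<Longrightarrow> finite (set_pmf (seq_pmf ps))"
  by (induction ps) auto

lemma length_seq_pmf: "xs \<in> set_pmf (seq_pmf ps) \<Longrightarrow> length xs = length ps"
  by (auto simp: set_seq_pmf dest: list_all2_lengthD)

lemma seq_pmf_replicate: "seq_pmf (replicate n p) = replicate_pmf n p"
  by (induction n) auto

text \<open>Independent draws commute, so all first stages can be moved in front of all second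
  stages. This turns single-letter kernels into block kernels.\<close>

lemma seq_pmf_bind:
  "seq_pmf (map (\<lambda>i. bind_pmf (A i) (B i)) is) =
    bind_pmf (seq_pmf (map A is)) (\<lambda>as. seq_pmf (map2 B is as))"
proof (induction "is")
  case (Cons i "is")
  let ?S = "seq_pmf (map A is)"
  have "seq_pmf (map (\<lambda>i. bind_pmf (A i) (B i)) (i # is)) =
    bind_pmf (A i) (\<lambda>a. bind_pmf (B i a) (\<lambda>b. bind_pmf ?S
      (\<lambda>as. bind_pmf (seq_pmf (map2 B is as)) (\<lambda>bs. return_pmf (b # bs)))))"
    using Cons.IH by (simp add: bind_assoc_pmf)
  also have "\<dots> = bind_pmf (A i) (\<lambda>a. bind_pmf ?S (\<lambda>as. bind_pmf (B i a)
      (\<lambda>b. bind_pmf (seq_pmf (map2 B is as)) (\<lambda>bs. return_pmf (b # bs)))))"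
    by (subst bind_commute_pmf) (rule refl)
  also have "\<dots> = bind_pmf (seq_pmf (map A (i # is))) (\<lambda>as. seq_pmf (map2 B (i # is) as))"
    by (simp add: bind_assoc_pmf bind_return_pmf)
  finally show ?case .
qed (simp add: bind_return_pmf)

lemma seq_pmf_return: "seq_pmf (map (\<lambda>i. return_pmf (f i)) is) = return_pmf (map f is)"
  by (induction "is") (auto simp: bind_return_pmf)

lemma pmf_bind_Cons:
  "pmf (bind_pmf p (\<lambda>x. bind_pmf q (\<lambda>xs. return_pmf (x # xs)))) (a # as) = pmf p a * pmf q as"
proof -
  have "bind_pmf p (\<lambda>x. bind_pmf q (\<lambda>xs. return_pmf (x # xs))) = map_pmf (\<lambda>(x, xs). x # xs) (pair_pmf p q)"
    by (simp add: pair_pmf_def map_bind_pmf)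
  moreover have "pmf (map_pmf (\<lambda>(x, xs). x # xs) (pair_pmf p q)) ((\<lambda>(x, xs). x # xs) (a, as)) = pmf (pair_pmf p q) (a, as)"
    by (rule pmf_map_inj') (auto simp: inj_on_def)
  ultimately show ?thesis by (simp add: pmf_pair)
qed

lemma pmf_replicate_pmf:
  "length as = n \<Longrightarrow> pmf (replicate_pmf n p) as = prod_list (map (pmf p) as)"
proof (induction n arbitrary: as)
  case (Suc n)
  then obtain a as' where as: "as = a # as'" by (cases as) auto
  show ?case
    using Suc unfolding as by (simp add: pmf_bind_Cons)
qed simp

lemma finite_set_replicate_pmf: "finite (set_pmf p) \<Longrightarrow> finite (set_pmf (replicate_pmf n p))"
  by (auto intro!: finite_set_seq_pmf simp flip: seq_pmf_replicate)

lemma expectation_replicate_Suc: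
  fixes h :: "'a list \<Rightarrow> real"
  assumes "finite (set_pmf p)"
  shows "measure_pmf.expectation (replicate_pmf (Suc n) p) h =
    measure_pmf.expectation p (\<lambda>x. measure_pmf.expectation (replicate_pmf n p) (\<lambda>xs. h (x # xs)))"
  using assms by (simp add: expectation_bind_pmf finite_set_replicate_pmf)

text \<open>Independence and centring kill the cross terms of the square.\<close>

lemma expectation_centred_sum:
  fixes g :: "'a \<Rightarrow> real"
  assumes fin: "finite (set_pmf p)" and centred: "measure_pmf.expectation p g = 0"
  shows "measure_pmf.expectation (replicate_pmf n p) (\<lambda>xs. sum_list (map g xs)) = 0"
    and "measure_pmf.expectation (replicate_pmf n p) (\<lambda>xs. (sum_list (map g xs))\<^sup>2)
      = n * measure_pmf.expectation p (\<lambda>x. (g x)\<^sup>2)"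
proof -
  have int [simp]: "integrable (measure_pmf p) F" "integrable (measure_pmf (replicate_pmf n p)) G"
    for F :: "'a \<Rightarrow> real" and n and G :: "'a list \<Rightarrow> real"
    using fin by (auto intro!: integrable_measure_pmf_finite finite_set_replicate_pmf)
  have first: "measure_pmf.expectation (replicate_pmf n p) (\<lambda>xs. sum_list (map g xs)) = 0" for n
  proof (induction n)
    case (Suc n)
    then show ?case
      unfolding expectation_replicate_Suc[OF fin] by (simp add: centred)
  qed simp
  then show "measure_pmf.expectation (replicate_pmf n p) (\<lambda>xs. sum_list (map g xs)) = 0" .
  show "measure_pmf.expectation (replicate_pmf n p) (\<lambda>xs. (sum_list (map g xs))\<^sup>2)
      = n * measure_pmf.expectation p (\<lambda>x. (g x)\<^sup>2)"
  proof (induction n)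
    case (Suc n)
    have "measure_pmf.expectation (replicate_pmf n p) (\<lambda>xs. (g x + sum_list (map g xs))\<^sup>2)
      = (g x)\<^sup>2 + n * measure_pmf.expectation p (\<lambda>x. (g x)\<^sup>2)" for x
      using Suc first[of n] by (simp add: power2_sum)
    then show ?case
      unfolding expectation_replicate_Suc[OF fin] by (simp add: algebra_simps)
  qed simp
qed

text \<open>Chebyshev's inequality, with variance \<open>n * S\<close> of the centred sum.\<close>

lemma weak_law:
  fixes g :: "'a \<Rightarrow> real" and \<gamma> :: real
  assumes fin: "finite (set_pmf p)" and \<gamma>: "\<gamma> > 0"
  shows "(\<lambda>n. measure_pmf.prob (replicate_pmf n p)
      {xs. \<bar>sum_list (map g xs) - n * measure_pmf.expectation p g\<bar> > n * \<gamma>}) \<longlonglongrightarrow> 0"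
proof -
  define h where "h x = g x - measure_pmf.expectation p g" for x
  define S where "S = measure_pmf.expectation p (\<lambda>x. (h x)\<^sup>2)"
  have int: "integrable (measure_pmf p) F" for F :: "'a \<Rightarrow> real"
    using fin by (rule integrable_measure_pmf_finite)
  have centred: "measure_pmf.expectation p h = 0"
    unfolding h_def by (simp add: int)
  have le: "measure_pmf.prob (replicate_pmf n p)
      {xs. \<bar>sum_list (map g xs) - n * measure_pmf.expectation p g\<bar> > n * \<gamma>} \<le> (S / \<gamma>\<^sup>2) / n" if n: "n > 0" for n
  proof -
    have sum: "sum_list (map h xs) = sum_list (map g xs) - n * measure_pmf.expectation p g"
      if "length xs = n" for xs
      using that unfolding h_def by (simp add: sum_list_subtractf sum_list_triv)
    have "measure_pmf.prob (replicate_pmf n p)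
        {xs. \<bar>sum_list (map g xs) - n * measure_pmf.expectation p g\<bar> > n * \<gamma>}
      \<le> measure_pmf.expectation (replicate_pmf n p) (\<lambda>xs. (sum_list (map h xs))\<^sup>2 / (n * \<gamma>)\<^sup>2)"
      unfolding prob_eq_expectation
    proof (rule expectation_mono_pmf[OF finite_set_replicate_pmf[OF fin]])
      fix xs assume "xs \<in> set_pmf (replicate_pmf n p)"
      then have "length xs = n" by (auto simp: set_replicate_pmf)
      note sum = sum[OF this]
      show "of_bool (\<bar>sum_list (map g xs) - n * measure_pmf.expectation p g\<bar> > n * \<gamma>)
        \<le> (sum_list (map h xs))\<^sup>2 / (n * \<gamma>)\<^sup>2"
      proof (cases "\<bar>sum_list (map g xs) - n * measure_pmf.expectation p g\<bar> > n * \<gamma>")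
        case True
        then have "(n * \<gamma>)\<^sup>2 \<le> (sum_list (map h xs))\<^sup>2"
          unfolding sum using \<gamma> by (intro abs_le_square_iff[THEN iffD1]) auto
        then show ?thesis using True n \<gamma> by (simp add: le_divide_eq)
      qed simp
    qed
    also have "\<dots> = (n * S) / (n * \<gamma>)\<^sup>2"
      using expectation_centred_sum(2)[OF fin centred, of n] unfolding S_def by simp
    also have "\<dots> = (S / \<gamma>\<^sup>2) / n" using n by (simp add: power2_eq_square)
    finally show ?thesis .
  qed
  show ?thesis
  proof (rule real_tendsto_sandwich[where f = "\<lambda>_. 0" and h = "\<lambda>n. (S / \<gamma>\<^sup>2) / real n"])
    show "\<forall>\<^sub>F n in sequentially. measure_pmf.prob (replicate_pmf n p)
      {xs. \<bar>sum_list (map g xs) - n * measure_pmf.expectation p g\<bar> > n * \<gamma>} \<le> (S / \<gamma>\<^sup>2) / real n"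
      using eventually_gt_at_top[of 0] by eventually_elim (rule le)
    show "(\<lambda>n. (S / \<gamma>\<^sup>2) / real n) \<longlonglongrightarrow> 0" by (rule lim_const_over_n)
    show "(\<lambda>_. 0 :: real) \<longlonglongrightarrow> 0" by simp
  qed (auto simp: eventually_sequentially)
qed

section \<open>The method of types and Sanov's upper bound\<close>

definition rel_ent :: "'a pmf \<Rightarrow> 'a pmf \<Rightarrow> real" where
  "rel_ent p q = (\<Sum>x\<in>set_pmf p. pmf p x * log 2 (pmf p x / pmf q x))"

lemma sum_list_eq_sum_count:
  fixes f :: "'a \<Rightarrow> real"
  assumes "finite S" "set xs \<subseteq> S"
  shows "(\<Sum>x\<leftarrow>xs. f x) = (\<Sum>x\<in>S. count (mset xs) x * f x)"
  using assms(2)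
proof (induction xs)
  case (Cons x xs)
  have "(\<Sum>y\<in>S. count (mset (x # xs)) y * f y)
      = (\<Sum>y\<in>S. (if y = x then f y else 0) + count (mset xs) y * f y)"
    by (intro sum.cong) (auto simp: algebra_simps)
  also have "\<dots> = f x + (\<Sum>y\<in>S. count (mset xs) y * f y)"
    using assms(1) Cons.prems by (simp add: sum.distrib)
  finally show ?case using Cons by simp
qed simp

text \<open>Change of measure: on the sequences of type \<open>t\<close> the \<open>n\<close>-fold
  laws of \<open>q\<close> and \<open>t\<close> have the constant ratio
  \<open>2 powr (- n * rel_ent t q)\<close>, and the type class has probability at most 1 under the
  latter.\<close>

lemma prob_type_class_le:
  assumes xs: "length xs = n" "n > 0" "set xs \<subseteq> set_pmf q"
  shows "measure_pmf.prob (replicate_pmf n q) {zs. mset zs = mset xs}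
    \<le> 2 powr (- real n * rel_ent (pmf_of_multiset (mset xs)) q)"
proof -
  define t where "t = pmf_of_multiset (mset xs)"
  have ne: "mset xs \<noteq> {#}" using xs by auto
  have t: "pmf t x = count (mset xs) x / n" "set_pmf t = set xs" for x
    unfolding t_def using ne xs(1) by auto
  have pos: "pmf t x > 0" "pmf q x > 0" if "x \<in> set xs" for x
    using that xs(3) t(2) by (auto simp: pmf_positive)
  have "(\<Sum>x\<leftarrow>xs. log 2 (pmf t x / pmf q x)) = (\<Sum>x\<in>set xs. count (mset xs) x * log 2 (pmf t x / pmf q x))"
    by (rule sum_list_eq_sum_count) auto
  also have "\<dots> = n * rel_ent t q"
    unfolding rel_ent_def t using xs(2) by (simp add: sum_distrib_left)
  finally have sum: "(\<Sum>x\<leftarrow>xs. log 2 (pmf t x / pmf q x)) = n * rel_ent t q" .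
  \<comment> \<open>\<open>t\<close> stays the type of \<open>xs\<close> while the induction runs
    over shorter lists.\<close>
  have ratio: "prod_list (map (pmf q) ys) = 2 powr (- (\<Sum>x\<leftarrow>ys. log 2 (pmf t x / pmf q x))) * prod_list (map (pmf t) ys)"
    if "set ys \<subseteq> set xs" for ys
    using that
  proof (induction ys)
    case (Cons y ys)
    then have "pmf t y > 0" "pmf q y > 0" using pos by auto
    then have y: "pmf q y = 2 powr (- log 2 (pmf t y / pmf q y)) * pmf t y"
      by (simp add: powr_minus)
    have "prod_list (map (pmf q) (y # ys)) = 2 powr (- log 2 (pmf t y / pmf q y)) * pmf t y *
        (2 powr (- (\<Sum>x\<leftarrow>ys. log 2 (pmf t x / pmf q x))) * prod_list (map (pmf t) ys))"
      using Cons y by simp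
    also have "\<dots> = 2 powr (- log 2 (pmf t y / pmf q y) + - (\<Sum>x\<leftarrow>ys. log 2 (pmf t x / pmf q x))) *
        prod_list (map (pmf t) (y # ys))"
      unfolding powr_add by simp
    finally show ?case by simp
  qed simp
  let ?A = "{zs. mset zs = mset xs}"
  have fin: "finite ?A" by (rule finite_subset[OF _ finite_lists_length_eq[of "set xs" n]])
      (auto dest: mset_eq_setD mset_eq_length simp: xs)
  have eq: "pmf (replicate_pmf n q) zs = 2 powr (- real n * rel_ent t q) * pmf (replicate_pmf n t) zs"
    if "zs \<in> ?A" for zs
  proof -
    have zs: "length zs = n" "mset zs = mset xs" using that mset_eq_length xs(1) by auto
    have p: "prod_list (map f zs) = prod_list (map f xs)" for f :: "'a \<Rightarrow> real"
      using zs(2) by (metis mset_map prod_mset_prod_list)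
    show ?thesis
      using ratio[of xs] sum by (simp add: pmf_replicate_pmf zs(1) p)
  qed
  have "measure_pmf.prob (replicate_pmf n q) ?A = (\<Sum>zs\<in>?A. pmf (replicate_pmf n q) zs)"
    by (rule measure_measure_pmf_finite[OF fin])
  also have "\<dots> = 2 powr (- real n * rel_ent t q) * (\<Sum>zs\<in>?A. pmf (replicate_pmf n t) zs)"
    by (simp add: eq sum_distrib_left)
  also have "(\<Sum>zs\<in>?A. pmf (replicate_pmf n t) zs) = measure_pmf.prob (replicate_pmf n t) ?A"
    by (rule measure_measure_pmf_finite[OF fin, symmetric])
  also have "2 powr (- real n * rel_ent t q) * measure_pmf.prob (replicate_pmf n t) ?A \<le> 2 powr (- real n * rel_ent t q) * 1"
    by (intro mult_left_mono) auto
  finally show ?thesis unfolding t_def by simp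
qed

text \<open>A type is determined by its counts on the support of \<open>q\<close>, each between 0
  and \<open>n\<close>, so only polynomially many type classes matter; the union bound over them
  costs the factor in front.\<close>

lemma sanov_upper_bound:
  assumes fin: "finite (set_pmf q)" and n: "n > 0"
    and E: "\<And>xs. xs \<in> A \<Longrightarrow> length xs = n \<Longrightarrow> set xs \<subseteq> set_pmf q \<Longrightarrow>
      E \<le> rel_ent (pmf_of_multiset (mset xs)) q"
  shows "measure_pmf.prob (replicate_pmf n q) A \<le> real (n + 1) ^ card (set_pmf q) * 2 powr (- real n * E)"
proof -
  let ?B = "A \<inter> {xs. length xs = n \<and> set xs \<subseteq> set_pmf q}"
  have finB: "finite ?B"
    by (rule finite_subset[OF _ finite_lists_length_eq[OF fin, of n]]) auto
  have "card (mset ` ?B) \<le> card (set_pmf q \<rightarrow>\<^sub>E {0..n})"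
  proof (rule card_inj_on_le)
    show "inj_on (\<lambda>m. restrict (count m) (set_pmf q)) (mset ` ?B)"
    proof (rule inj_onI)
      fix m m' assume m: "m \<in> mset ` ?B" "m' \<in> mset ` ?B"
        and eq: "restrict (count m) (set_pmf q) = restrict (count m') (set_pmf q)"
      show "m = m'"
      proof (rule multiset_eqI)
        fix x show "count m x = count m' x"
        proof (cases "x \<in> set_pmf q")
          case True
          then show ?thesis using fun_cong[OF eq, of x] by simp
        next
          case False
          then have "x \<notin># m" "x \<notin># m'" using m by auto
          then show ?thesis by (simp add: not_in_iff)
        qed
      qed
    qed
    show "(\<lambda>m. restrict (count m) (set_pmf q)) ` mset ` ?B \<subseteq> set_pmf q \<rightarrow>\<^sub>E {0..n}"
    proof (rule image_subsetI)
      fix m assume "m \<in> mset ` ?B"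
      then have "count m x \<le> n" for x using count_le_size[of m x] by auto
      then show "restrict (count m) (set_pmf q) \<in> set_pmf q \<rightarrow>\<^sub>E {0..n}" by auto
    qed
    show "finite (set_pmf q \<rightarrow>\<^sub>E {0..n})" using fin by (intro finite_PiE) auto
  qed
  also have "\<dots> = (n + 1) ^ card (set_pmf q)" using fin by (simp add: card_PiE)
  finally have card: "card (mset ` ?B) \<le> (n + 1) ^ card (set_pmf q)" .
  have "measure_pmf.prob (replicate_pmf n q) A = measure_pmf.prob (replicate_pmf n q) ?B"
    by (rule measure_prob_cong_0) (auto simp: pmf_eq_0_set_pmf set_replicate_pmf)
  also have "\<dots> \<le> measure_pmf.prob (replicate_pmf n q) (\<Union>m\<in>mset ` ?B. {zs. mset zs = m})"
    by (intro measure_pmf.finite_measure_mono) auto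
  also have "\<dots> \<le> (\<Sum>m\<in>mset ` ?B. measure_pmf.prob (replicate_pmf n q) {zs. mset zs = m})"
    using finB by (intro measure_pmf.finite_measure_subadditive_finite) auto
  also have "\<dots> \<le> (\<Sum>m\<in>mset ` ?B. 2 powr (- real n * E))"
  proof (rule sum_mono)
    fix m assume "m \<in> mset ` ?B"
    then obtain xs where xs: "m = mset xs" "xs \<in> A" "length xs = n" "set xs \<subseteq> set_pmf q" by auto
    have "measure_pmf.prob (replicate_pmf n q) {zs. mset zs = m} \<le> 2 powr (- real n * rel_ent (pmf_of_multiset (mset xs)) q)"
      unfolding xs(1) by (rule prob_type_class_le) (use xs n in auto)
    also have "\<dots> \<le> 2 powr (- real n * E)"
      using E[OF xs(2-4)] by (intro powr_mono) (auto intro!: mult_left_mono)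
    finally show "measure_pmf.prob (replicate_pmf n q) {zs. mset zs = m} \<le> 2 powr (- real n * E)" .
  qed
  also have "\<dots> = card (mset ` ?B) * 2 powr (- real n * E)" by simp
  also have "\<dots> \<le> real (n + 1) ^ card (set_pmf q) * 2 powr (- real n * E)"
    using of_nat_mono[OF card, where 'a = real] by (intro mult_right_mono) (simp_all del: of_nat_Suc add: add.commute)
  finally show ?thesis .
qed

section \<open>Information quantities of finitely supported laws\<close>

lemma absolutely_continuous_pmf_iff:
  "absolutely_continuous (measure_pmf q) (measure_pmf p) \<longleftrightarrow> set_pmf p \<subseteq> set_pmf q"
proof
  assume ac: "absolutely_continuous (measure_pmf q) (measure_pmf p)"
  have "measure_pmf.prob q (- set_pmf q) = 0" by (subst measure_pmf_zero_iff) auto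
  then have "- set_pmf q \<in> null_sets (measure_pmf q)"
    by (simp add: null_sets_def measure_pmf.emeasure_eq_measure)
  then have "- set_pmf q \<in> null_sets (measure_pmf p)"
    using ac by (auto simp: absolutely_continuous_def)
  then have "measure_pmf.prob p (- set_pmf q) = 0"
    by (simp add: null_sets_def measure_pmf.emeasure_eq_measure)
  then show "set_pmf p \<subseteq> set_pmf q" by (subst (asm) measure_pmf_zero_iff) auto
next
  assume sub: "set_pmf p \<subseteq> set_pmf q"
  show "absolutely_continuous (measure_pmf q) (measure_pmf p)"
    unfolding absolutely_continuous_def
  proof
    fix A assume "A \<in> null_sets (measure_pmf q)"
    then have "measure_pmf.prob q A = 0"
      by (simp add: null_sets_def measure_pmf.emeasure_eq_measure)
    then have "measure_pmf.prob p A = 0" using sub by (auto simp: measure_pmf_zero_iff)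
    then show "A \<in> null_sets (measure_pmf p)"
      by (simp add: null_sets_def measure_pmf.emeasure_eq_measure)
  qed
qed

text \<open>The density of \<open>p\<close> relative to \<open>q\<close> is the quotient of the mass
  functions; integration is over \<open>q\<close>, which restores the weight
  \<open>pmf p x\<close>.\<close>

lemma KL_divergence_pmf:
  assumes fin: "finite (set_pmf p)" and sub: "set_pmf p \<subseteq> set_pmf q"
  shows "KL_divergence 2 (measure_pmf q) (measure_pmf p) = rel_ent p q"
proof -
  define f where "f x = pmf p x / pmf q x" for x
  have f0: "0 \<le> f x" for x by (simp add: f_def)
  have "measure_pmf p = density (measure_pmf q) f"
  proof (rule measure_eqI)
    fix A
    have eq: "ennreal (pmf q x) * ennreal (f x) = ennreal (pmf p x)" for x
      using sub by (cases "x \<in> set_pmf q")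
        (auto simp: f_def ennreal_mult[symmetric] pmf_positive_iff set_pmf_eq subset_iff)
    have "emeasure (density (measure_pmf q) f) A = (\<integral>\<^sup>+x. ennreal (f x) * indicator A x \<partial>measure_pmf q)"
      by (subst emeasure_density) auto
    also have "\<dots> = (\<integral>\<^sup>+x. ennreal (pmf p x) * indicator A x \<partial>count_space UNIV)"
      unfolding nn_integral_measure_pmf by (simp add: eq mult.assoc[symmetric])
    also have "\<dots> = (\<integral>\<^sup>+x. indicator A x \<partial>measure_pmf p)"
      unfolding nn_integral_measure_pmf ..
    finally show "emeasure (measure_pmf p) A = emeasure (density (measure_pmf q) f) A" by simp
  qed simp
  then have "KL_divergence 2 (measure_pmf q) (measure_pmf p) = (\<integral>x. f x * log 2 (f x) \<partial>measure_pmf q)"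
    using sigma_finite_measure.KL_density[OF measure_pmf.sigma_finite_measure_axioms, of 2 f q] f0 by simp
  also have "\<dots> = (\<Sum>x\<in>set_pmf p. f x * log 2 (f x) * pmf q x)"
    by (rule integral_measure_pmf_real[OF fin]) (auto simp: f_def set_pmf_iff)
  also have "\<dots> = rel_ent p q"
    unfolding rel_ent_def using sub by (intro sum.cong) (auto simp: f_def set_pmf_iff)
  finally show ?thesis .
qed

text \<open>\<open>rel_ent\<close> alone misses the infinite case: a summand with
  \<open>pmf q x = 0\<close> vanishes by the conventions for division and logarithm at 0.\<close>

lemma divergence_pmf:
  assumes "finite (set_pmf p)"
  shows "divergence p q = (if set_pmf p \<subseteq> set_pmf q then ereal (rel_ent p q) else \<infinity>)"
  using KL_divergence_pmf[OF assms] by (simp add: divergence_def absolutely_continuous_pmf_iff)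

text \<open>Countability makes the product of the two discrete \<sigma>-algebras discrete
  again.\<close>

lemma pair_measure_pmf:
  fixes p :: "'a::countable pmf" and q :: "'b::countable pmf"
  shows "measure_pmf p \<Otimes>\<^sub>M measure_pmf q = measure_pmf (pair_pmf p q)"
proof (rule pair_measure_eqI)
  have "sets (measure_pmf p \<Otimes>\<^sub>M measure_pmf q)
      = sets (count_space (UNIV :: 'a set) \<Otimes>\<^sub>M count_space (UNIV :: 'b set))"
    by (rule sets_pair_measure_cong) auto
  also have "count_space (UNIV :: 'a set) \<Otimes>\<^sub>M count_space (UNIV :: 'b set) = count_space (UNIV \<times> UNIV)"
    by (rule pair_measure_countable) auto
  finally show "sets (measure_pmf p \<Otimes>\<^sub>M measure_pmf q) = sets (measure_pmf (pair_pmf p q))"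
    by simp
  show "emeasure (measure_pmf p) A * emeasure (measure_pmf q) B = emeasure (measure_pmf (pair_pmf p q)) (A \<times> B)"
    for A B
    unfolding measure_pmf.emeasure_eq_measure
    by (subst measure_pmf_prob_product)
      (auto simp: ennreal_mult' intro: countable_subset[OF subset_UNIV countableI_type])
qed (auto intro: measure_pmf.sigma_finite_measure_axioms)

lemma mutual_information_pmf:
  fixes X :: "'w \<Rightarrow> 'a::countable" and Y :: "'w \<Rightarrow> 'b::countable"
  assumes fin: "finite (set_pmf p)"
  shows "prob_space.mutual_information (measure_pmf p) 2 (count_space UNIV) (count_space UNIV) X Y =
    measure_pmf.expectation p (\<lambda>\<omega>. log 2 (pmf (map_pmf (\<lambda>\<omega>. (X \<omega>, Y \<omega>)) p) (X \<omega>, Y \<omega>) /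
      (pmf (map_pmf X p) (X \<omega>) * pmf (map_pmf Y p) (Y \<omega>))))"
proof -
  let ?XY = "\<lambda>\<omega>. (X \<omega>, Y \<omega>)"
  have "prob_space.mutual_information (measure_pmf p) 2 (count_space UNIV) (count_space UNIV) X Y =
    KL_divergence 2 (measure_pmf (pair_pmf (map_pmf X p) (map_pmf Y p))) (measure_pmf (map_pmf ?XY p))"
    unfolding prob_space.mutual_information_def[OF measure_pmf.prob_space_axioms]
    by (simp add: pair_measure_countable[OF countableI_type countableI_type] map_pmf_rep_eq[symmetric] pair_measure_pmf)
  also have "\<dots> = rel_ent (map_pmf ?XY p) (pair_pmf (map_pmf X p) (map_pmf Y p))"
    by (rule KL_divergence_pmf) (use fin in auto)
  also have "\<dots> = measure_pmf.expectation (map_pmf ?XY p) (\<lambda>z. log 2 (pmf (map_pmf ?XY p) z /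
      pmf (pair_pmf (map_pmf X p) (map_pmf Y p)) z))"
    using fin by (simp add: rel_ent_def expectation_finite_pmf del: integral_map_pmf)
  finally show ?thesis by (simp add: pmf_pair)
qed

lemma pmf_map_cond_pmf:
  assumes "pmf (map_pmf B p) b > 0"
  shows "pmf (map_pmf A (cond_pmf p {\<omega>. B \<omega> = b})) a
    = pmf (map_pmf (\<lambda>\<omega>. (A \<omega>, B \<omega>)) p) (a, b) / pmf (map_pmf B p) b"
proof -
  have b: "pmf (map_pmf B p) b = measure_pmf.prob p {\<omega>. B \<omega> = b}"
    by (simp add: pmf_map vimage_def)
  have ne: "set_pmf p \<inter> {\<omega>. B \<omega> = b} \<noteq> {}"
    using assms unfolding b by (metis inf_commute measure_Int_set_pmf measure_empty order_less_irrefl)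
  have "pmf (map_pmf A (cond_pmf p {\<omega>. B \<omega> = b})) a = measure_pmf.prob (cond_pmf p {\<omega>. B \<omega> = b}) {\<omega>. A \<omega> = a}"
    by (simp add: pmf_map vimage_def)
  also have "\<dots> = measure_pmf.prob p ({\<omega>. A \<omega> = a} \<inter> {\<omega>. B \<omega> = b}) / measure_pmf.prob p {\<omega>. B \<omega> = b}"
    using assms unfolding b cond_pmf.rep_eq[OF ne]
    by (subst measure_uniform_measure) (auto simp: measure_pmf.emeasure_eq_measure Int_commute)
  also have "{\<omega>. A \<omega> = a} \<inter> {\<omega>. B \<omega> = b} = (\<lambda>\<omega>. (A \<omega>, B \<omega>)) -` {(a, b)}" by auto
  finally show ?thesis unfolding b by (simp add: pmf_map)
qed

lemma pmf_map_positive: "\<omega> \<in> set_pmf p \<Longrightarrow> pmf (map_pmf A p) (A \<omega>) > 0"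
  by (simp add: pmf_positive_iff)

text \<open>By definition the left side is \<open>I(A; B, C) - I(A; C)\<close>. The marginal of
  \<open>A\<close> cancels, and what is left is the mean of the information density, the
  log-likelihood ratio that governs the acceptance of codewords.\<close>

lemma cond_mutual_info_pmf:
  fixes A :: "'w \<Rightarrow> 'a::countable" and B :: "'w \<Rightarrow> 'b::countable" and C :: "'w \<Rightarrow> 'c::countable"
  assumes fin: "finite (set_pmf p)"
  shows "cond_mutual_info p A B C = measure_pmf.expectation p (\<lambda>\<omega>. log 2
    (pmf (map_pmf B (cond_pmf p {\<omega>'. (A \<omega>', C \<omega>') = (A \<omega>, C \<omega>)})) (B \<omega>) /
     pmf (map_pmf B (cond_pmf p {\<omega>'. C \<omega>' = C \<omega>})) (B \<omega>)))"
proof -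
  define P where "P Z \<omega> = pmf (map_pmf Z p) (Z \<omega>)" for Z :: "'w \<Rightarrow> 'z" and \<omega>
  have "(count_space UNIV :: 'b measure) \<Otimes>\<^sub>M (count_space UNIV :: 'c measure) = count_space UNIV"
    by (simp add: pair_measure_countable[OF countableI_type countableI_type])
  then have "cond_mutual_info p A B C =
     measure_pmf.expectation p (\<lambda>\<omega>. log 2 (pmf (map_pmf (\<lambda>\<omega>. (A \<omega>, B \<omega>, C \<omega>)) p) (A \<omega>, B \<omega>, C \<omega>) /
      (pmf (map_pmf A p) (A \<omega>) * pmf (map_pmf (\<lambda>\<omega>. (B \<omega>, C \<omega>)) p) (B \<omega>, C \<omega>)))) -
     measure_pmf.expectation p (\<lambda>\<omega>. log 2 (pmf (map_pmf (\<lambda>\<omega>. (A \<omega>, C \<omega>)) p) (A \<omega>, C \<omega>) /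
      (pmf (map_pmf A p) (A \<omega>) * pmf (map_pmf C p) (C \<omega>))))"
    unfolding cond_mutual_info_def prob_space.conditional_mutual_information_def[OF measure_pmf.prob_space_axioms]
    by (simp add: mutual_information_pmf[OF fin])
  also have "\<dots> = measure_pmf.expectation p (\<lambda>\<omega>.
      log 2 (pmf (map_pmf (\<lambda>\<omega>. (A \<omega>, B \<omega>, C \<omega>)) p) (A \<omega>, B \<omega>, C \<omega>) /
      (pmf (map_pmf A p) (A \<omega>) * pmf (map_pmf (\<lambda>\<omega>. (B \<omega>, C \<omega>)) p) (B \<omega>, C \<omega>))) -
      log 2 (pmf (map_pmf (\<lambda>\<omega>. (A \<omega>, C \<omega>)) p) (A \<omega>, C \<omega>) /
      (pmf (map_pmf A p) (A \<omega>) * pmf (map_pmf C p) (C \<omega>))))"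
    by (intro Bochner_Integration.integral_diff[symmetric] integrable_measure_pmf_finite fin)
  also have "\<dots> = measure_pmf.expectation p (\<lambda>\<omega>. log 2
    (pmf (map_pmf B (cond_pmf p {\<omega>'. (A \<omega>', C \<omega>') = (A \<omega>, C \<omega>)})) (B \<omega>) /
     pmf (map_pmf B (cond_pmf p {\<omega>'. C \<omega>' = C \<omega>})) (B \<omega>)))"
  proof (intro integral_cong_AE AE_pmfI)
    fix \<omega> assume \<omega>: "\<omega> \<in> set_pmf p"
    define a where "a = pmf (map_pmf A p) (A \<omega>)"
    define c where "c = pmf (map_pmf C p) (C \<omega>)"
    define ac where "ac = pmf (map_pmf (\<lambda>\<omega>. (A \<omega>, C \<omega>)) p) (A \<omega>, C \<omega>)"
    define bc where "bc = pmf (map_pmf (\<lambda>\<omega>. (B \<omega>, C \<omega>)) p) (B \<omega>, C \<omega>)"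
    define abc where "abc = pmf (map_pmf (\<lambda>\<omega>. (A \<omega>, B \<omega>, C \<omega>)) p) (A \<omega>, B \<omega>, C \<omega>)"
    have pos: "a > 0" "c > 0" "ac > 0" "bc > 0" "abc > 0"
      unfolding a_def c_def ac_def bc_def abc_def
      using pmf_map_positive[OF \<omega>, of A] pmf_map_positive[OF \<omega>, of C]
        pmf_map_positive[OF \<omega>, of "\<lambda>\<omega>. (A \<omega>, C \<omega>)"] pmf_map_positive[OF \<omega>, of "\<lambda>\<omega>. (B \<omega>, C \<omega>)"]
        pmf_map_positive[OF \<omega>, of "\<lambda>\<omega>. (A \<omega>, B \<omega>, C \<omega>)"] by auto
    have bac: "pmf (map_pmf (\<lambda>\<omega>. (B \<omega>, A \<omega>, C \<omega>)) p) (B \<omega>, A \<omega>, C \<omega>) = abc"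
      unfolding abc_def pmf_map by (intro arg_cong[where f = "measure_pmf.prob p"]) auto
    have "pmf (map_pmf B (cond_pmf p {\<omega>'. (A \<omega>', C \<omega>') = (A \<omega>, C \<omega>)})) (B \<omega>) = abc / ac"
      using pmf_map_cond_pmf[of "\<lambda>\<omega>. (A \<omega>, C \<omega>)" p "(A \<omega>, C \<omega>)" B "B \<omega>"] pos(3)
      unfolding bac ac_def by simp
    moreover have "pmf (map_pmf B (cond_pmf p {\<omega>'. C \<omega>' = C \<omega>})) (B \<omega>) = bc / c"
      using pmf_map_cond_pmf[of C p "C \<omega>" B "B \<omega>"] pos(2) unfolding bc_def c_def by simp
    ultimately show "log 2 (pmf (map_pmf (\<lambda>\<omega>. (A \<omega>, B \<omega>, C \<omega>)) p) (A \<omega>, B \<omega>, C \<omega>) /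
      (pmf (map_pmf A p) (A \<omega>) * pmf (map_pmf (\<lambda>\<omega>. (B \<omega>, C \<omega>)) p) (B \<omega>, C \<omega>))) -
      log 2 (pmf (map_pmf (\<lambda>\<omega>. (A \<omega>, C \<omega>)) p) (A \<omega>, C \<omega>) /
      (pmf (map_pmf A p) (A \<omega>) * pmf (map_pmf C p) (C \<omega>))) = log 2
    (pmf (map_pmf B (cond_pmf p {\<omega>'. (A \<omega>', C \<omega>') = (A \<omega>, C \<omega>)})) (B \<omega>) /
     pmf (map_pmf B (cond_pmf p {\<omega>'. C \<omega>' = C \<omega>})) (B \<omega>))"
      unfolding a_def[symmetric] c_def[symmetric] ac_def[symmetric] bc_def[symmetric] abc_def[symmetric]
      using pos by (simp add: log_divide log_mult)
  qed auto
  finally show ?thesis .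
qed

text \<open>Gibbs' inequality, from \<open>ln z \<le> z - 1\<close>.\<close>

lemma rel_ent_nonneg:
  assumes fin: "finite (set_pmf p)" and sub: "set_pmf p \<subseteq> set_pmf q"
  shows "0 \<le> rel_ent p q"
proof -
  have "- rel_ent p q = (\<Sum>x\<in>set_pmf p. pmf p x * log 2 (pmf q x / pmf p x))"
    unfolding rel_ent_def sum_negf[symmetric]
  proof (intro sum.cong refl)
    fix x assume "x \<in> set_pmf p"
    then have "pmf p x > 0" "pmf q x > 0" using sub by (auto simp: pmf_positive)
    then show "- (pmf p x * log 2 (pmf p x / pmf q x)) = pmf p x * log 2 (pmf q x / pmf p x)"
      by (simp add: log_divide algebra_simps)
  qed
  also have "\<dots> \<le> (\<Sum>x\<in>set_pmf p. (pmf q x - pmf p x) / ln 2)"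
  proof (intro sum_mono)
    fix x assume "x \<in> set_pmf p"
    then have pos: "pmf p x > 0" "pmf q x > 0" using sub by (auto simp: pmf_positive)
    then have "ln (pmf q x / pmf p x) \<le> pmf q x / pmf p x - 1"
      by (intro ln_le_minus_one) auto
    then have "pmf p x * ln (pmf q x / pmf p x) \<le> pmf p x * (pmf q x / pmf p x - 1)"
      using pos by (intro mult_left_mono) auto
    also have "\<dots> = pmf q x - pmf p x" using pos by (simp add: right_diff_distrib)
    finally show "pmf p x * log 2 (pmf q x / pmf p x) \<le> (pmf q x - pmf p x) / ln 2"
      by (simp add: log_def divide_right_mono)
  qed
  also have "\<dots> = (measure_pmf.prob q (set_pmf p) - measure_pmf.prob p (set_pmf p)) / ln 2"
    using fin by (simp add: sum_divide_distrib[symmetric] sum_subtractf measure_measure_pmf_finite)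
  also have "\<dots> \<le> 0"
  proof (intro divide_nonpos_pos)
    have "measure_pmf.prob p (set_pmf p) = 1"
      by (simp add: measure_pmf.prob_eq_1 AE_measure_pmf)
    then show "measure_pmf.prob q (set_pmf p) - measure_pmf.prob p (set_pmf p) \<le> 0" by simp
  qed simp
  finally show ?thesis by simp
qed

section \<open>Typical sequences\<close>

text \<open>Continuity of \<open>x * log 2 (x / c)\<close> up to the boundary point 0, where its
  value is 0: a limit of laws may lose part of the support.\<close>

lemma tendsto_mult_log:
  fixes y :: "nat \<Rightarrow> real"
  assumes y: "y \<longlonglongrightarrow> l" "\<And>n. 0 \<le> y n" and c: "c > 0"
  shows "(\<lambda>n. y n * log 2 (y n / c)) \<longlonglongrightarrow> l * log 2 (l / c)"
proof -
  have l: "0 \<le> l" using y by (simp add: LIMSEQ_le_const)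
  let ?f = "\<lambda>x::real. x * log 2 (x / c)"
  have "continuous (at l within {0..}) ?f"
  proof (cases "l = 0")
    case True
    have "(?f \<longlongrightarrow> 0) (at_right 0)" using c by real_asymp
    moreover have "at_right 0 = at (0::real) within {0..}"
      by (rule at_within_nhd[of _ UNIV]) auto
    ultimately show ?thesis unfolding continuous_within True by simp
  next
    case False
    then show ?thesis using l c by (auto intro!: continuous_intros)
  qed
  then show ?thesis
    by (rule continuous_within_sequentially[THEN iffD1, rule_format, unfolded comp_def])
      (use y in auto)
qed

text \<open>Successive extraction of subsequences, one coordinate at a time.\<close>

lemma finite_pointwise_convergent_subseq:
  fixes f :: "nat \<Rightarrow> 'a \<Rightarrow> real"
  assumes "finite S" "\<And>n x. f n x \<in> {0..1}"
  shows "\<exists>r l. strict_mono (r :: nat \<Rightarrow> nat) \<and> (\<forall>x\<in>S. (\<lambda>n. f (r n) x) \<longlonglongrightarrow> l x)"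
  using assms(1)
proof (induction S)
  case empty
  show ?case by (intro exI[of _ id]) (auto simp: strict_mono_def)
next
  case (insert a S)
  then obtain r l where r: "strict_mono (r :: nat \<Rightarrow> nat)" "\<And>x. x \<in> S \<Longrightarrow> (\<lambda>n. f (r n) x) \<longlonglongrightarrow> l x"
    by blast
  have "seq_compact {0..1::real}" by (simp add: compact_eq_seq_compact_metric[symmetric])
  then obtain la r' where r': "strict_mono (r' :: nat \<Rightarrow> nat)" "((\<lambda>n. f (r n) a) \<circ> r') \<longlonglongrightarrow> la"
    using assms(2) unfolding seq_compact_def by metis
  have "(\<lambda>n. f ((r \<circ> r') n) x) \<longlonglongrightarrow> (l(a := la)) x" if "x \<in> insert a S" for x
  proof (cases "x = a")
    case True
    then show ?thesis using r'(2) by (simp add: comp_def)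
  next
    case False
    then show ?thesis
      using LIMSEQ_subseq_LIMSEQ[OF r(2) r'(1), of x] that by (simp add: comp_def)
  qed
  then show ?case
    using strict_mono_o[OF r(1) r'(1)] by blast
qed

lemma pmf_map_finite:
  assumes "finite S" "set_pmf t \<subseteq> S"
  shows "pmf (map_pmf F t) z = (\<Sum>x\<in>{x\<in>S. F x = z}. pmf t x)"
proof -
  have "pmf (map_pmf F t) z = measure_pmf.prob t (F -` {z})" by (rule pmf_map)
  also have "\<dots> = measure_pmf.prob t {x\<in>S. F x = z}"
    by (rule measure_prob_cong_0) (use assms in \<open>auto simp: pmf_eq_0_set_pmf\<close>)
  also have "\<dots> = (\<Sum>x\<in>{x\<in>S. F x = z}. pmf t x)"
    using assms by (intro measure_measure_pmf_finite) auto
  finally show ?thesis .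
qed

lemma rel_ent_superset:
  assumes "finite S" "set_pmf t \<subseteq> S"
  shows "rel_ent t q = (\<Sum>x\<in>S. pmf t x * log 2 (pmf t x / pmf q x))"
  unfolding rel_ent_def using assms by (intro sum.mono_neutral_left) (auto simp: set_pmf_iff)

text \<open>By compactness of the set of laws on a finite set.\<close>

lemma rel_ent_approximate_marginals:
  fixes q :: "'a pmf" and F :: "'a \<Rightarrow> 'b" and G :: "'a \<Rightarrow> 'c"
  assumes fin: "finite (set_pmf q)"
    and min: "\<And>t. set_pmf t \<subseteq> set_pmf q \<Longrightarrow> map_pmf F t = \<mu> \<Longrightarrow> map_pmf G t = \<nu> \<Longrightarrow> E < rel_ent t q"
  shows "\<exists>\<gamma>>0. \<forall>t. set_pmf t \<subseteq> set_pmf q \<longrightarrow> (\<forall>z. \<bar>pmf (map_pmf F t) z - pmf \<mu> z\<bar> \<le> \<gamma>) \<longrightarrow>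
    (\<forall>z. \<bar>pmf (map_pmf G t) z - pmf \<nu> z\<bar> \<le> \<gamma>) \<longrightarrow> E \<le> rel_ent t q"
proof (rule ccontr)
  let ?S = "set_pmf q"
  assume contra: "\<not> ?thesis"
  \<comment> \<open>A violating law for each tolerance \<open>1 / (n + 1)\<close>, so that the
    marginals become exact in the limit.\<close>
  have "\<exists>t. set_pmf t \<subseteq> ?S \<and> (\<forall>z. \<bar>pmf (map_pmf F t) z - pmf \<mu> z\<bar> \<le> inverse (real (Suc n))) \<and>
      (\<forall>z. \<bar>pmf (map_pmf G t) z - pmf \<nu> z\<bar> \<le> inverse (real (Suc n))) \<and> rel_ent t q < E" for n
  proof -
    have "0 < inverse (real (Suc n))" by simp
    then show ?thesis using contra by (meson not_le)
  qed
  then obtain t where t: "\<And>n. set_pmf (t n) \<subseteq> ?S"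
    "\<And>n z. \<bar>pmf (map_pmf F (t n)) z - pmf \<mu> z\<bar> \<le> inverse (real (Suc n))"
    "\<And>n z. \<bar>pmf (map_pmf G (t n)) z - pmf \<nu> z\<bar> \<le> inverse (real (Suc n))"
    "\<And>n. rel_ent (t n) q < E"
    by metis
  obtain r l where r: "strict_mono (r :: nat \<Rightarrow> nat)"
    and l: "\<And>x. x \<in> ?S \<Longrightarrow> (\<lambda>n. pmf (t (r n)) x) \<longlonglongrightarrow> l x"
    using finite_pointwise_convergent_subseq[OF fin, of "\<lambda>n. pmf (t n)"] by (auto simp: pmf_le_1)
  have l0: "0 \<le> l x" if "x \<in> ?S" for x
    using l[OF that] by (rule LIMSEQ_le_const) auto
  have "(\<lambda>n. \<Sum>x\<in>?S. pmf (t (r n)) x) \<longlonglongrightarrow> (\<Sum>x\<in>?S. l x)"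
    by (intro tendsto_sum l)
  moreover have "(\<Sum>x\<in>?S. pmf (t (r n)) x) = 1" for n
    using fin t(1) by (intro sum_pmf_eq_1) auto
  ultimately have l1: "(\<Sum>x\<in>?S. l x) = 1"
    using LIMSEQ_unique[OF _ tendsto_const] by fastforce
  \<comment> \<open>No mass escapes from a finite support, so the coordinatewise limit is again a
    law.\<close>
  define lim where "lim = embed_pmf (\<lambda>x. if x \<in> ?S then l x else 0)"
  have pmf_lim: "pmf lim x = (if x \<in> ?S then l x else 0)" for x
    unfolding lim_def
  proof (rule pmf_embed_pmf)
    have "(\<integral>\<^sup>+x. ennreal (if x \<in> ?S then l x else 0) \<partial>count_space UNIV)
      = (\<Sum>x\<in>?S. ennreal (if x \<in> ?S then l x else 0))"
      by (rule nn_integral_count_space'[OF fin]) auto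
    also have "\<dots> = ennreal (\<Sum>x\<in>?S. l x)" using l0 by (simp add: sum_ennreal)
    finally show "(\<integral>\<^sup>+x. ennreal (if x \<in> ?S then l x else 0) \<partial>count_space UNIV) = 1" using l1 by simp
  qed (use l0 in auto)
  have lim_sub: "set_pmf lim \<subseteq> ?S" by (auto simp: set_pmf_iff pmf_lim split: if_splits)
  have zero: "(\<lambda>n. inverse (real (Suc (r n)))) \<longlonglongrightarrow> 0"
    using LIMSEQ_subseq_LIMSEQ[OF LIMSEQ_inverse_real_of_nat r] by (simp add: comp_def)
  have marginal: "map_pmf H lim = \<mu>'"
    if "\<And>n z. \<bar>pmf (map_pmf H (t n)) z - pmf \<mu>' z\<bar> \<le> inverse (real (Suc n))" for H :: "'a \<Rightarrow> 'd" and \<mu>'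
  proof (rule pmf_eqI)
    fix z
    have "(\<lambda>n. pmf (map_pmf H (t (r n))) z) \<longlonglongrightarrow> pmf (map_pmf H lim) z"
      unfolding pmf_map_finite[OF fin t(1)] pmf_map_finite[OF fin lim_sub]
      by (intro tendsto_sum) (auto simp: pmf_lim l)
    moreover have "(\<lambda>n. pmf (map_pmf H (t (r n))) z) \<longlonglongrightarrow> pmf \<mu>' z"
      by (rule Lim_transform2[OF tendsto_const], rule Lim_null_comparison[OF _ zero])
        (use that in \<open>auto simp: abs_minus_commute\<close>)
    ultimately show "pmf (map_pmf H lim) z = pmf \<mu>' z" by (rule LIMSEQ_unique)
  qed
  have "E < rel_ent lim q" by (intro min lim_sub marginal t)
  \<comment> \<open>A limit keeps only the weak inequality; the strict one in \<open>min\<close>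
    turns it into a contradiction.\<close>
  moreover have "rel_ent lim q \<le> E"
  proof (rule LIMSEQ_le_const2)
    show "(\<lambda>n. rel_ent (t (r n)) q) \<longlonglongrightarrow> rel_ent lim q"
      unfolding rel_ent_superset[OF fin t(1)] rel_ent_superset[OF fin lim_sub]
      by (intro tendsto_sum tendsto_mult_log) (auto simp: pmf_lim l pmf_positive)
    show "\<exists>N. \<forall>n\<ge>N. rel_ent (t (r n)) q \<le> E" using t(4) by (auto intro: less_imp_le)
  qed
  ultimately show False by simp
qed

lemma pmf_map_type:
  assumes "xs \<noteq> []"
  shows "pmf (map_pmf F (pmf_of_multiset (mset xs))) z = (\<Sum>x\<leftarrow>xs. of_bool (F x = z)) / length xs"
proof -
  have ne: "mset xs \<noteq> {#}" using assms by simp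
  have "pmf (map_pmf F (pmf_of_multiset (mset xs))) z
      = (\<Sum>x\<in>{x\<in>set xs. F x = z}. count (mset xs) x / length xs)"
    by (subst pmf_map_finite[of "set xs"]) (use ne in auto)
  also have "\<dots> = (\<Sum>x\<in>set xs. real (count (mset xs) x) * of_bool (F x = z)) / length xs"
    unfolding sum_divide_distrib by (rule sum.mono_neutral_cong_left) auto
  also have "(\<Sum>x\<in>set xs. real (count (mset xs) x) * of_bool (F x = z)) = (\<Sum>x\<leftarrow>xs. of_bool (F x = z) :: real)"
    by (rule sum_list_eq_sum_count[symmetric]) auto
  finally show ?thesis .
qed

text \<open>Strong typicality of the image under \<open>F\<close> with an additive tolerance,
  multiplied out so that the empty list needs no exception. A symbol of probability 0 may still
  occur with frequency up to \<gamma>.\<close>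

definition typical :: "('a \<Rightarrow> 'b) \<Rightarrow> 'b pmf \<Rightarrow> real \<Rightarrow> 'a list \<Rightarrow> bool" where
  "typical F \<mu> \<gamma> xs \<longleftrightarrow> (\<forall>z. \<bar>(\<Sum>x\<leftarrow>xs. of_bool (F x = z)) - real (length xs) * pmf \<mu> z\<bar> \<le> real (length xs) * \<gamma>)"

lemma typical_map: "typical F \<mu> \<gamma> (map g xs) = typical (F \<circ> g) \<mu> \<gamma> xs"
  by (simp add: typical_def comp_def)

text \<open>Union bound over the finitely many possible values, with the weak law applied to the
  indicator of each.\<close>

lemma not_typical_tendsto_0:
  assumes fin: "finite (set_pmf p)" and \<gamma>: "\<gamma> > 0"
  shows "(\<lambda>n. measure_pmf.prob (replicate_pmf n p) {xs. \<not> typical F (map_pmf F p) \<gamma> xs}) \<longlonglongrightarrow> 0"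
proof -
  let ?Z = "F ` set_pmf p"
  let ?B = "\<lambda>z n. {xs. \<bar>(\<Sum>x\<leftarrow>xs. of_bool (F x = z)) - real n * pmf (map_pmf F p) z\<bar> > real n * \<gamma>}"
  have exp: "measure_pmf.expectation p (\<lambda>x. of_bool (F x = z)) = pmf (map_pmf F p) z" for z
    by (simp add: prob_eq_expectation[symmetric] pmf_map vimage_def)
  have le: "measure_pmf.prob (replicate_pmf n p) {xs. \<not> typical F (map_pmf F p) \<gamma> xs}
      \<le> (\<Sum>z\<in>?Z. measure_pmf.prob (replicate_pmf n p) (?B z n))" for n
  proof -
    have "measure_pmf.prob (replicate_pmf n p) {xs. \<not> typical F (map_pmf F p) \<gamma> xs}
      = measure_pmf.prob (replicate_pmf n p) ({xs. \<not> typical F (map_pmf F p) \<gamma> xs} \<inter> set_pmf (replicate_pmf n p))"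
      by (simp add: measure_Int_set_pmf)
    also have "\<dots> \<le> measure_pmf.prob (replicate_pmf n p) (\<Union>z\<in>?Z. ?B z n)"
    proof (intro measure_pmf.finite_measure_mono subsetI)
      fix xs assume xs: "xs \<in> {xs. \<not> typical F (map_pmf F p) \<gamma> xs} \<inter> set_pmf (replicate_pmf n p)"
      then have len: "length xs = n" and sub: "set xs \<subseteq> set_pmf p" by (auto simp: set_replicate_pmf)
      obtain z where z: "\<bar>(\<Sum>x\<leftarrow>xs. of_bool (F x = z)) - real n * pmf (map_pmf F p) z\<bar> > real n * \<gamma>"
        using xs len by (auto simp: typical_def not_le)
      \<comment> \<open>Off the range of \<open>F\<close> count and probability both vanish, so no
        deviation can occur.\<close>
      have "z \<in> ?Z"
      proof (rule ccontr)
        assume nz: "z \<notin> ?Z"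
        then have "pmf (map_pmf F p) z = 0" by (simp add: pmf_eq_0_set_pmf)
        moreover have "map (\<lambda>x. of_bool (F x = z)) xs = map (\<lambda>_. 0 :: real) xs"
          using nz sub by auto
        then have "(\<Sum>x\<leftarrow>xs. of_bool (F x = z)) = (0::real)" by (simp only: sum_list_0)
        ultimately show False using z \<gamma> by (simp add: mult_less_0_iff)
      qed
      then show "xs \<in> (\<Union>z\<in>?Z. ?B z n)" using z by auto
    qed simp
    also have "\<dots> \<le> (\<Sum>z\<in>?Z. measure_pmf.prob (replicate_pmf n p) (?B z n))"
      using fin by (intro measure_pmf.finite_measure_subadditive_finite) auto
    finally show ?thesis .
  qed
  have "(\<lambda>n. \<Sum>z\<in>?Z. measure_pmf.prob (replicate_pmf n p) (?B z n)) \<longlonglongrightarrow> (\<Sum>z\<in>?Z. 0)"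
  proof (rule tendsto_sum)
    fix z
    show "(\<lambda>n. measure_pmf.prob (replicate_pmf n p) (?B z n)) \<longlonglongrightarrow> 0"
      using weak_law[OF fin \<gamma>, of "\<lambda>x. of_bool (F x = z)"] unfolding exp .
  qed
  then have "(\<lambda>n. \<Sum>z\<in>?Z. measure_pmf.prob (replicate_pmf n p) (?B z n)) \<longlonglongrightarrow> 0" by simp
  then show ?thesis
    by (rule real_tendsto_sandwich[where f = "\<lambda>_. 0", rotated 3])
      (rule always_eventually, rule allI, rule measure_nonneg,
       rule always_eventually, rule allI, rule le, rule tendsto_const)
qed

text \<open>The two typicality conditions say that the type of \<open>xs\<close> has marginals
  within \<gamma> of the prescribed ones, so the hypothesis bounds its divergence and Sanov's
  estimate applies.\<close>

lemma prob_typical_le: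
  fixes q :: "'a pmf" and F :: "'a \<Rightarrow> 'b" and G :: "'a \<Rightarrow> 'c"
  assumes fin: "finite (set_pmf q)" and n: "n > 0"
    and \<gamma>: "\<And>t. set_pmf t \<subseteq> set_pmf q \<Longrightarrow> (\<forall>z. \<bar>pmf (map_pmf F t) z - pmf \<mu> z\<bar> \<le> \<gamma>) \<Longrightarrow>
      (\<forall>z. \<bar>pmf (map_pmf G t) z - pmf \<nu> z\<bar> \<le> \<gamma>) \<Longrightarrow> E \<le> rel_ent t q"
  shows "measure_pmf.prob (replicate_pmf n q) {xs. typical F \<mu> \<gamma> xs \<and> typical G \<nu> \<gamma> xs}
    \<le> real (n + 1) ^ card (set_pmf q) * 2 powr (- real n * E)"
proof (rule sanov_upper_bound[OF fin n])
  fix xs assume ty: "xs \<in> {xs. typical F \<mu> \<gamma> xs \<and> typical G \<nu> \<gamma> xs}"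
    and len: "length xs = n" and sub: "set xs \<subseteq> set_pmf q"
  have ne: "xs \<noteq> []" using len n by auto
  have freq: "\<bar>pmf (map_pmf H (pmf_of_multiset (mset xs))) z - pmf \<mu>' z\<bar> \<le> \<gamma>"
    if "typical H \<mu>' \<gamma> xs" for H :: "'a \<Rightarrow> 'd" and \<mu>' z
  proof -
    have "\<bar>(\<Sum>x\<leftarrow>xs. of_bool (H x = z)) - real n * pmf \<mu>' z\<bar> \<le> real n * \<gamma>"
      using that len by (auto simp: typical_def)
    then have "\<bar>(\<Sum>x\<leftarrow>xs. of_bool (H x = z)) - real n * pmf \<mu>' z\<bar> / n \<le> \<gamma>"
      using n by (simp add: divide_le_eq mult.commute)
    also have "\<bar>(\<Sum>x\<leftarrow>xs. of_bool (H x = z)) - real n * pmf \<mu>' z\<bar> / n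
      = \<bar>((\<Sum>x\<leftarrow>xs. of_bool (H x = z)) - real n * pmf \<mu>' z) / n\<bar>" by simp
    finally show ?thesis using n unfolding pmf_map_type[OF ne] len by (simp add: diff_divide_distrib)
  qed
  show "E \<le> rel_ent (pmf_of_multiset (mset xs)) q"
    using ty ne sub by (intro \<gamma> allI freq) auto
qed

section \<open>Blocks\<close>

text \<open>One pair of histories per position of the block, rather than one block per round:
  single-letter kernels act entry by entry.\<close>

type_synonym state = "(nat list \<times> nat list) list"

definition extendU :: "state \<Rightarrow> nat list \<Rightarrow> state" where
  "extendU s u = map2 (\<lambda>(us, vs) u. (us @ [u], vs)) s u"

definition extendV :: "state \<Rightarrow> nat list \<Rightarrow> state" where
  "extendV s v = map2 (\<lambda>(us, vs) v. (us, vs @ [v])) s v"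

definition block_kernel ::
    "(nat list \<times> nat list \<times> 'x \<Rightarrow> nat pmf) \<Rightarrow> state \<Rightarrow> 'x list \<Rightarrow> nat list pmf" where
  "block_kernel \<kappa> s x = seq_pmf (map2 (\<lambda>(us, vs) x. \<kappa> (us, vs, x)) s x)"

definition block_aux where
  "block_aux \<kappa> \<eta> k zs = seq_pmf (map (\<lambda>(x, y). aux_pmf \<kappa> \<eta> x y k) zs)"

lemma block_aux_0: "block_aux \<kappa> \<eta> 0 zs = return_pmf (replicate (length zs) ([], []))"
proof -
  have "block_aux \<kappa> \<eta> 0 zs = seq_pmf (map (\<lambda>_. return_pmf ([], [])) zs)"
    unfolding block_aux_def by (simp add: case_prod_unfold)
  also have "\<dots> = return_pmf (map (\<lambda>_. ([], [])) zs)" by (rule seq_pmf_return)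
  finally show ?thesis by (simp add: map_replicate_const)
qed

text \<open>\<open>seq_pmf_bind\<close> is used three times, to split off the history, the letters
  of A and the letters of B: \<open>n\<close> independent copies of a round are one round on
  blocks.\<close>

lemma block_aux_Suc:
  "block_aux \<kappa> \<eta> (Suc k) zs = do {
     s \<leftarrow> block_aux \<kappa> \<eta> k zs;
     u \<leftarrow> block_kernel (\<kappa> (Suc k)) s (map fst zs);
     v \<leftarrow> block_kernel (\<eta> (Suc k)) (extendU s u) (map snd zs);
     return_pmf (extendV (extendU s u) v)}"
proof -
  define A where "A z h = \<kappa> (Suc k) (fst h, snd h, fst z)" for z :: "'a \<times> 'b" and h
  define B where "B z h u = \<eta> (Suc k) (fst h @ [u], snd h, snd z)" for z :: "'a \<times> 'b" and h u
  have "block_aux \<kappa> \<eta> (Suc k) zs = seq_pmf (map (\<lambda>z. bind_pmf (aux_pmf \<kappa> \<eta> (fst z) (snd z) k)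
      (\<lambda>h. bind_pmf (A z h) (\<lambda>u. bind_pmf (B z h u) (\<lambda>v. return_pmf (fst h @ [u], snd h @ [v]))))) zs)"
    unfolding block_aux_def A_def B_def by (simp add: case_prod_unfold)
  also have "\<dots> = bind_pmf (block_aux \<kappa> \<eta> k zs) (\<lambda>s. seq_pmf (map (\<lambda>zh. bind_pmf (A (fst zh) (snd zh))
      (\<lambda>u. bind_pmf (B (fst zh) (snd zh) u) (\<lambda>v. return_pmf (fst (snd zh) @ [u], snd (snd zh) @ [v])))) (zip zs s)))"
    by (subst seq_pmf_bind) (simp add: block_aux_def case_prod_unfold)
  also have "\<dots> = bind_pmf (block_aux \<kappa> \<eta> k zs) (\<lambda>s. bind_pmf (seq_pmf (map (\<lambda>zh. A (fst zh) (snd zh)) (zip zs s)))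
      (\<lambda>u. seq_pmf (map (\<lambda>zhu. bind_pmf (B (fst (fst zhu)) (snd (fst zhu)) (snd zhu)) (\<lambda>v.
        return_pmf (fst (snd (fst zhu)) @ [snd zhu], snd (snd (fst zhu)) @ [v]))) (zip (zip zs s) u))))"
    by (subst seq_pmf_bind) (simp add: case_prod_unfold)
  also have "\<dots> = bind_pmf (block_aux \<kappa> \<eta> k zs) (\<lambda>s. bind_pmf (seq_pmf (map (\<lambda>zh. A (fst zh) (snd zh)) (zip zs s)))
      (\<lambda>u. bind_pmf (seq_pmf (map (\<lambda>zhu. B (fst (fst zhu)) (snd (fst zhu)) (snd zhu)) (zip (zip zs s) u)))
      (\<lambda>v. return_pmf (map (\<lambda>zhuv. (fst (snd (fst (fst zhuv))) @ [snd (fst zhuv)], snd (snd (fst (fst zhuv))) @ [snd zhuv]))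
        (zip (zip (zip zs s) u) v)))))"
    by (subst seq_pmf_bind) (simp add: case_prod_unfold seq_pmf_return)
  also have "\<dots> = do {
     s \<leftarrow> block_aux \<kappa> \<eta> k zs;
     u \<leftarrow> block_kernel (\<kappa> (Suc k)) s (map fst zs);
     v \<leftarrow> block_kernel (\<eta> (Suc k)) (extendU s u) (map snd zs);
     return_pmf (extendV (extendU s u) v)}"
  proof (intro bind_pmf_cong refl)
    fix s
    show A_eq: "seq_pmf (map (\<lambda>zh. A (fst zh) (snd zh)) (zip zs s)) = block_kernel (\<kappa> (Suc k)) s (map fst zs)"
      unfolding block_kernel_def A_def
      by (rule arg_cong[where f = seq_pmf], induction zs s rule: list_induct2') auto
    fix u
    have "map (\<lambda>zhu. B (fst (fst zhu)) (snd (fst zhu)) (snd zhu)) (zip (zip zs s) u)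
      = map2 (\<lambda>(us, vs) y. \<eta> (Suc k) (us, vs, y)) (extendU s u) (map snd zs)"
      unfolding B_def extendU_def
    proof (induction zs arbitrary: s u)
      case (Cons z zs)
      show ?case by (cases s; cases u) (auto simp: Cons.IH)
    qed simp
    then show "seq_pmf (map (\<lambda>zhu. B (fst (fst zhu)) (snd (fst zhu)) (snd zhu)) (zip (zip zs s) u))
      = block_kernel (\<eta> (Suc k)) (extendU s u) (map snd zs)"
      unfolding block_kernel_def by simp
    fix v
    assume "s \<in> set_pmf (block_aux \<kappa> \<eta> k zs)" 
    \<comment> \<open>Equal lengths keep \<open>zip\<close> from truncating; otherwise the two ways
      of pairing could differ.\<close>
    then have len: "length s = length zs" by (auto simp: block_aux_def dest: length_seq_pmf)
    have "map (\<lambda>zhuv. (fst (snd (fst (fst zhuv))) @ [snd (fst zhuv)], snd (snd (fst (fst zhuv))) @ [snd zhuv]))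
        (zip (zip (zip zs s) u) v) = extendV (extendU s u) v"
      unfolding extendU_def extendV_def using len
    proof (induction zs arbitrary: s u v)
      case (Cons z zs)
      then show ?case by (cases s; cases u; cases v) auto
    qed simp
    then show "return_pmf (map (\<lambda>zhuv. (fst (snd (fst (fst zhuv))) @ [snd (fst zhuv)], snd (snd (fst (fst zhuv))) @ [snd zhuv]))
        (zip (zip (zip zs s) u) v)) = return_pmf (extendV (extendU s u) v)" by simp
  qed
  finally show ?thesis .
qed

lemma length_block_kernel: "u \<in> set_pmf (block_kernel \<kappa> s x) \<Longrightarrow> length u = min (length s) (length x)"
  by (auto simp: block_kernel_def dest: length_seq_pmf)

lemma length_block_aux: "s \<in> set_pmf (block_aux \<kappa> \<eta> k zs) \<Longrightarrow> length s = length zs"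
  by (auto simp: block_aux_def dest: length_seq_pmf)

lemma length_aux_pmf: "(us, vs) \<in> set_pmf (aux_pmf \<kappa> \<eta> x y k) \<Longrightarrow> length us = k \<and> length vs = k"
  by (induction k arbitrary: us vs) auto

lemma depth_block_aux:
  assumes "s \<in> set_pmf (block_aux \<kappa> \<eta> k zs)" "(us, vs) \<in> set s"
  shows "length us = k \<and> length vs = k"
proof -
  have "list_all2 (\<lambda>h p. h \<in> set_pmf p) s (map (\<lambda>(x, y). aux_pmf \<kappa> \<eta> x y k) zs)"
    using assms(1) by (simp add: block_aux_def set_seq_pmf)
  then show ?thesis using assms(2)
    by (auto simp: list_all2_conv_all_nth in_set_conv_nth case_prod_beta dest!: spec dest: length_aux_pmf)
qed

text \<open>The state just before the letter of A in round \<open>j\<close>, recovered from a later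
  state; \<open>pastV\<close> already includes that letter. Rounds count from 1, whence
  \<open>j - 1\<close>.\<close>

definition pastU :: "nat \<Rightarrow> state \<Rightarrow> state" where
  "pastU j s = map (\<lambda>(us, vs). (take (j - 1) us, take (j - 1) vs)) s"

definition pastV :: "nat \<Rightarrow> state \<Rightarrow> state" where
  "pastV j s = map (\<lambda>(us, vs). (take j us, take (j - 1) vs)) s"

definition lettersU :: "nat \<Rightarrow> state \<Rightarrow> nat list" where
  "lettersU j s = map (\<lambda>(us, vs). us ! (j - 1)) s"

definition lettersV :: "nat \<Rightarrow> state \<Rightarrow> nat list" where
  "lettersV j s = map (\<lambda>(us, vs). vs ! (j - 1)) s"

text \<open>Rounds only append, so the tests of earlier rounds can be read off from the final state.
  Passing all tests thereby becomes an event about complete outcomes.\<close>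

lemma past_extend:
  assumes "length u = length s" "length v = length s"
    and "\<And>us vs. (us, vs) \<in> set s \<Longrightarrow> length us = k \<and> length vs = k"
  defines "t \<equiv> extendV (extendU s u) v"
  shows "pastU (Suc k) t = s" "pastV (Suc k) t = extendU s u"
    "lettersU (Suc k) t = u" "lettersV (Suc k) t = v"
    "\<And>j. j \<in> {1..k} \<Longrightarrow> pastU j t = pastU j s" "\<And>j. j \<in> {1..k} \<Longrightarrow> pastV j t = pastV j s"
    "\<And>j. j \<in> {1..k} \<Longrightarrow> lettersU j t = lettersU j s" "\<And>j. j \<in> {1..k} \<Longrightarrow> lettersV j t = lettersV j s"
proof -
  have nth: "length us = k \<and> length vs = k" if "i < length s" "s ! i = (us, vs)" for i us vs
    using assms(3)[of us vs] that by (metis nth_mem)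
  have len: "length t = length s" using assms(1,2) by (simp add: t_def extendV_def extendU_def)
  have t: "t ! i = (fst (s ! i) @ [u ! i], snd (s ! i) @ [v ! i])" if "i < length s" for i
    using assms(1,2) that by (simp add: t_def extendV_def extendU_def case_prod_beta)
  have l: "length (fst (s ! i)) = k" "length (snd (s ! i)) = k" if "i < length s" for i
    using nth[OF that, of "fst (s ! i)" "snd (s ! i)"] by auto
  show "pastU (Suc k) t = s" "pastV (Suc k) t = extendU s u"
    "lettersU (Suc k) t = u" "lettersV (Suc k) t = v"
    "\<And>j. j \<in> {1..k} \<Longrightarrow> pastU j t = pastU j s" "\<And>j. j \<in> {1..k} \<Longrightarrow> pastV j t = pastV j s"
    "\<And>j. j \<in> {1..k} \<Longrightarrow> lettersU j t = lettersU j s" "\<And>j. j \<in> {1..k} \<Longrightarrow> lettersV j t = lettersV j s"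
    by (auto intro!: nth_equalityI simp: pastU_def pastV_def lettersU_def lettersV_def len t l
        case_prod_beta extendU_def assms(1,2) nth_append)
qed

lemma finite_lists_of_length: "finite {xs :: 'a::finite list. length xs = n}"
  using finite_lists_length_eq[OF finite[of "UNIV :: 'a set"], of n] by simp

section \<open>Sums over blocks and the n-fold law with bars\<close>

lemma sum_blocks:
  fixes W :: "('x::finite \<times> 'y::finite) pmf" and f :: "'x list \<Rightarrow> 'y list \<Rightarrow> real"
  shows "(\<Sum>x\<in>{x. length x = n}. \<Sum>y\<in>{y. length y = n}. pmf (replicate_pmf n W) (zip x y) * f x y)
    = measure_pmf.expectation (replicate_pmf n W) (\<lambda>zs. f (map fst zs) (map snd zs))"
proof -
  have bij: "bij_betw (\<lambda>(x, y). zip x y) ({x :: 'x list. length x = n} \<times> {y :: 'y list. length y = n})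
      {zs. length zs = n}"
    by (rule bij_betw_byWitness[where f' = "\<lambda>zs. (map fst zs, map snd zs)"]) (auto simp: zip_map_fst_snd)
  have "measure_pmf.expectation (replicate_pmf n W) (\<lambda>zs. f (map fst zs) (map snd zs))
    = (\<Sum>zs\<in>{zs. length zs = n}. f (map fst zs) (map snd zs) * pmf (replicate_pmf n W) zs)"
    by (rule integral_measure_pmf_real[OF finite_lists_of_length]) (auto simp: set_replicate_pmf)
  also have "\<dots> = (\<Sum>(x, y)\<in>{x. length x = n} \<times> {y. length y = n}.
      f (map fst (zip x y)) (map snd (zip x y)) * pmf (replicate_pmf n W) (zip x y))"
    by (subst sum.reindex_bij_betw[OF bij, symmetric]) (simp add: case_prod_unfold)
  also have "\<dots> = (\<Sum>(x, y)\<in>{x. length x = n} \<times> {y. length y = n}. pmf (replicate_pmf n W) (zip x y) * f x y)"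
    by (intro sum.cong refl) auto
  finally show ?thesis by (simp add: sum.cartesian_product)
qed

text \<open>Coordinatewise sampling regrouped: the source block is drawn before the histories, the
  order in which a code meets them.\<close>

lemma replicate_bar_law:
  "replicate_pmf n (bar_law W K \<kappa> \<eta>) = do {
     zs \<leftarrow> replicate_pmf n W;
     s \<leftarrow> block_aux \<kappa> \<eta> K zs;
     return_pmf (map2 (\<lambda>z h. (fst h, snd h, z)) zs s)}"
proof -
  have "replicate_pmf n (bar_law W K \<kappa> \<eta>) = seq_pmf (map (\<lambda>_. bind_pmf W (\<lambda>z.
      bind_pmf (aux_pmf \<kappa> \<eta> (fst z) (snd z) K) (\<lambda>h. return_pmf (fst h, snd h, z)))) (replicate n ()))"
    by (simp add: bar_law_def case_prod_unfold map_replicate flip: seq_pmf_replicate)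
  also have "\<dots> = bind_pmf (replicate_pmf n W) (\<lambda>zs. seq_pmf (map2 (\<lambda>_ z.
      bind_pmf (aux_pmf \<kappa> \<eta> (fst z) (snd z) K) (\<lambda>h. return_pmf (fst h, snd h, z))) (replicate n ()) zs))"
    by (subst seq_pmf_bind) (simp add: map_replicate seq_pmf_replicate)
  also have "\<dots> = bind_pmf (replicate_pmf n W) (\<lambda>zs. seq_pmf (map (\<lambda>z.
      bind_pmf (aux_pmf \<kappa> \<eta> (fst z) (snd z) K) (\<lambda>h. return_pmf (fst h, snd h, z))) zs))"
  proof (intro bind_pmf_cong refl arg_cong[where f = seq_pmf])
    fix zs assume "zs \<in> set_pmf (replicate_pmf n W)"
    then have "length zs = n" by (auto simp: set_replicate_pmf)
    then show "map2 (\<lambda>_ z. bind_pmf (aux_pmf \<kappa> \<eta> (fst z) (snd z) K) (\<lambda>h. return_pmf (fst h, snd h, z))) (replicate n ()) zs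
      = map (\<lambda>z. bind_pmf (aux_pmf \<kappa> \<eta> (fst z) (snd z) K) (\<lambda>h. return_pmf (fst h, snd h, z))) zs"
      by (auto intro: nth_equalityI)
  qed
  also have "\<dots> = bind_pmf (replicate_pmf n W) (\<lambda>zs. bind_pmf (block_aux \<kappa> \<eta> K zs)
      (\<lambda>s. return_pmf (map2 (\<lambda>z h. (fst h, snd h, z)) zs s)))"
    by (subst seq_pmf_bind) (simp add: block_aux_def case_prod_unfold seq_pmf_return)
  finally show ?thesis .
qed

definition state_of :: "('x, 'y) outcome list \<Rightarrow> state" where
  "state_of = map (\<lambda>(us, vs, x, y). (us, vs))"

lemma outcome_blocks:
  assumes "length s = length zs"
  defines "ws \<equiv> map2 (\<lambda>z h. (fst h, snd h, z)) zs s"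
  shows "state_of ws = s" "map rv_X ws = map fst zs" "map rv_Y ws = map snd zs"
  using assms(1) unfolding ws_def state_of_def
  by (auto intro!: nth_equalityI simp: rv_X_def rv_Y_def case_prod_unfold)

text \<open>States become lists of histories, and block kernels are products over positions.
  \<open>accX\<close> and \<open>accY\<close> are the final tests of the two nodes, left open
  here.\<close>

locale block_scheme =
  fixes \<kappa> :: "nat \<Rightarrow> nat list \<times> nat list \<times> 'x::finite \<Rightarrow> nat pmf"
    and \<eta> :: "nat \<Rightarrow> nat list \<times> nat list \<times> 'y::finite \<Rightarrow> nat pmf"
    and \<rho> \<sigma> :: "nat \<Rightarrow> nat list \<times> nat list \<Rightarrow> nat pmf"
    and c d :: "nat \<Rightarrow> real" and M N :: "nat \<Rightarrow> nat" and \<theta> \<tau> :: real and K n :: nat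
    and accX :: "state \<Rightarrow> 'x list \<Rightarrow> bool" and accY :: "state \<Rightarrow> 'y list \<Rightarrow> bool"
  assumes finite_letters: "\<And>k b. finite (set_pmf (\<kappa> k b))" "\<And>k b. finite (set_pmf (\<eta> k b))"
      "\<And>k h. finite (set_pmf (\<rho> k h))" "\<And>k h. finite (set_pmf (\<sigma> k h))"
    and cd: "\<And>k. c k \<ge> 1" "\<And>k. d k \<ge> 1"
    and \<theta>: "0 \<le> \<theta>" "\<And>k. \<theta> \<le> 1 - (1 - 1 / c k) ^ M k" "\<And>k. \<theta> \<le> 1 - (1 - 1 / d k) ^ N k"
    and \<tau>: "0 \<le> \<tau>" "\<And>k. real (M k) / c k \<le> \<tau>" "\<And>k. real (N k) / d k \<le> \<tau>"
    and K: "K \<ge> 1"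
begin

text \<open>The information density of the block is at most \<open>log 2 (c k)\<close>; the product
  form avoids dividing by a reference law that may vanish.\<close>

definition goodA :: "nat \<Rightarrow> state \<Rightarrow> nat list \<Rightarrow> 'x list \<Rightarrow> bool" where
  "goodA k s u x \<longleftrightarrow> pmf (block_kernel (\<kappa> k) s x) u \<le> c k * pmf (seq_pmf (map (\<rho> k) s)) u"

text \<open>Only the sender of the last message can check \<open>accY\<close>.\<close>

definition goodB :: "nat \<Rightarrow> state \<Rightarrow> nat list \<Rightarrow> 'y list \<Rightarrow> bool" where
  "goodB k s v y \<longleftrightarrow> pmf (block_kernel (\<eta> k) s y) v \<le> d k * pmf (seq_pmf (map (\<sigma> k) s)) v \<and>
     (k = K \<longrightarrow> accY (extendV s v) y)"

sublocale covering_scheme "{x. length x = n}" "{y. length y = n}"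
  "\<lambda>k. block_kernel (\<kappa> k)" "\<lambda>k. block_kernel (\<eta> k)"
  "\<lambda>k s. seq_pmf (map (\<rho> k) s)" "\<lambda>k s. seq_pmf (map (\<sigma> k) s)"
  extendU extendV goodA goodB accX c d M N \<theta> \<tau>
proof
  show "finite {x :: 'x list. length x = n}" "finite {y :: 'y list. length y = n}"
    by (rule finite_lists_of_length)+
  show "finite (set_pmf (block_kernel (\<kappa> k) s x))" "finite (set_pmf (block_kernel (\<eta> k) s y))"
    "finite (set_pmf (seq_pmf (map (\<rho> k) s)))" "finite (set_pmf (seq_pmf (map (\<sigma> k) s)))" for k s x y
    using finite_letters by (auto simp: block_kernel_def intro!: finite_set_seq_pmf)
qed (use cd \<theta> \<tau> in \<open>auto simp: goodA_def goodB_def\<close>)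

definition good_upto :: "nat \<Rightarrow> state \<Rightarrow> 'x list \<Rightarrow> 'y list \<Rightarrow> bool" where
  "good_upto k s x y \<longleftrightarrow> (\<forall>j\<in>{1..k}. goodA j (pastU j s) (lettersU j s) x \<and> goodB j (pastV j s) (lettersV j s) y)"

lemma finite_block_kernel:
  "finite (set_pmf (block_kernel (\<kappa> k) s x))" "finite (set_pmf (block_kernel (\<eta> k) s y))"
  using finite_letters by (auto simp: block_kernel_def intro!: finite_set_seq_pmf)

lemma finite_aux_pmf: "finite (set_pmf (aux_pmf \<kappa> \<eta> x y k))"
  using finite_letters by (induction k) (auto simp: case_prod_unfold)

lemma finite_block_aux: "finite (set_pmf (block_aux \<kappa> \<eta> k zs))"
  by (auto simp: block_aux_def case_prod_unfold intro!: finite_set_seq_pmf finite_aux_pmf)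

text \<open>\<open>val\<close> is a nested recursion over rounds, whereas a probability of complete
  histories is wanted. The statement interpolates: the first \<open>k\<close> rounds are sampled and
  the rest is still inside \<open>val\<close>; the case \<open>k = K\<close> is the goal.\<close>

lemma val_eq_expectation:
  assumes "k \<le> K"
  shows "val [1..<Suc K] (replicate (length zs) ([], [])) (map fst zs) (map snd zs) =
    measure_pmf.expectation (block_aux \<kappa> \<eta> k zs) (\<lambda>s.
      of_bool (good_upto k s (map fst zs) (map snd zs)) * val [Suc k..<Suc K] s (map fst zs) (map snd zs))"
  using assms
proof (induction k)
  case 0
  show ?case by (simp add: block_aux_0 good_upto_def del: upt_Suc)
next
  case (Suc k)
  let ?x = "map fst zs" and ?y = "map snd zs" and ?ks = "[Suc (Suc k)..<Suc K]"
  let ?F = "\<lambda>s. of_bool (good_upto (Suc k) s ?x ?y) * val ?ks s ?x ?y"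
  have upt: "[Suc k..<Suc K] = Suc k # ?ks" using Suc.prems by (intro upt_conv_Cons) auto
  have step: "of_bool (good_upto k s ?x ?y) * val [Suc k..<Suc K] s ?x ?y =
     measure_pmf.expectation (block_kernel (\<kappa> (Suc k)) s ?x) (\<lambda>u.
       measure_pmf.expectation (block_kernel (\<eta> (Suc k)) (extendU s u) ?y) (\<lambda>v. ?F (extendV (extendU s u) v)))"
    if s: "s \<in> set_pmf (block_aux \<kappa> \<eta> k zs)" for s
  proof -
    note len_s = length_block_aux[OF s] and depth = depth_block_aux[OF s]
    have "of_bool (good_upto k s ?x ?y) * val [Suc k..<Suc K] s ?x ?y =
      measure_pmf.expectation (block_kernel (\<kappa> (Suc k)) s ?x) (\<lambda>u.
        of_bool (good_upto k s ?x ?y) * (if goodA (Suc k) s u ?x then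
        measure_pmf.expectation (block_kernel (\<eta> (Suc k)) (extendU s u) ?y) (\<lambda>v.
          if goodB (Suc k) (extendU s u) v ?y then val ?ks (extendV (extendU s u) v) ?x ?y else 0) else 0))"
      unfolding upt val.simps by simp
    also have "\<dots> = measure_pmf.expectation (block_kernel (\<kappa> (Suc k)) s ?x) (\<lambda>u.
       measure_pmf.expectation (block_kernel (\<eta> (Suc k)) (extendU s u) ?y) (\<lambda>v. ?F (extendV (extendU s u) v)))"
    proof (intro integral_cong_AE AE_pmfI)
      fix u assume "u \<in> set_pmf (block_kernel (\<kappa> (Suc k)) s ?x)"
      then have len_u: "length u = length s" using len_s by (simp add: length_block_kernel)
      have "measure_pmf.expectation (block_kernel (\<eta> (Suc k)) (extendU s u) ?y) (\<lambda>v. ?F (extendV (extendU s u) v))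
        = measure_pmf.expectation (block_kernel (\<eta> (Suc k)) (extendU s u) ?y) (\<lambda>v.
          of_bool (good_upto k s ?x ?y) * (of_bool (goodA (Suc k) s u ?x) *
          (if goodB (Suc k) (extendU s u) v ?y then val ?ks (extendV (extendU s u) v) ?x ?y else 0)))"
      proof (intro integral_cong_AE AE_pmfI)
        fix v assume "v \<in> set_pmf (block_kernel (\<eta> (Suc k)) (extendU s u) ?y)"
        then have len_v: "length v = length s"
          using len_s len_u by (simp add: length_block_kernel extendU_def)
        note past = past_extend[OF len_u len_v depth]
        have "good_upto (Suc k) (extendV (extendU s u) v) ?x ?y \<longleftrightarrow> good_upto k s ?x ?y \<and>
            goodA (Suc k) s u ?x \<and> goodB (Suc k) (extendU s u) v ?y"
        proof -
          let ?t = "extendV (extendU s u) v"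
          have "{1..Suc k} = insert (Suc k) {1..k}" by auto
          then have upto: "(\<forall>j\<in>{1..Suc k}. Z j) \<longleftrightarrow> Z (Suc k) \<and> (\<forall>j\<in>{1..k}. Z j)" for Z by simp
          have "(\<forall>j\<in>{1..k}. goodA j (pastU j ?t) (lettersU j ?t) ?x \<and> goodB j (pastV j ?t) (lettersV j ?t) ?y)
            \<longleftrightarrow> good_upto k s ?x ?y"
            unfolding good_upto_def by (intro ball_cong refl) (simp only: past)
          then show ?thesis
            unfolding good_upto_def[of "Suc k"] upto by (simp only: past(1-4)) blast
        qed
        then show "?F (extendV (extendU s u) v) = of_bool (good_upto k s ?x ?y) * (of_bool (goodA (Suc k) s u ?x) *
          (if goodB (Suc k) (extendU s u) v ?y then val ?ks (extendV (extendU s u) v) ?x ?y else 0))"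
          by simp
      qed auto
      then show "of_bool (good_upto k s ?x ?y) * (if goodA (Suc k) s u ?x then
        measure_pmf.expectation (block_kernel (\<eta> (Suc k)) (extendU s u) ?y) (\<lambda>v.
          if goodB (Suc k) (extendU s u) v ?y then val ?ks (extendV (extendU s u) v) ?x ?y else 0) else 0)
        = measure_pmf.expectation (block_kernel (\<eta> (Suc k)) (extendU s u) ?y) (\<lambda>v. ?F (extendV (extendU s u) v))"
        by simp
    qed auto
    finally show ?thesis .
  qed
  have "measure_pmf.expectation (block_aux \<kappa> \<eta> (Suc k) zs) ?F =
    measure_pmf.expectation (block_aux \<kappa> \<eta> k zs) (\<lambda>s. 
     measure_pmf.expectation (block_kernel (\<kappa> (Suc k)) s ?x) (\<lambda>u.
       measure_pmf.expectation (block_kernel (\<eta> (Suc k)) (extendU s u) ?y) (\<lambda>v. ?F (extendV (extendU s u) v))))"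
    unfolding block_aux_Suc
    by (simp add: expectation_bind_pmf finite_block_aux finite_block_kernel)
  also have "\<dots> = measure_pmf.expectation (block_aux \<kappa> \<eta> k zs) (\<lambda>s.
      of_bool (good_upto k s ?x ?y) * val [Suc k..<Suc K] s ?x ?y)"
    by (intro integral_cong_AE AE_pmfI step[symmetric]) auto
  finally show ?case using Suc by simp
qed

definition good_outcomes :: "('x, 'y) outcome list set" where
  "good_outcomes = {ws. good_upto K (state_of ws) (map rv_X ws) (map rv_Y ws) \<and> accX (state_of ws) (map rv_X ws)}"

text \<open>Links the ideal value to single-letter laws: its average over the source is the chance
  of passing all tests under independent copies of the law with bars, for either hypothesis
  \<open>W\<close>.\<close>

lemma expectation_val:
  fixes W :: "('x \<times> 'y) pmf"
  shows "measure_pmf.expectation (replicate_pmf n W)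
      (\<lambda>zs. val [1..<Suc K] (replicate n ([], [])) (map fst zs) (map snd zs))
    = measure_pmf.prob (replicate_pmf n (bar_law W K \<kappa> \<eta>)) good_outcomes"
proof -
  have fin: "finite (set_pmf (replicate_pmf n W))" by (intro finite_set_replicate_pmf) simp
  have "measure_pmf.prob (replicate_pmf n (bar_law W K \<kappa> \<eta>)) good_outcomes =
    measure_pmf.expectation (replicate_pmf n W) (\<lambda>zs. measure_pmf.expectation (block_aux \<kappa> \<eta> K zs)
      (\<lambda>s. of_bool (map2 (\<lambda>z h. (fst h, snd h, z)) zs s \<in> good_outcomes)))"
    unfolding prob_eq_expectation[of _ "\<lambda>ws. ws \<in> good_outcomes", unfolded Collect_mem_eq] replicate_bar_law
    by (simp add: expectation_bind_pmf fin finite_block_aux)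
  also have "\<dots> = measure_pmf.expectation (replicate_pmf n W)
      (\<lambda>zs. val [1..<Suc K] (replicate n ([], [])) (map fst zs) (map snd zs))"
  proof (intro integral_cong_AE AE_pmfI)
    fix zs assume "zs \<in> set_pmf (replicate_pmf n W)"
    then have n: "length zs = n" by (auto simp: set_replicate_pmf)
    have "val [1..<Suc K] (replicate n ([], [])) (map fst zs) (map snd zs) =
      measure_pmf.expectation (block_aux \<kappa> \<eta> K zs) (\<lambda>s.
      of_bool (good_upto K s (map fst zs) (map snd zs)) * of_bool (accX s (map fst zs)))"
      using val_eq_expectation[of K zs] unfolding n by simp
    also have "\<dots> = measure_pmf.expectation (block_aux \<kappa> \<eta> K zs)
      (\<lambda>s. of_bool (map2 (\<lambda>z h. (fst h, snd h, z)) zs s \<in> good_outcomes))"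
    proof (intro integral_cong_AE AE_pmfI)
      fix s assume "s \<in> set_pmf (block_aux \<kappa> \<eta> K zs)"
      note len = length_block_aux[OF this]
      show "of_bool (good_upto K s (map fst zs) (map snd zs)) * of_bool (accX s (map fst zs))
        = (of_bool (map2 (\<lambda>z h. (fst h, snd h, z)) zs s \<in> good_outcomes) :: real)"
        unfolding good_outcomes_def mem_Collect_eq outcome_blocks[OF len] by simp
    qed auto
    finally show "measure_pmf.expectation (block_aux \<kappa> \<eta> K zs)
      (\<lambda>s. of_bool (map2 (\<lambda>z h. (fst h, snd h, z)) zs s \<in> good_outcomes))
      = val [1..<Suc K] (replicate n ([], [])) (map fst zs) (map snd zs)" by simp
  qed auto
  finally show ?thesis by simp
qed

text \<open>With the block probabilities under \<open>P\<close> as \<open>a\<close>, and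
  \<open>w\<close> times those under \<open>Q\<close> as \<open>b\<close>, the payoff of a tree is
  \<open>1 - \<alpha> - w * \<beta>\<close>; a single inequality controls both errors of one
  code.\<close>

lemma exists_code:
  fixes P Q :: "('x \<times> 'y) pmf" and w :: real
  assumes w: "0 \<le> w"
  shows "\<exists>C :: ('x, 'y) code. is_code K n C \<and> size_A C = (\<lambda>k. Suc (M k)) \<and> size_B C = (\<lambda>k. Suc (N k)) \<and>
    \<theta> ^ (2 * K) * measure_pmf.prob (replicate_pmf n (bar_law P K \<kappa> \<eta>)) good_outcomes -
    w * \<tau> ^ (2 * K) * measure_pmf.prob (replicate_pmf n (bar_law Q K \<kappa> \<eta>)) good_outcomes
    \<le> 1 - prob_decide K n C P 1 - w * prob_decide K n C Q 0"
proof -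
  define a where "a x y = pmf (replicate_pmf n P) (zip x y)" for x y
  define b where "b x y = w * pmf (replicate_pmf n Q) (zip x y)" for x y
  let ?X = "{x :: 'x list. length x = n}" and ?Y = "{y :: 'y list. length y = n}"
  let ?val = "val [1..<Suc K] (replicate n ([], []))"
  have "\<exists>t. well_sized (\<lambda>k. Suc (M k)) (\<lambda>k. Suc (N k)) [1..<Suc K] t \<and>
    (\<Sum>x\<in>?X. \<Sum>y\<in>?Y. (\<theta> ^ (2 * length [1..<Suc K]) * a x y - \<tau> ^ (2 * length [1..<Suc K]) * b x y) * ?val x y)
    \<le> (\<Sum>x\<in>?X. \<Sum>y\<in>?Y. if accepts t x y then a x y - b x y else 0)"
    by (rule exists_ptree) (use w in \<open>auto simp: a_def b_def\<close>)
  then obtain t where t: "well_sized (\<lambda>k. Suc (M k)) (\<lambda>k. Suc (N k)) [1..<Suc K] t"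
    and le: "(\<Sum>x\<in>?X. \<Sum>y\<in>?Y. (\<theta> ^ (2 * K) * a x y - \<tau> ^ (2 * K) * b x y) * ?val x y)
    \<le> (\<Sum>x\<in>?X. \<Sum>y\<in>?Y. if accepts t x y then a x y - b x y else 0)"
    unfolding length_upt diff_Suc_1 by iprover
  define C where "C = code_of_ptree (\<lambda>k. Suc (M k)) (\<lambda>k. Suc (N k)) t"
  note is_code = is_code_of_ptree[OF t, of n, folded C_def]
  have decide: "decision C (map fst zs) (snd (transcript C (map fst zs) (map snd zs) K))
      = (if accepts t (map fst zs) (map snd zs) then 0 else 1)" for zs
    using decision_code_of_ptree[OF t] unfolding C_def by simp
  have dec0: "prob_decide K n C W 0 = measure_pmf.expectation (replicate_pmf n W)
      (\<lambda>zs. of_bool (accepts t (map fst zs) (map snd zs)))" for W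
  proof -
    have "((if b then 0 else 1) = (0::nat)) = b" for b by simp
    then show ?thesis unfolding prob_decide_def decide prob_eq_expectation by simp
  qed
  have dec1: "prob_decide K n C W 1 = 1 - prob_decide K n C W 0" for W
  proof -
    have "prob_decide K n C W 1 = measure_pmf.prob (replicate_pmf n W) (space (replicate_pmf n W) -
        {zs. decision C (map fst zs) (snd (transcript C (map fst zs) (map snd zs) K)) = 0})"
      unfolding prob_decide_def decide by (intro arg_cong[where f = "measure_pmf.prob _"]) auto
    also have "\<dots> = 1 - prob_decide K n C W 0"
      unfolding prob_decide_def by (rule measure_pmf.prob_compl) simp
    finally show ?thesis .
  qed
  have "(\<Sum>x\<in>?X. \<Sum>y\<in>?Y. (\<theta> ^ (2 * K) * a x y - \<tau> ^ (2 * K) * b x y) * ?val x y)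
    = \<theta> ^ (2 * K) * (\<Sum>x\<in>?X. \<Sum>y\<in>?Y. pmf (replicate_pmf n P) (zip x y) * ?val x y)
      - w * \<tau> ^ (2 * K) * (\<Sum>x\<in>?X. \<Sum>y\<in>?Y. pmf (replicate_pmf n Q) (zip x y) * ?val x y)"
    unfolding sum_distrib_left sum_subtractf[symmetric] a_def b_def
    by (intro sum.cong refl) (simp add: left_diff_distrib mult.assoc mult.left_commute)
  also have "\<dots> = \<theta> ^ (2 * K) * measure_pmf.prob (replicate_pmf n (bar_law P K \<kappa> \<eta>)) good_outcomes -
    w * \<tau> ^ (2 * K) * measure_pmf.prob (replicate_pmf n (bar_law Q K \<kappa> \<eta>)) good_outcomes"
    unfolding sum_blocks expectation_val ..
  finally have lhs: "(\<Sum>x\<in>?X. \<Sum>y\<in>?Y. (\<theta> ^ (2 * K) * a x y - \<tau> ^ (2 * K) * b x y) * ?val x y) = \<dots>" .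
  have "(\<Sum>x\<in>?X. \<Sum>y\<in>?Y. if accepts t x y then a x y - b x y else 0)
    = (\<Sum>x\<in>?X. \<Sum>y\<in>?Y. pmf (replicate_pmf n P) (zip x y) * of_bool (accepts t x y))
      - w * (\<Sum>x\<in>?X. \<Sum>y\<in>?Y. pmf (replicate_pmf n Q) (zip x y) * of_bool (accepts t x y))"
    unfolding sum_distrib_left sum_subtractf[symmetric] a_def b_def
    by (intro sum.cong refl) simp
  also have "\<dots> = 1 - prob_decide K n C P 1 - w * prob_decide K n C Q 0"
    unfolding sum_blocks dec1 dec0 by simp
  finally have "1 - prob_decide K n C P 1 - w * prob_decide K n C Q 0 = 
    (\<Sum>x\<in>?X. \<Sum>y\<in>?Y. if accepts t x y then a x y - b x y else 0)" by simp
  then show ?thesis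
    using is_code le unfolding lhs by (intro exI[of _ C]) (simp add: C_def code_of_ptree_def)
qed

end

section \<open>Markov chains and single-letter kernels\<close>

lemma pmf_bind_tagged:
  "pmf (bind_pmf \<mu> (\<lambda>b. map_pmf (\<lambda>a. (a, b)) (\<kappa> b))) (a, b) = pmf \<mu> b * pmf (\<kappa> b) a"
proof -
  have "pmf (map_pmf (\<lambda>a. (a, b')) (\<kappa> b')) (a, b) = pmf (\<kappa> b) a * of_bool (b' = b)" for b'
  proof (cases "b' = b")
    case True
    have "pmf (map_pmf (\<lambda>a. (a, b)) (\<kappa> b)) ((\<lambda>a. (a, b)) a) = pmf (\<kappa> b) a"
      by (rule pmf_map_inj') (auto simp: inj_on_def)
    then show ?thesis using True by simp
  qed (auto simp: pmf_eq_0_set_pmf)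
  then have "pmf (bind_pmf \<mu> (\<lambda>b. map_pmf (\<lambda>a. (a, b)) (\<kappa> b))) (a, b) = (\<integral>b'. pmf (\<kappa> b) a * of_bool (b' = b) \<partial>\<mu>)"
    by (simp add: pmf_bind)
  also have "\<dots> = (\<Sum>b'\<in>{b}. pmf (\<kappa> b) a * of_bool (b' = b) * pmf \<mu> b')"
    by (rule integral_measure_pmf_real) auto
  finally show ?thesis by simp
qed

lemma pmf_map_prob: "pmf (map_pmf A p) a = measure_pmf.prob p {\<omega>. A \<omega> = a}"
  by (simp add: pmf_map vimage_def)

text \<open>By the Markov property the kernel at \<open>B\<close> may be applied after
  \<open>C\<close> is known. Where \<open>B = b\<close> is null both sides vanish, so the version of
  the kernel is immaterial. \<open>f\<close> allows the conditioning tuple to be reordered.\<close>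

lemma markov_chain_law:
  fixes A :: "'w \<Rightarrow> 'a" and B :: "'w \<Rightarrow> 'b" and C :: "'w \<Rightarrow> 'c"
  assumes markov: "markov_chain p A (\<lambda>\<omega>. f (B \<omega>)) C" and f: "inj f" and \<kappa>: "is_cond_law p A B \<kappa>"
  shows "map_pmf (\<lambda>\<omega>. (A \<omega>, B \<omega>, C \<omega>)) p =
    bind_pmf (map_pmf (\<lambda>\<omega>. (B \<omega>, C \<omega>)) p) (\<lambda>bc. map_pmf (\<lambda>a. (a, bc)) (\<kappa> (fst bc)))"
proof (rule pmf_eqI)
  fix abc :: "'a \<times> 'b \<times> 'c"
  obtain a b c where abc: "abc = (a, b, c)" by (cases abc) auto
  let ?pr = "measure_pmf.prob p"
  have B: "{\<omega>. f (B \<omega>) = f b} = {\<omega>. B \<omega> = b}" using f by (auto simp: inj_eq)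
  have eq: "?pr {\<omega>. A \<omega> = a \<and> B \<omega> = b \<and> C \<omega> = c} = ?pr {\<omega>. B \<omega> = b \<and> C \<omega> = c} * pmf (\<kappa> b) a"
  proof (cases "?pr {\<omega>. B \<omega> = b} = 0")
    case True
    then have "?pr {\<omega>. A \<omega> = a \<and> B \<omega> = b \<and> C \<omega> = c} = 0" "?pr {\<omega>. B \<omega> = b \<and> C \<omega> = c} = 0"
      by (auto simp: measure_pmf_zero_iff)
    then show ?thesis by simp
  next
    case False
    then have pos: "?pr {\<omega>. B \<omega> = b} > 0" by (simp add: zero_less_measure_iff)
    have "pmf (\<kappa> b) a = ?pr {\<omega>. A \<omega> = a \<and> B \<omega> = b} / ?pr {\<omega>. B \<omega> = b}"
      using pmf_map_cond_pmf[of B p b A a] \<kappa> pos by (simp add: is_cond_law_def pmf_map_prob)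
    moreover have "?pr {\<omega>. A \<omega> = a \<and> B \<omega> = b \<and> C \<omega> = c} / ?pr {\<omega>. B \<omega> = b}
       = ?pr {\<omega>. A \<omega> = a \<and> B \<omega> = b} / ?pr {\<omega>. B \<omega> = b} * (?pr {\<omega>. B \<omega> = b \<and> C \<omega> = c} / ?pr {\<omega>. B \<omega> = b})"
      using markov[unfolded markov_chain_def, rule_format, of a c "f b"] f
      by (simp add: cond_prob_def inj_eq conj_ac)
    ultimately have "?pr {\<omega>. A \<omega> = a \<and> B \<omega> = b \<and> C \<omega> = c} / ?pr {\<omega>. B \<omega> = b}
       = (?pr {\<omega>. B \<omega> = b \<and> C \<omega> = c} * pmf (\<kappa> b) a) / ?pr {\<omega>. B \<omega> = b}"
      by simp
    then show ?thesis using pos by simp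
  qed
  have "pmf (bind_pmf (map_pmf (\<lambda>\<omega>. (B \<omega>, C \<omega>)) p) (\<lambda>bc. map_pmf (\<lambda>a. (a, bc)) (\<kappa> (fst bc)))) abc
     = pmf (map_pmf (\<lambda>\<omega>. (B \<omega>, C \<omega>)) p) (b, c) * pmf (\<kappa> b) a"
    unfolding abc by (subst pmf_bind_tagged) simp
  then show "pmf (map_pmf (\<lambda>\<omega>. (A \<omega>, B \<omega>, C \<omega>)) p) abc =
    pmf (bind_pmf (map_pmf (\<lambda>\<omega>. (B \<omega>, C \<omega>)) p) (\<lambda>bc. map_pmf (\<lambda>a. (a, bc)) (\<kappa> (fst bc)))) abc"
    using eq unfolding abc pmf_map_prob by simp
qed

text \<open>It is the relative entropy between the joint law and the one in which \<open>B\<close>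
  is redrawn from its law given \<open>C\<close> alone. This later makes the likelihood-ratio bounds
  \<open>c k\<close> and \<open>d k\<close> at least 1.\<close>

lemma cond_mutual_info_nonneg:
  fixes A :: "'w \<Rightarrow> 'a::countable" and B :: "'w \<Rightarrow> 'b::countable" and C :: "'w \<Rightarrow> 'c::countable"
  assumes fin: "finite (set_pmf p)"
  shows "0 \<le> cond_mutual_info p A B C"
proof -
  define \<kappa> where "\<kappa> ac = map_pmf B (cond_pmf p {\<omega>. (A \<omega>, C \<omega>) = ac})" for ac
  define \<rho> where "\<rho> c = map_pmf B (cond_pmf p {\<omega>. C \<omega> = c})" for c
  define t where "t = map_pmf (\<lambda>\<omega>. (B \<omega>, A \<omega>, C \<omega>)) p"
  define q where "q = bind_pmf (map_pmf (\<lambda>\<omega>. (A \<omega>, C \<omega>)) p) (\<lambda>ac. map_pmf (\<lambda>b. (b, ac)) (\<rho> (snd ac)))"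
  have pos: "pmf (map_pmf (\<lambda>\<omega>. (A \<omega>, C \<omega>)) p) (A \<omega>, C \<omega>) > 0" "pmf (\<rho> (C \<omega>)) (B \<omega>) > 0" if "\<omega> \<in> set_pmf p" for \<omega>
  proof -
    show "pmf (map_pmf (\<lambda>\<omega>. (A \<omega>, C \<omega>)) p) (A \<omega>, C \<omega>) > 0" using that by (rule pmf_map_positive)
    have "set_pmf p \<inter> {\<omega>'. C \<omega>' = C \<omega>} \<noteq> {}" using that by auto
    then show "pmf (\<rho> (C \<omega>)) (B \<omega>) > 0" using that by (auto simp: \<rho>_def pmf_positive_iff)
  qed
  have pmf_q: "pmf q (B \<omega>, A \<omega>, C \<omega>) = pmf (map_pmf (\<lambda>\<omega>. (A \<omega>, C \<omega>)) p) (A \<omega>, C \<omega>) * pmf (\<rho> (C \<omega>)) (B \<omega>)" for \<omega>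
    unfolding q_def by (subst pmf_bind_tagged) simp
  have pmf_t: "pmf t (B \<omega>, A \<omega>, C \<omega>) = pmf (map_pmf (\<lambda>\<omega>. (A \<omega>, C \<omega>)) p) (A \<omega>, C \<omega>) * pmf (\<kappa> (A \<omega>, C \<omega>)) (B \<omega>)"
    if "\<omega> \<in> set_pmf p" for \<omega>
    using pmf_map_cond_pmf[of "\<lambda>\<omega>. (A \<omega>, C \<omega>)" p "(A \<omega>, C \<omega>)" B "B \<omega>"] pos(1)[OF that]
    unfolding t_def \<kappa>_def by simp
  have "cond_mutual_info p A B C = measure_pmf.expectation p (\<lambda>\<omega>. log 2 (pmf (\<kappa> (A \<omega>, C \<omega>)) (B \<omega>) / pmf (\<rho> (C \<omega>)) (B \<omega>)))"
    unfolding cond_mutual_info_pmf[OF fin] \<kappa>_def \<rho>_def ..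
  also have "\<dots> = measure_pmf.expectation p (\<lambda>\<omega>. log 2 (pmf t (B \<omega>, A \<omega>, C \<omega>) / pmf q (B \<omega>, A \<omega>, C \<omega>)))"
  proof (intro integral_cong_AE AE_pmfI)
    fix \<omega> assume \<omega>: "\<omega> \<in> set_pmf p"
    show "log 2 (pmf (\<kappa> (A \<omega>, C \<omega>)) (B \<omega>) / pmf (\<rho> (C \<omega>)) (B \<omega>)) =
      log 2 (pmf t (B \<omega>, A \<omega>, C \<omega>) / pmf q (B \<omega>, A \<omega>, C \<omega>))"
      using pos(1)[OF \<omega>] unfolding pmf_t[OF \<omega>] pmf_q by simp
  qed auto
  also have "\<dots> = measure_pmf.expectation t (\<lambda>z. log 2 (pmf t z / pmf q z))"
    unfolding t_def by simp
  also have "\<dots> = rel_ent t q"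
    using fin by (simp add: rel_ent_def expectation_finite_pmf t_def del: integral_map_pmf)
  also have "\<dots> \<ge> 0"
  proof (rule rel_ent_nonneg)
    show "finite (set_pmf t)" using fin by (simp add: t_def)
    show "set_pmf t \<subseteq> set_pmf q"
    proof
      fix z assume "z \<in> set_pmf t"
      then obtain \<omega> where "\<omega> \<in> set_pmf p" "z = (B \<omega>, A \<omega>, C \<omega>)" by (auto simp: t_def)
      then show "z \<in> set_pmf q" using pos[of \<omega>] pmf_q[of \<omega>] by (simp add: pmf_positive_iff[symmetric])
    qed
  qed
  finally show ?thesis .
qed

lemma finite_tuples:
  assumes "\<And>k. k \<in> {1..K} \<Longrightarrow> finite (A k)"
  shows "finite (tuples A K)"
proof (rule finite_subset)
  show "tuples A K \<subseteq> {xs. set xs \<subseteq> (\<Union>k\<in>{1..K}. A k) \<and> length xs = K}"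
    by (fastforce simp: tuples_def in_set_conv_nth)
  show "finite {xs. set xs \<subseteq> (\<Union>k\<in>{1..K}. A k) \<and> length xs = K}"
    using assms by (intro finite_lists_length_eq) auto
qed

lemma bar_law_0: "bar_law W 0 \<kappa> \<eta> = map_pmf (\<lambda>(x, y). ([], [], x, y)) W"
  by (simp add: bar_law_def map_pmf_def bind_return_pmf case_prod_unfold)

lemma bar_law_Suc:
  "bar_law W (Suc k) \<kappa> \<eta> = do {
     (us, vs, x, y) \<leftarrow> bar_law W k \<kappa> \<eta>;
     u \<leftarrow> \<kappa> (Suc k) (us, vs, x);
     v \<leftarrow> \<eta> (Suc k) (us @ [u], vs, y);
     return_pmf (us @ [u], vs @ [v], x, y)}"
  by (simp add: bar_law_def bind_assoc_pmf bind_return_pmf case_prod_unfold)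

text \<open>Chain rule: at each letter the Markov condition says that the other node's source adds
  nothing to the conditional law, so the kernels rebuild \<open>p\<close> from its source
  marginal.\<close>

lemma bar_law_unique:
  fixes p :: "('x, 'y) outcome pmf"
  assumes lengths: "\<And>us vs x y. (us, vs, x, y) \<in> set_pmf p \<Longrightarrow> length us = K \<and> length vs = K"
    and P: "map_pmf (\<lambda>\<omega>. (rv_X \<omega>, rv_Y \<omega>)) p = P"
    and markov: "\<And>k. k \<in> {1..K} \<Longrightarrow> markov_chain p (rv_U k)
          (\<lambda>\<omega>. (rv_X \<omega>, rv_U_upto (k - 1) \<omega>, rv_V_upto (k - 1) \<omega>)) rv_Y"
      "\<And>k. k \<in> {1..K} \<Longrightarrow> markov_chain p (rv_V k)
          (\<lambda>\<omega>. (rv_Y \<omega>, rv_U_upto k \<omega>, rv_V_upto (k - 1) \<omega>)) rv_X"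
    and law: "\<And>k. k \<in> {1..K} \<Longrightarrow>
        is_cond_law p (rv_U k) (\<lambda>\<omega>. (rv_U_upto (k - 1) \<omega>, rv_V_upto (k - 1) \<omega>, rv_X \<omega>)) (\<kappa> k)"
      "\<And>k. k \<in> {1..K} \<Longrightarrow>
        is_cond_law p (rv_V k) (\<lambda>\<omega>. (rv_U_upto k \<omega>, rv_V_upto (k - 1) \<omega>, rv_Y \<omega>)) (\<eta> k)"
  shows "bar_law P K \<kappa> \<eta> = p"
proof -
  have "k \<le> K \<Longrightarrow> bar_law P k \<kappa> \<eta> = map_pmf (\<lambda>\<omega>. (rv_U_upto k \<omega>, rv_V_upto k \<omega>, rv_X \<omega>, rv_Y \<omega>)) p" for k
  proof (induction k)
    case 0
    then show ?case
      unfolding bar_law_0 P[symmetric] by (simp add: map_pmf_comp rv_U_upto_def rv_V_upto_def case_prod_unfold)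
  next
    case (Suc k)
    then have k: "Suc k \<in> {1..K}" by auto
    let ?x = "rv_X :: ('x, 'y) outcome \<Rightarrow> 'x" and ?y = "rv_Y :: ('x, 'y) outcome \<Rightarrow> 'y"
    let ?us = "rv_U_upto k :: ('x, 'y) outcome \<Rightarrow> nat list" and ?vs = "rv_V_upto k :: ('x, 'y) outcome \<Rightarrow> nat list"
    let ?us' = "rv_U_upto (Suc k) :: ('x, 'y) outcome \<Rightarrow> nat list"
    have snoc: "rv_U_upto (Suc k) \<omega> = rv_U_upto k \<omega> @ [rv_U (Suc k) \<omega>]"
      "rv_V_upto (Suc k) \<omega> = rv_V_upto k \<omega> @ [rv_V (Suc k) \<omega>]" if "\<omega> \<in> set_pmf p" for \<omega>
    proof -
      obtain us vs x y where \<omega>: "\<omega> = (us, vs, x, y)" by (cases \<omega>) auto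
      then have "length us = K" "length vs = K" using lengths that by auto
      then show "rv_U_upto (Suc k) \<omega> = rv_U_upto k \<omega> @ [rv_U (Suc k) \<omega>]"
        "rv_V_upto (Suc k) \<omega> = rv_V_upto k \<omega> @ [rv_V (Suc k) \<omega>]"
        using k unfolding \<omega> by (auto simp: rv_U_upto_def rv_U_def rv_V_upto_def rv_V_def take_Suc_conv_app_nth)
    qed
    have U: "map_pmf (\<lambda>\<omega>. (rv_U (Suc k) \<omega>, (?us \<omega>, ?vs \<omega>, ?x \<omega>), ?y \<omega>)) p =
      bind_pmf (map_pmf (\<lambda>\<omega>. ((?us \<omega>, ?vs \<omega>, ?x \<omega>), ?y \<omega>)) p) (\<lambda>bc. map_pmf (\<lambda>a. (a, bc)) (\<kappa> (Suc k) (fst bc)))"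
      by (rule markov_chain_law[where f = "\<lambda>(us, vs, x). (x, us, vs)"])
        (use markov(1)[OF k] law(1)[OF k] in \<open>auto simp: inj_def\<close>)
    have V: "map_pmf (\<lambda>\<omega>. (rv_V (Suc k) \<omega>, (?us' \<omega>, ?vs \<omega>, ?y \<omega>), ?x \<omega>)) p =
      bind_pmf (map_pmf (\<lambda>\<omega>. ((?us' \<omega>, ?vs \<omega>, ?y \<omega>), ?x \<omega>)) p) (\<lambda>bc. map_pmf (\<lambda>a. (a, bc)) (\<eta> (Suc k) (fst bc)))"
      by (rule markov_chain_law[where f = "\<lambda>(us, vs, y). (y, us, vs)"])
        (use markov(2)[OF k] law(2)[OF k] in \<open>auto simp: inj_def\<close>)
    \<comment> \<open>The tuple is regrouped so that the new letter of A belongs to the past of the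
      next letter of B.\<close>
    have "map_pmf (\<lambda>\<omega>. ((?us' \<omega>, ?vs \<omega>, ?y \<omega>), ?x \<omega>)) p
      = map_pmf (\<lambda>(u, (us, vs, x), y). ((us @ [u], vs, y), x)) (map_pmf (\<lambda>\<omega>. (rv_U (Suc k) \<omega>, (?us \<omega>, ?vs \<omega>, ?x \<omega>), ?y \<omega>)) p)"
      unfolding map_pmf_comp by (intro map_pmf_cong refl) (simp add: snoc)
    also have "\<dots> = do {
       (us, vs, x, y) \<leftarrow> map_pmf (\<lambda>\<omega>. (?us \<omega>, ?vs \<omega>, ?x \<omega>, ?y \<omega>)) p;
       u \<leftarrow> \<kappa> (Suc k) (us, vs, x);
       return_pmf ((us @ [u], vs, y), x)}"
      unfolding U by (simp add: map_pmf_def bind_assoc_pmf bind_return_pmf case_prod_unfold)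
    finally have step: "map_pmf (\<lambda>\<omega>. ((?us' \<omega>, ?vs \<omega>, ?y \<omega>), ?x \<omega>)) p = \<dots>" .
    have "map_pmf (\<lambda>\<omega>. (rv_U_upto (Suc k) \<omega>, rv_V_upto (Suc k) \<omega>, rv_X \<omega>, rv_Y \<omega>)) p
      = map_pmf (\<lambda>(v, (us, vs, y), x). (us, vs @ [v], x, y)) (map_pmf (\<lambda>\<omega>. (rv_V (Suc k) \<omega>, (?us' \<omega>, ?vs \<omega>, ?y \<omega>), ?x \<omega>)) p)"
      unfolding map_pmf_comp by (intro map_pmf_cong refl) (simp add: snoc)
    also have "\<dots> = do {
     (us, vs, x, y) \<leftarrow> map_pmf (\<lambda>\<omega>. (?us \<omega>, ?vs \<omega>, ?x \<omega>, ?y \<omega>)) p;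
     u \<leftarrow> \<kappa> (Suc k) (us, vs, x);
     v \<leftarrow> \<eta> (Suc k) (us @ [u], vs, y);
     return_pmf (us @ [u], vs @ [v], x, y)}"
      unfolding V step by (simp add: map_pmf_def bind_assoc_pmf bind_return_pmf case_prod_unfold)
    finally show ?case unfolding bar_law_Suc using Suc by simp
  qed
  from this[OF order_refl] have "bar_law P K \<kappa> \<eta> = map_pmf (\<lambda>\<omega>. (rv_U_upto K \<omega>, rv_V_upto K \<omega>, rv_X \<omega>, rv_Y \<omega>)) p" .
  also have "\<dots> = map_pmf (\<lambda>\<omega>. \<omega>) p"
    using lengths by (intro map_pmf_cong refl) (auto simp: rv_U_upto_def rv_V_upto_def rv_X_def rv_Y_def)
  finally show ?thesis by simp
qed

lemma bar_law_cong:
  assumes "\<And>k b. k \<in> {1..K} \<Longrightarrow> \<kappa> k b = \<kappa>' k b" "\<And>k b. k \<in> {1..K} \<Longrightarrow> \<eta> k b = \<eta>' k b"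
  shows "bar_law W K \<kappa> \<eta> = bar_law W K \<kappa>' \<eta>'"
proof -
  have "aux_pmf \<kappa> \<eta> x y k = aux_pmf \<kappa>' \<eta>' x y k" if "k \<le> K" for x y k
    using that by (induction k) (simp_all add: assms)
  then show ?thesis by (simp add: bar_law_def)
qed

lemma set_aux_pmf_subset:
  assumes "\<And>k b. k \<in> {1..K} \<Longrightarrow> set_pmf (\<kappa> k b) \<subseteq> U k" "\<And>k b. k \<in> {1..K} \<Longrightarrow> set_pmf (\<eta> k b) \<subseteq> V k"
    and "k \<le> K"
  shows "set_pmf (aux_pmf \<kappa> \<eta> x y k) \<subseteq> tuples U k \<times> tuples V k"
  using assms(3)
proof (induction k)
  case (Suc k)
  have snoc: "us @ [u] \<in> tuples A (Suc k)" if "us \<in> tuples A k" "u \<in> A (Suc k)" for us u A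
    using that by (auto simp: tuples_def nth_append less_Suc_eq)
  show ?case
    using Suc assms(1)[of "Suc k"] assms(2)[of "Suc k"]
    by (auto intro!: snoc) blast+
qed (auto simp: tuples_def)

lemma set_bar_law_subset:
  assumes "\<And>k b. k \<in> {1..K} \<Longrightarrow> set_pmf (\<kappa> k b) \<subseteq> U k" "\<And>k b. k \<in> {1..K} \<Longrightarrow> set_pmf (\<eta> k b) \<subseteq> V k"
  shows "set_pmf (bar_law W K \<kappa> \<eta>) \<subseteq> tuples U K \<times> tuples V K \<times> UNIV"
  using set_aux_pmf_subset[of K \<kappa> U \<eta> V K] assms by (auto simp: bar_law_def) blast+

section \<open>Information densities\<close>

lemma pmf_seq_pmf_map:
  "pmf (seq_pmf (map f ws)) (map g ws) = prod_list (map (\<lambda>w. pmf (f w) (g w)) ws)"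
  by (induction ws) (simp_all add: pmf_bind_Cons)

text \<open>Turns a bound on a sum of information densities into the product bound used by the
  acceptance tests.\<close>

lemma prod_list_le_powr_sum_log:
  fixes f g :: "'a \<Rightarrow> real"
  assumes "\<And>w. w \<in> set ws \<Longrightarrow> f w > 0 \<and> g w > 0" "(\<Sum>w\<leftarrow>ws. log 2 (f w / g w)) \<le> L"
  shows "prod_list (map f ws) \<le> 2 powr L * prod_list (map g ws)"
proof -
  have "prod_list (map f ws) = 2 powr (\<Sum>w\<leftarrow>ws. log 2 (f w / g w)) * prod_list (map g ws)"
    using assms(1)
  proof (induction ws)
    case (Cons w ws)
    then have "f w > 0" "g w > 0" by auto
    then have "f w = 2 powr (log 2 (f w / g w)) * g w" by simp
    then have "prod_list (map f (w # ws)) = (2 powr (log 2 (f w / g w)) * g w) *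
        (2 powr (\<Sum>w\<leftarrow>ws. log 2 (f w / g w)) * prod_list (map g ws))"
      using Cons by simp
    then show ?case by (simp add: powr_add)
  qed simp
  also have "\<dots> \<le> 2 powr L * prod_list (map g ws)"
  proof (rule mult_right_mono)
    have "0 \<le> g w" if "w \<in> set ws" for w using assms(1)[OF that] by simp
    then show "0 \<le> prod_list (map g ws)" by (auto intro!: prod_list_nonneg)
  qed (use assms(2) in simp)
  finally show ?thesis .
qed

text \<open>At acceptance rate \<open>1 / c\<close> about \<open>T\<close> of the \<open>M\<close>
  codewords are accepted on average. All are refused with probability at most
  \<open>exp (- T)\<close>, and rounding up costs at most \<open>1 / c \<le> 1\<close>.\<close>

lemma codebook_size:
  fixes c T :: real
  assumes "c \<ge> 1" "T > 0"
  defines "M \<equiv> nat \<lceil>c * T\<rceil>"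
  shows "1 - exp (- T) \<le> 1 - (1 - 1 / c) ^ M" "real M / c \<le> T + 1" "real M \<le> c * T + 1"
proof -
  have M: "c * T \<le> real M" "real M \<le> c * T + 1"
  proof -
    have "0 \<le> \<lceil>c * T\<rceil>" using assms by (simp add: zero_le_ceiling less_imp_le order_less_le_trans[of "-1" 0])
    then show "c * T \<le> real M" "real M \<le> c * T + 1" unfolding M_def by linarith+
  qed
  then show "real M \<le> c * T + 1" by simp
  have "real M / c \<le> (c * T + 1) / c" using M assms by (intro divide_right_mono) auto
  also have "\<dots> = T + 1 / c" using assms by (simp add: add_divide_distrib)
  also have "\<dots> \<le> T + 1" using assms by simp
  finally show "real M / c \<le> T + 1" .
  have "1 - 1 / c \<le> exp (- (1 / c))" using exp_ge_add_one_self[of "- (1 / c)"] by simp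
  then have "(1 - 1 / c) ^ M \<le> exp (- (1 / c)) ^ M"
    using assms by (intro power_mono) auto
  also have "\<dots> = exp (- (real M / c))" by (simp add: exp_of_nat_mult[symmetric])
  also have "\<dots> \<le> exp (- T)"
    using M assms by (simp add: pos_le_divide_eq mult.commute)
  finally show "1 - exp (- T) \<le> 1 - (1 - 1 / c) ^ M" by simp
qed

text \<open>The second \<gamma> comes from \<open>T = 2 powr (n * \<gamma>)\<close>. Rounding up and
  the extra failure index enlarge the size by a factor of at most 4, that is 2 bits.\<close>

lemma log_codebook_size:
  fixes I \<gamma> :: real
  assumes "0 \<le> I" "0 < \<gamma>"
  shows "log 2 (real (Suc (nat \<lceil>2 powr (real n * (I + \<gamma>)) * 2 powr (real n * \<gamma>)\<rceil>))) \<le> real n * (I + 2 * \<gamma>) + 2"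
proof -
  let ?z = "2 powr (real n * (I + 2 * \<gamma>))"
  have eq: "2 powr (real n * (I + \<gamma>)) * 2 powr (real n * \<gamma>) = ?z"
    by (simp add: powr_add[symmetric] algebra_simps)
  have "?z \<ge> 1" using assms by (intro ge_one_powr_ge_zero) auto
  then have "real (Suc (nat \<lceil>?z\<rceil>)) \<le> 4 * ?z" by linarith
  then have "real (Suc (nat \<lceil>?z\<rceil>)) \<le> 2 powr 2 * ?z" by simp
  then have "log 2 (real (Suc (nat \<lceil>?z\<rceil>))) \<le> log 2 (2 powr 2 * ?z)" by (intro log_mono) linarith+
  also have "\<dots> = real n * (I + 2 * \<gamma>) + 2" unfolding powr_add[symmetric] by (simp add: algebra_simps)
  finally show ?thesis unfolding eq .
qed

lemma block_kernel_outcomes: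
  "block_kernel \<kappa> (pastU j (state_of ws)) (map rv_X ws)
    = seq_pmf (map (\<lambda>\<omega>. \<kappa> (rv_U_upto (j - 1) \<omega>, rv_V_upto (j - 1) \<omega>, rv_X \<omega>)) ws)"
  "block_kernel \<eta> (pastV j (state_of ws)) (map rv_Y ws)
    = seq_pmf (map (\<lambda>\<omega>. \<eta> (rv_U_upto j \<omega>, rv_V_upto (j - 1) \<omega>, rv_Y \<omega>)) ws)"
proof -
  have "map2 (\<lambda>(us, vs) x. \<kappa> (us, vs, x)) (pastU j (state_of ws)) (map rv_X ws)
    = map (\<lambda>\<omega>. \<kappa> (rv_U_upto (j - 1) \<omega>, rv_V_upto (j - 1) \<omega>, rv_X \<omega>)) ws"
    by (induction ws) (auto simp: pastU_def state_of_def rv_U_upto_def rv_V_upto_def rv_X_def)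
  then show "block_kernel \<kappa> (pastU j (state_of ws)) (map rv_X ws)
    = seq_pmf (map (\<lambda>\<omega>. \<kappa> (rv_U_upto (j - 1) \<omega>, rv_V_upto (j - 1) \<omega>, rv_X \<omega>)) ws)"
    by (simp add: block_kernel_def)
  have "map2 (\<lambda>(us, vs) x. \<eta> (us, vs, x)) (pastV j (state_of ws)) (map rv_Y ws)
    = map (\<lambda>\<omega>. \<eta> (rv_U_upto j \<omega>, rv_V_upto (j - 1) \<omega>, rv_Y \<omega>)) ws"
    by (induction ws) (auto simp: pastV_def state_of_def rv_U_upto_def rv_V_upto_def rv_Y_def)
  then show "block_kernel \<eta> (pastV j (state_of ws)) (map rv_Y ws)
    = seq_pmf (map (\<lambda>\<omega>. \<eta> (rv_U_upto j \<omega>, rv_V_upto (j - 1) \<omega>, rv_Y \<omega>)) ws)"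
    by (simp add: block_kernel_def)
qed

lemma past_outcomes:
  "map f (pastU j (state_of ws)) = map (\<lambda>\<omega>. f (rv_U_upto (j - 1) \<omega>, rv_V_upto (j - 1) \<omega>)) ws"
  "map f (pastV j (state_of ws)) = map (\<lambda>\<omega>. f (rv_U_upto j \<omega>, rv_V_upto (j - 1) \<omega>)) ws"
  "lettersU j (state_of ws) = map (rv_U j) ws" "lettersV j (state_of ws) = map (rv_V j) ws"
  by (auto simp: pastU_def pastV_def lettersU_def lettersV_def state_of_def rv_U_def rv_V_def
      rv_U_upto_def rv_V_upto_def)

text \<open>The last test of B is evaluated in the state after its letter, so the complete history
  has to be put together again.\<close>

lemma extendV_pastV:
  assumes "K \<ge> 1" "\<And>us vs. (us, vs) \<in> set s \<Longrightarrow> length us = K \<and> length vs = K"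
  shows "extendV (pastV K s) (lettersV K s) = s"
  using assms(2)
proof (induction s)
  case (Cons h s)
  obtain us vs where h: "h = (us, vs)" by (cases h)
  then have len: "length us = K" "length vs = K" using Cons.prems by auto
  have "take (K - 1) vs @ [vs ! (K - 1)] = vs"
    using len(2) assms(1) take_Suc_conv_app_nth[of "K - 1" vs] by simp
  moreover have "extendV (pastV K s) (lettersV K s) = s" using Cons by auto
  ultimately show ?case using len unfolding h by (simp add: extendV_def pastV_def lettersV_def)
qed (simp add: extendV_def pastV_def lettersV_def)

lemma powr_times_power_tendsto_0:
  fixes a :: real
  assumes "a > 0"
  shows "(\<lambda>n. real (n + 1) ^ m * 2 powr (- (real n * a))) \<longlonglongrightarrow> 0"
  using assms by real_asymp

lemma rejection_factor_tendsto_1: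
  fixes a :: real
  assumes "a > 0"
  shows "(\<lambda>n. 1 - exp (- (2 powr (real n * a)))) \<longlonglongrightarrow> 1"
  using assms by real_asymp

text \<open>One admissible tuple with one version of its kernels; the rate constraint stays outside.
  Finite support is asked at every index, since the abstract scheme quantifies over all of
  them.\<close>

locale auxiliary_law =
  fixes P Q :: "('x::finite \<times> 'y::finite) pmf" and K :: nat
    and U V :: "nat \<Rightarrow> nat set" and p :: "('x, 'y) outcome pmf"
    and \<kappa> :: "nat \<Rightarrow> nat list \<times> nat list \<times> 'x \<Rightarrow> nat pmf"
    and \<eta> :: "nat \<Rightarrow> nat list \<times> nat list \<times> 'y \<Rightarrow> nat pmf"
  assumes K: "K \<ge> 1"
    and alphabets: "\<And>k. k \<in> {1..K} \<Longrightarrow> finite (U k)" "\<And>k. k \<in> {1..K} \<Longrightarrow> finite (V k)"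
    and p: "p \<in> laws_on K U V" "map_pmf (\<lambda>\<omega>. (rv_X \<omega>, rv_Y \<omega>)) p = P"
    and markov: "\<And>k. k \<in> {1..K} \<Longrightarrow> markov_chain p (rv_U k)
          (\<lambda>\<omega>. (rv_X \<omega>, rv_U_upto (k - 1) \<omega>, rv_V_upto (k - 1) \<omega>)) rv_Y"
      "\<And>k. k \<in> {1..K} \<Longrightarrow> markov_chain p (rv_V k)
          (\<lambda>\<omega>. (rv_Y \<omega>, rv_U_upto k \<omega>, rv_V_upto (k - 1) \<omega>)) rv_X"
    and law: "\<And>k. k \<in> {1..K} \<Longrightarrow>
        is_cond_law p (rv_U k) (\<lambda>\<omega>. (rv_U_upto (k - 1) \<omega>, rv_V_upto (k - 1) \<omega>, rv_X \<omega>)) (\<kappa> k)"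
      "\<And>k. k \<in> {1..K} \<Longrightarrow>
        is_cond_law p (rv_V k) (\<lambda>\<omega>. (rv_U_upto k \<omega>, rv_V_upto (k - 1) \<omega>, rv_Y \<omega>)) (\<eta> k)"
    and kernels_on: "\<And>k b. k \<in> {1..K} \<Longrightarrow> set_pmf (\<kappa> k b) \<subseteq> U k"
      "\<And>k b. k \<in> {1..K} \<Longrightarrow> set_pmf (\<eta> k b) \<subseteq> V k"
    and finite_kernels: "\<And>k b. finite (set_pmf (\<kappa> k b))" "\<And>k b. finite (set_pmf (\<eta> k b))"
begin

lemma finite_laws: "(t :: ('x, 'y) outcome pmf) \<in> laws_on K U V \<Longrightarrow> finite (set_pmf t)"
  by (rule finite_subset[of _ "tuples U K \<times> tuples V K \<times> UNIV"])
    (auto simp: laws_on_def intro!: finite_cartesian_product finite_tuples alphabets)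

lemma finite_p: "finite (set_pmf p)"
  using p(1) by (rule finite_laws)

lemma length_laws:
  "t \<in> laws_on K U V \<Longrightarrow> (us, vs, x, y) \<in> set_pmf t \<Longrightarrow> length us = K \<and> length vs = K"
  by (auto simp: laws_on_def tuples_def)

lemma bar_law_P: "bar_law P K \<kappa> \<eta> = p"
  by (rule bar_law_unique) (use p length_laws[OF p(1)] markov law in auto)

lemma bar_law_on: "bar_law W K \<kappa> \<eta> \<in> laws_on K U V"
  using set_bar_law_subset[of K \<kappa> U \<eta> V W] kernels_on by (auto simp: laws_on_def)

text \<open>The codeword law: the letter of A given the past without \<open>X\<close>. A past that
  is null under \<open>p\<close> may well occur under the alternative; \<open>return_pmf 0\<close>
  is a finitely supported placeholder there.\<close>

definition refA :: "nat \<Rightarrow> nat list \<times> nat list \<Rightarrow> nat pmf" where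
  "refA k h = (if set_pmf p \<inter> {\<omega>. (rv_U_upto (k - 1) \<omega>, rv_V_upto (k - 1) \<omega>) = h} = {} then return_pmf 0
    else map_pmf (rv_U k) (cond_pmf p {\<omega>. (rv_U_upto (k - 1) \<omega>, rv_V_upto (k - 1) \<omega>) = h}))"

definition refB :: "nat \<Rightarrow> nat list \<times> nat list \<Rightarrow> nat pmf" where
  "refB k h = (if set_pmf p \<inter> {\<omega>. (rv_U_upto k \<omega>, rv_V_upto (k - 1) \<omega>) = h} = {} then return_pmf 0
    else map_pmf (rv_V k) (cond_pmf p {\<omega>. (rv_U_upto k \<omega>, rv_V_upto (k - 1) \<omega>) = h}))"

lemma finite_ref: "finite (set_pmf (refA k h))" "finite (set_pmf (refB k h))"
  using finite_p by (auto simp: refA_def refB_def)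

definition probA :: "nat \<Rightarrow> ('x, 'y) outcome \<Rightarrow> real" where
  "probA k \<omega> = pmf (\<kappa> k (rv_U_upto (k - 1) \<omega>, rv_V_upto (k - 1) \<omega>, rv_X \<omega>)) (rv_U k \<omega>)"

definition probB :: "nat \<Rightarrow> ('x, 'y) outcome \<Rightarrow> real" where
  "probB k \<omega> = pmf (\<eta> k (rv_U_upto k \<omega>, rv_V_upto (k - 1) \<omega>, rv_Y \<omega>)) (rv_V k \<omega>)"

definition ref_probA :: "nat \<Rightarrow> ('x, 'y) outcome \<Rightarrow> real" where
  "ref_probA k \<omega> = pmf (refA k (rv_U_upto (k - 1) \<omega>, rv_V_upto (k - 1) \<omega>)) (rv_U k \<omega>)"

definition ref_probB :: "nat \<Rightarrow> ('x, 'y) outcome \<Rightarrow> real" where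
  "ref_probB k \<omega> = pmf (refB k (rv_U_upto k \<omega>, rv_V_upto (k - 1) \<omega>)) (rv_V k \<omega>)"

lemma ref_prob_eq:
  assumes "\<omega> \<in> set_pmf p"
  shows "ref_probA k \<omega> = pmf (map_pmf (rv_U k) (cond_pmf p
      {\<omega>'. (rv_U_upto (k - 1) \<omega>', rv_V_upto (k - 1) \<omega>') = (rv_U_upto (k - 1) \<omega>, rv_V_upto (k - 1) \<omega>)})) (rv_U k \<omega>)"
    "ref_probB k \<omega> = pmf (map_pmf (rv_V k) (cond_pmf p
      {\<omega>'. (rv_U_upto k \<omega>', rv_V_upto (k - 1) \<omega>') = (rv_U_upto k \<omega>, rv_V_upto (k - 1) \<omega>)})) (rv_V k \<omega>)"
  using assms unfolding ref_probA_def ref_probB_def refA_def refB_def by auto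

lemma prob_eq:
  assumes "\<omega> \<in> set_pmf p" "k \<in> {1..K}"
  shows "probA k \<omega> = pmf (map_pmf (rv_U k) (cond_pmf p {\<omega>'. (rv_X \<omega>', rv_U_upto (k - 1) \<omega>', rv_V_upto (k - 1) \<omega>') =
      (rv_X \<omega>, rv_U_upto (k - 1) \<omega>, rv_V_upto (k - 1) \<omega>)})) (rv_U k \<omega>)"
    "probB k \<omega> = pmf (map_pmf (rv_V k) (cond_pmf p {\<omega>'. (rv_Y \<omega>', rv_U_upto k \<omega>', rv_V_upto (k - 1) \<omega>') =
      (rv_Y \<omega>, rv_U_upto k \<omega>, rv_V_upto (k - 1) \<omega>)})) (rv_V k \<omega>)"
proof -
  have pos: "measure_pmf.prob p {\<omega>'. F \<omega>' = F \<omega>} > 0" for F :: "('x, 'y) outcome \<Rightarrow> 'd"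
    using pmf_map_positive[OF assms(1), of F] by (simp add: pmf_map_prob)
  have evA: "{\<omega>'. (rv_U_upto (k - 1) \<omega>', rv_V_upto (k - 1) \<omega>', rv_X \<omega>') = (rv_U_upto (k - 1) \<omega>, rv_V_upto (k - 1) \<omega>, rv_X \<omega>)}
    = {\<omega>'. (rv_X \<omega>', rv_U_upto (k - 1) \<omega>', rv_V_upto (k - 1) \<omega>') = (rv_X \<omega>, rv_U_upto (k - 1) \<omega>, rv_V_upto (k - 1) \<omega>)}"
    by auto
  show "probA k \<omega> = pmf (map_pmf (rv_U k) (cond_pmf p {\<omega>'. (rv_X \<omega>', rv_U_upto (k - 1) \<omega>', rv_V_upto (k - 1) \<omega>') =
      (rv_X \<omega>, rv_U_upto (k - 1) \<omega>, rv_V_upto (k - 1) \<omega>)})) (rv_U k \<omega>)"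
    unfolding probA_def
    by (rule arg_cong[where f = "\<lambda>t. pmf t _"],
        rule law(1)[OF assms(2), unfolded is_cond_law_def, rule_format, OF pos, unfolded evA])
  have evB: "{\<omega>'. (rv_U_upto k \<omega>', rv_V_upto (k - 1) \<omega>', rv_Y \<omega>') = (rv_U_upto k \<omega>, rv_V_upto (k - 1) \<omega>, rv_Y \<omega>)}
    = {\<omega>'. (rv_Y \<omega>', rv_U_upto k \<omega>', rv_V_upto (k - 1) \<omega>') = (rv_Y \<omega>, rv_U_upto k \<omega>, rv_V_upto (k - 1) \<omega>)}"
    by auto
  show "probB k \<omega> = pmf (map_pmf (rv_V k) (cond_pmf p {\<omega>'. (rv_Y \<omega>', rv_U_upto k \<omega>', rv_V_upto (k - 1) \<omega>') =
      (rv_Y \<omega>, rv_U_upto k \<omega>, rv_V_upto (k - 1) \<omega>)})) (rv_V k \<omega>)"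
    unfolding probB_def
    by (rule arg_cong[where f = "\<lambda>t. pmf t _"],
        rule law(2)[OF assms(2), unfolded is_cond_law_def, rule_format, OF pos, unfolded evB])
qed

lemma prob_positive:
  assumes "\<omega> \<in> set_pmf p" "k \<in> {1..K}"
  shows "probA k \<omega> > 0" "probB k \<omega> > 0" "ref_probA k \<omega> > 0" "ref_probB k \<omega> > 0"
proof -
  have *: "pmf (map_pmf F (cond_pmf p {\<omega>'. G \<omega>' = G \<omega>})) (F \<omega>) > 0"
    for F :: "('x, 'y) outcome \<Rightarrow> 'd" and G :: "('x, 'y) outcome \<Rightarrow> 'e"
  proof -
    have "set_pmf p \<inter> {\<omega>'. G \<omega>' = G \<omega>} \<noteq> {}" using assms(1) by auto
    then show ?thesis using assms(1) by (auto simp: pmf_positive_iff)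
  qed
  show "probA k \<omega> > 0" "probB k \<omega> > 0" unfolding prob_eq[OF assms] by (rule *)+
  show "ref_probA k \<omega> > 0" "ref_probB k \<omega> > 0" unfolding ref_prob_eq[OF assms(1)] by (rule *)+
qed

text \<open>The value 0 outside the rounds keeps the likelihood-ratio bounds at least 1 at every
  index.\<close>

definition infoA :: "nat \<Rightarrow> real" where
  "infoA k = (if k \<in> {1..K} then cond_mutual_info p rv_X (rv_U k)
     (\<lambda>\<omega>. (rv_U_upto (k - 1) \<omega>, rv_V_upto (k - 1) \<omega>)) else 0)"

definition infoB :: "nat \<Rightarrow> real" where
  "infoB k = (if k \<in> {1..K} then cond_mutual_info p rv_Y (rv_V k)
     (\<lambda>\<omega>. (rv_U_upto k \<omega>, rv_V_upto (k - 1) \<omega>)) else 0)"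

lemma info_nonneg: "0 \<le> infoA k" "0 \<le> infoB k"
  by (simp_all add: infoA_def infoB_def cond_mutual_info_nonneg finite_p)

lemma sum_info: "(\<Sum>k=1..K. infoA k + infoB k) = exchange_rate K p"
  unfolding exchange_rate_def by (intro sum.cong refl) (simp add: infoA_def infoB_def)

text \<open>The mean that the weak law needs: the density summed over a block concentrates near
  \<open>n\<close> times the conditional mutual information.\<close>

lemma expectation_density:
  assumes "k \<in> {1..K}"
  shows "measure_pmf.expectation p (\<lambda>\<omega>. log 2 (probA k \<omega> / ref_probA k \<omega>)) = infoA k"
    "measure_pmf.expectation p (\<lambda>\<omega>. log 2 (probB k \<omega> / ref_probB k \<omega>)) = infoB k"
proof -
  show "measure_pmf.expectation p (\<lambda>\<omega>. log 2 (probA k \<omega> / ref_probA k \<omega>)) = infoA k"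
    unfolding infoA_def cond_mutual_info_pmf[OF finite_p] using assms
    by (simp del: prod.inject) (intro integral_cong_AE AE_pmfI; simp del: prod.inject add: prob_eq ref_prob_eq)
  show "measure_pmf.expectation p (\<lambda>\<omega>. log 2 (probB k \<omega> / ref_probB k \<omega>)) = infoB k"
    unfolding infoB_def cond_mutual_info_pmf[OF finite_p] using assms
    by (simp del: prod.inject) (intro integral_cong_AE AE_pmfI; simp del: prod.inject add: prob_eq ref_prob_eq)
qed

end

section \<open>The codes of blocklength n and their error probabilities\<close>

context auxiliary_law
begin

definition margX :: "('x, 'y) outcome \<Rightarrow> nat list \<times> nat list \<times> 'x" where
  "margX \<omega> = (rv_U_upto K \<omega>, rv_V_upto K \<omega>, rv_X \<omega>)"

definition margY :: "('x, 'y) outcome \<Rightarrow> nat list \<times> nat list \<times> 'y" where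
  "margY \<omega> = (rv_U_upto K \<omega>, rv_V_upto K \<omega>, rv_Y \<omega>)"

definition accX :: "real \<Rightarrow> state \<Rightarrow> 'x list \<Rightarrow> bool" where
  "accX \<mu> s x = typical id (map_pmf margX p) \<mu> (map2 (\<lambda>(us, vs) x. (take K us, take K vs, x)) s x)"

definition accY :: "real \<Rightarrow> state \<Rightarrow> 'y list \<Rightarrow> bool" where
  "accY \<mu> s y = typical id (map_pmf margY p) \<mu> (map2 (\<lambda>(us, vs) y. (take K us, take K vs, y)) s y)"

lemma acc_outcomes:
  "accX \<mu> (state_of ws) (map rv_X ws) = typical margX (map_pmf margX p) \<mu> ws"
  "accY \<mu> (state_of ws) (map rv_Y ws) = typical margY (map_pmf margY p) \<mu> ws"
proof -
  have "map2 (\<lambda>(us, vs) x. (take K us, take K vs, x)) (state_of ws) (map rv_X ws) = map margX ws"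
    by (induction ws) (auto simp: state_of_def margX_def rv_U_upto_def rv_V_upto_def rv_X_def)
  then show "accX \<mu> (state_of ws) (map rv_X ws) = typical margX (map_pmf margX p) \<mu> ws"
    by (simp add: accX_def typical_map)
  have "map2 (\<lambda>(us, vs) y. (take K us, take K vs, y)) (state_of ws) (map rv_Y ws) = map margY ws"
    by (induction ws) (auto simp: state_of_def margY_def rv_U_upto_def rv_V_upto_def rv_Y_def)
  then show "accY \<mu> (state_of ws) (map rv_Y ws) = typical margY (map_pmf margY p) \<mu> ws"
    by (simp add: accY_def typical_map)
qed

lemma state_of_lengths:
  assumes "ws \<in> set_pmf (replicate_pmf n (bar_law W K \<kappa> \<eta>))" "(us, vs) \<in> set (state_of ws)"
  shows "length us = K \<and> length vs = K"
proof -
  obtain x y where "(us, vs, x, y) \<in> set_pmf (bar_law W K \<kappa> \<eta>)"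
    using assms by (auto simp: state_of_def set_replicate_pmf)
  then show ?thesis using length_laws[OF bar_law_on] by blast
qed

definition devA :: "real \<Rightarrow> nat \<Rightarrow> nat \<Rightarrow> ('x, 'y) outcome list set" where
  "devA \<gamma> n k = {ws. \<bar>(\<Sum>\<omega>\<leftarrow>ws. log 2 (probA k \<omega> / ref_probA k \<omega>)) -
     real n * measure_pmf.expectation p (\<lambda>\<omega>. log 2 (probA k \<omega> / ref_probA k \<omega>))\<bar> > real n * \<gamma>}"

definition devB :: "real \<Rightarrow> nat \<Rightarrow> nat \<Rightarrow> ('x, 'y) outcome list set" where
  "devB \<gamma> n k = {ws. \<bar>(\<Sum>\<omega>\<leftarrow>ws. log 2 (probB k \<omega> / ref_probB k \<omega>)) -
     real n * measure_pmf.expectation p (\<lambda>\<omega>. log 2 (probB k \<omega> / ref_probB k \<omega>))\<bar> > real n * \<gamma>}"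

text \<open>The union bound over all events that can make the ideal protocol fail a test under
  \<open>P\<close>.\<close>

definition bad_prob :: "real \<Rightarrow> real \<Rightarrow> nat \<Rightarrow> real" where
  "bad_prob \<gamma> \<mu> n =
     (\<Sum>k=1..K. measure_pmf.prob (replicate_pmf n p) (devA \<gamma> n k) + measure_pmf.prob (replicate_pmf n p) (devB \<gamma> n k)) +
     measure_pmf.prob (replicate_pmf n p) {ws. \<not> typical margX (map_pmf margX p) \<mu> ws} +
     measure_pmf.prob (replicate_pmf n p) {ws. \<not> typical margY (map_pmf margY p) \<mu> ws}"

lemma bad_prob_tendsto_0:
  assumes "\<gamma> > 0" "\<mu> > 0"
  shows "bad_prob \<gamma> \<mu> \<longlonglongrightarrow> 0"
proof -
  have "bad_prob \<gamma> \<mu> \<longlonglongrightarrow> (\<Sum>k=1..K. 0 + 0) + 0 + 0"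
    unfolding bad_prob_def devA_def devB_def
    by (intro tendsto_add tendsto_sum weak_law not_typical_tendsto_0 finite_p assms)
  then show ?thesis by simp
qed

definition test_prob :: "real \<Rightarrow> nat \<Rightarrow> real" where
  "test_prob \<mu> n = measure_pmf.prob (replicate_pmf n (bar_law Q K \<kappa> \<eta>))
     {ws. typical margX (map_pmf margX p) \<mu> ws \<and> typical margY (map_pmf margY p) \<mu> ws}"

text \<open>The two messages of a round each exceed \<open>n\<close> times their information by at
  most \<open>2 * n * \<gamma> + 2\<close> bits, whence \<open>4 * \<gamma>\<close> and
  \<open>4\<close>. Under \<open>P\<close> the law with bars is \<open>p\<close>, and some test
  fails with probability at most \<open>bad_prob\<close>; under \<open>Q\<close> passing all tests
  implies typicality of both marginals.\<close>

lemma exists_code_block: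
  fixes n :: nat and \<gamma> \<mu> w :: real
  assumes \<gamma>: "\<gamma> > 0" and w: "w \<ge> 0"
  shows "\<exists>C :: ('x, 'y) code. is_code K n C \<and>
    (\<forall>k. log 2 (real (size_A C k * size_B C k)) \<le> real n * (infoA k + infoB k + 4 * \<gamma>) + 4) \<and>
    (1 - exp (- (2 powr (real n * \<gamma>)))) ^ (2 * K) * (1 - bad_prob \<gamma> \<mu> n) -
      w * (2 powr (real n * \<gamma>) + 1) ^ (2 * K) * test_prob \<mu> n
    \<le> 1 - prob_decide K n C P 1 - w * prob_decide K n C Q 0"
proof -
  define T where "T = 2 powr (real n * \<gamma>)"
  define c where "c k = 2 powr (real n * (infoA k + \<gamma>))" for k
  define d where "d k = 2 powr (real n * (infoB k + \<gamma>))" for k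
  define M where "M k = nat \<lceil>c k * T\<rceil>" for k
  define N where "N k = nat \<lceil>d k * T\<rceil>" for k
  have T: "T > 0" by (simp add: T_def)
  have cd: "c k \<ge> 1" "d k \<ge> 1" for k
    using info_nonneg[of k] \<gamma> by (auto simp: c_def d_def intro!: ge_one_powr_ge_zero)
  interpret B: block_scheme \<kappa> \<eta> refA refB c d M N "1 - exp (- T)" "T + 1" K n "accX \<mu>" "accY \<mu>"
    by unfold_locales
      (use finite_kernels finite_ref cd K T codebook_size[OF cd(1) T] codebook_size[OF cd(2) T] in \<open>auto simp: M_def N_def\<close>)
  obtain C :: "('x, 'y) code" where C: "is_code K n C" "size_A C = (\<lambda>k. Suc (M k))" "size_B C = (\<lambda>k. Suc (N k))"
    and gain: "(1 - exp (- T)) ^ (2 * K) * measure_pmf.prob (replicate_pmf n (bar_law P K \<kappa> \<eta>)) B.good_outcomes -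
    w * (T + 1) ^ (2 * K) * measure_pmf.prob (replicate_pmf n (bar_law Q K \<kappa> \<eta>)) B.good_outcomes
    \<le> 1 - prob_decide K n C P 1 - w * prob_decide K n C Q 0"
    using B.exists_code[OF w, of P Q] by iprover
  have rate: "log 2 (real (size_A C k * size_B C k)) \<le> real n * (infoA k + infoB k + 4 * \<gamma>) + 4" for k
  proof -
    have "log 2 (real (size_A C k * size_B C k)) = log 2 (real (Suc (M k))) + log 2 (real (Suc (N k)))"
      unfolding C of_nat_mult by (rule log_mult_pos) auto
    also have "\<dots> \<le> (real n * (infoA k + 2 * \<gamma>) + 2) + (real n * (infoB k + 2 * \<gamma>) + 2)"
      unfolding M_def N_def c_def d_def T_def
      by (intro add_mono log_codebook_size info_nonneg \<gamma>)
    finally show ?thesis by (simp add: algebra_simps)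
  qed
  have lettersK: "extendV (pastV K (state_of ws)) (lettersV K (state_of ws)) = state_of ws"
    if "ws \<in> set_pmf (replicate_pmf n (bar_law W K \<kappa> \<eta>))" for ws W
    using K state_of_lengths[OF that] by (rule extendV_pastV)
  have "measure_pmf.prob (replicate_pmf n (bar_law Q K \<kappa> \<eta>)) B.good_outcomes
    = measure_pmf.prob (replicate_pmf n (bar_law Q K \<kappa> \<eta>)) (B.good_outcomes \<inter> set_pmf (replicate_pmf n (bar_law Q K \<kappa> \<eta>)))"
    by (simp add: measure_Int_set_pmf)
  also have "\<dots> \<le> test_prob \<mu> n"
    unfolding test_prob_def
  proof (intro measure_pmf.finite_measure_mono subsetI)
    fix ws assume ws: "ws \<in> B.good_outcomes \<inter> set_pmf (replicate_pmf n (bar_law Q K \<kappa> \<eta>))"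
    \<comment> \<open>The test of B in round \<open>K\<close> contains \<open>accY\<close>, the only
      place where typicality with \<open>y\<close> is recorded.\<close>
    then have "B.goodB K (pastV K (state_of ws)) (lettersV K (state_of ws)) (map rv_Y ws)"
      using K by (auto simp: B.good_outcomes_def B.good_upto_def)
    then have "accY \<mu> (state_of ws) (map rv_Y ws)"
      using lettersK[of ws Q] ws by (simp add: B.goodB_def)
    moreover have "accX \<mu> (state_of ws) (map rv_X ws)"
      using ws by (simp add: B.good_outcomes_def)
    ultimately show "ws \<in> {ws. typical margX (map_pmf margX p) \<mu> ws \<and> typical margY (map_pmf margY p) \<mu> ws}"
      by (simp add: acc_outcomes)
  qed simp
  finally have Q_le: "measure_pmf.prob (replicate_pmf n (bar_law Q K \<kappa> \<eta>)) B.good_outcomes \<le> test_prob \<mu> n" .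
  let ?TX = "{ws. \<not> typical margX (map_pmf margX p) \<mu> ws}" and ?TY = "{ws. \<not> typical margY (map_pmf margY p) \<mu> ws}"
  let ?D = "\<Union>k\<in>{1..K}. devA \<gamma> n k \<union> devB \<gamma> n k"
  have good: "ws \<in> B.good_outcomes"
    if ws: "ws \<in> set_pmf (replicate_pmf n p)" and notD: "ws \<notin> ?D" and notT: "ws \<notin> ?TX" "ws \<notin> ?TY" for ws
  proof -
    have sub: "set ws \<subseteq> set_pmf p" using ws by (auto simp: set_replicate_pmf)
    have "B.goodA k (pastU k (state_of ws)) (lettersU k (state_of ws)) (map rv_X ws) \<and>
        B.goodB k (pastV k (state_of ws)) (lettersV k (state_of ws)) (map rv_Y ws)" if k: "k \<in> {1..K}" for k
    proof
      have pos: "probA k \<omega> > 0 \<and> ref_probA k \<omega> > 0" "probB k \<omega> > 0 \<and> ref_probB k \<omega> > 0" if "\<omega> \<in> set ws" for \<omega>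
        using prob_positive[OF _ k, of \<omega>] that sub by auto
      have "ws \<notin> devA \<gamma> n k" "ws \<notin> devB \<gamma> n k" using notD k by auto
      then have A: "(\<Sum>\<omega>\<leftarrow>ws. log 2 (probA k \<omega> / ref_probA k \<omega>)) \<le> real n * (infoA k + \<gamma>)"
        and B: "(\<Sum>\<omega>\<leftarrow>ws. log 2 (probB k \<omega> / ref_probB k \<omega>)) \<le> real n * (infoB k + \<gamma>)"
        unfolding devA_def devB_def expectation_density[OF k] by (auto simp: algebra_simps)
      show "B.goodA k (pastU k (state_of ws)) (lettersU k (state_of ws)) (map rv_X ws)"
        using prod_list_le_powr_sum_log[OF pos(1) A]
        unfolding B.goodA_def block_kernel_outcomes past_outcomes pmf_seq_pmf_map c_def
          probA_def[symmetric] ref_probA_def[symmetric] .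
      have "k = K \<longrightarrow> accY \<mu> (extendV (pastV k (state_of ws)) (lettersV k (state_of ws))) (map rv_Y ws)"
        using lettersK[of ws P] ws notT unfolding bar_law_P by (simp add: acc_outcomes)
      then show "B.goodB k (pastV k (state_of ws)) (lettersV k (state_of ws)) (map rv_Y ws)"
        using prod_list_le_powr_sum_log[OF pos(2) B]
        unfolding B.goodB_def block_kernel_outcomes past_outcomes pmf_seq_pmf_map d_def
          probB_def[symmetric] ref_probB_def[symmetric] by simp
    qed
    then show ?thesis
      using notT unfolding B.good_outcomes_def B.good_upto_def by (simp add: acc_outcomes)
  qed
  let ?pr = "measure_pmf.prob (replicate_pmf n p)"
  have "1 - ?pr B.good_outcomes = ?pr (space (replicate_pmf n p) - B.good_outcomes)"
    by (rule measure_pmf.prob_compl[symmetric]) simp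
  also have "\<dots> = ?pr ((space (replicate_pmf n p) - B.good_outcomes) \<inter> set_pmf (replicate_pmf n p))"
    by (simp add: measure_Int_set_pmf)
  also have "\<dots> \<le> ?pr (?D \<union> ?TX \<union> ?TY)"
    using good by (intro measure_pmf.finite_measure_mono) auto
  also have "\<dots> \<le> ?pr ?D + ?pr ?TX + ?pr ?TY"
    by (intro order_trans[OF measure_Un_le] add_mono order_refl) auto
  also have "?pr ?D \<le> (\<Sum>k=1..K. ?pr (devA \<gamma> n k \<union> devB \<gamma> n k))"
    by (intro measure_pmf.finite_measure_subadditive_finite) auto
  also have "\<dots> \<le> (\<Sum>k=1..K. ?pr (devA \<gamma> n k) + ?pr (devB \<gamma> n k))"
    by (intro sum_mono measure_Un_le) auto
  finally have P_ge: "1 - bad_prob \<gamma> \<mu> n \<le> ?pr B.good_outcomes"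
    unfolding bad_prob_def by simp
  have "(1 - exp (- T)) ^ (2 * K) * (1 - bad_prob \<gamma> \<mu> n) - w * (T + 1) ^ (2 * K) * test_prob \<mu> n
    \<le> (1 - exp (- T)) ^ (2 * K) * ?pr B.good_outcomes -
      w * (T + 1) ^ (2 * K) * measure_pmf.prob (replicate_pmf n (bar_law Q K \<kappa> \<eta>)) B.good_outcomes"
    using P_ge Q_le T w by (intro diff_mono mult_left_mono) auto
  also note gain[unfolded bar_law_P]
  finally show ?thesis
    using C(1) rate unfolding T_def by (intro exI[of _ C] conjI allI)
qed

text \<open>The sum \<alpha> + \<open>w n\<close> * \<beta> is at most \<open>r n\<close>, which
  tends to 0: Sanov's factor \<open>2 powr (- n * E)\<close> beats \<open>w n\<close> by
  \<open>2 powr (- n * \<delta>)\<close>. Exponentially, the factors \<tau> use up only a quarter of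
  this margin, and the rest absorbs the number of types.\<close>

lemma feasible_below_divergence:
  assumes rate: "exchange_rate K p \<le> R" and \<epsilon>: "\<epsilon> > 0"
    and E: "\<And>t. t \<in> matching_laws K U V p \<Longrightarrow> set_pmf t \<subseteq> set_pmf (bar_law Q K \<kappa> \<eta>) \<Longrightarrow>
      E < rel_ent t (bar_law Q K \<kappa> \<eta>)"
  shows "feasible_exponent P Q K R \<epsilon> E"
  unfolding feasible_exponent_def
proof (intro allI impI)
  fix \<delta> :: real assume \<delta>: "\<delta> > 0"
  let ?q = "bar_law Q K \<kappa> \<eta>"
  have fin_q: "finite (set_pmf ?q)" using bar_law_on by (rule finite_laws)
  have "\<exists>\<mu>>0. \<forall>t. set_pmf t \<subseteq> set_pmf ?q \<longrightarrow> (\<forall>z. \<bar>pmf (map_pmf margX t) z - pmf (map_pmf margX p) z\<bar> \<le> \<mu>) \<longrightarrow>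
    (\<forall>z. \<bar>pmf (map_pmf margY t) z - pmf (map_pmf margY p) z\<bar> \<le> \<mu>) \<longrightarrow> E \<le> rel_ent t ?q"
  proof (rule rel_ent_approximate_marginals[OF fin_q])
    fix t assume t: "set_pmf t \<subseteq> set_pmf ?q" "map_pmf margX t = map_pmf margX p" "map_pmf margY t = map_pmf margY p"
    then have "t \<in> laws_on K U V" using bar_law_on[of Q] by (auto simp: laws_on_def)
    then have "t \<in> matching_laws K U V p"
      using t(2,3) by (auto simp: matching_laws_def margX_def[abs_def] margY_def[abs_def])
    then show "E < rel_ent t ?q" using t(1) by (rule E)
  qed
  then obtain \<mu> where \<mu>: "\<mu> > 0" and sanov: "\<And>t. set_pmf t \<subseteq> set_pmf ?q \<Longrightarrow>
    (\<forall>z. \<bar>pmf (map_pmf margX t) z - pmf (map_pmf margX p) z\<bar> \<le> \<mu>) \<Longrightarrow>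
    (\<forall>z. \<bar>pmf (map_pmf margY t) z - pmf (map_pmf margY p) z\<bar> \<le> \<mu>) \<Longrightarrow> E \<le> rel_ent t ?q"
    by iprover
  \<comment> \<open>Chosen for two budgets: \<open>\<tau> n ^ (2 * K)\<close> costs
    \<open>2 powr (n * \<delta> / 4)\<close> up to a constant, and the rate overhead
    \<open>4 * K * \<gamma>\<close> is \<open>\<delta> / 2\<close>.\<close>
  define \<gamma> where "\<gamma> = \<delta> / (8 * real K)"
  have \<gamma>: "\<gamma> > 0" and K\<gamma>: "real K * \<gamma> = \<delta> / 8" using \<delta> K by (auto simp: \<gamma>_def)
  define w where "w n = 2 powr (real n * (E - \<delta>))" for n :: nat
  define \<theta> where "\<theta> n = 1 - exp (- (2 powr (real n * \<gamma>)))" for n :: nat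
  define \<tau> where "\<tau> n = 2 powr (real n * \<gamma>) + 1" for n :: nat
  define r where "r n = 1 - \<theta> n ^ (2 * K) * (1 - bad_prob \<gamma> \<mu> n) + w n * \<tau> n ^ (2 * K) * test_prob \<mu> n" for n
  let ?m = "card (set_pmf ?q)"
  have test_le: "w n * \<tau> n ^ (2 * K) * test_prob \<mu> n
      \<le> 2 ^ (2 * K) * (real (n + 1) ^ ?m * 2 powr (- (real n * (3 / 4 * \<delta>))))" if n: "n > 0" for n
  proof -
    have "2 powr (real n * \<gamma>) \<ge> 1" using \<gamma> by (intro ge_one_powr_ge_zero) auto
    then have "\<tau> n \<le> 2 * 2 powr (real n * \<gamma>)" by (simp add: \<tau>_def)
    then have "\<tau> n ^ (2 * K) \<le> (2 * 2 powr (real n * \<gamma>)) ^ (2 * K)"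
      by (intro power_mono) (auto simp: \<tau>_def intro: add_nonneg_nonneg)
    also have "\<dots> = 2 ^ (2 * K) * 2 powr (real n * (2 * (real K * \<gamma>)))"
      by (simp add: power_mult_distrib powr_power algebra_simps)
    also have "real n * (2 * (real K * \<gamma>)) = real n * (\<delta> / 4)" unfolding K\<gamma> by simp
    finally have \<tau>: "\<tau> n ^ (2 * K) \<le> 2 ^ (2 * K) * 2 powr (real n * (\<delta> / 4))" .
    have test: "test_prob \<mu> n \<le> real (n + 1) ^ ?m * 2 powr (- real n * E)"
      unfolding test_prob_def by (rule prob_typical_le[OF fin_q n sanov])
    have "w n * \<tau> n ^ (2 * K) * test_prob \<mu> n
      \<le> w n * (2 ^ (2 * K) * 2 powr (real n * (\<delta> / 4))) * (real (n + 1) ^ ?m * 2 powr (- real n * E))"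
      using \<tau> test by (intro mult_mono mult_left_mono) (auto simp: w_def test_prob_def)
    also have "\<dots> = 2 ^ (2 * K) * (real (n + 1) ^ ?m * (2 powr (real n * (E - \<delta>)) * 2 powr (real n * (\<delta> / 4)) * 2 powr (- real n * E)))"
      by (simp add: w_def)
    also have "2 powr (real n * (E - \<delta>)) * 2 powr (real n * (\<delta> / 4)) * 2 powr (- real n * E)
      = 2 powr (- (real n * (3 / 4 * \<delta>)))"
      unfolding powr_add[symmetric] by (simp add: algebra_simps)
    finally show ?thesis .
  qed
  have "(\<lambda>n. w n * \<tau> n ^ (2 * K) * test_prob \<mu> n) \<longlonglongrightarrow> 0"
  proof (rule real_tendsto_sandwich[where f = "\<lambda>_. 0"])
    show "\<forall>\<^sub>F n in sequentially. w n * \<tau> n ^ (2 * K) * test_prob \<mu> n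
      \<le> 2 ^ (2 * K) * (real (n + 1) ^ ?m * 2 powr (- (real n * (3 / 4 * \<delta>))))"
      using eventually_gt_at_top[of 0] by eventually_elim (rule test_le)
    show "(\<lambda>n. 2 ^ (2 * K) * (real (n + 1) ^ ?m * 2 powr (- (real n * (3 / 4 * \<delta>))))) \<longlonglongrightarrow> 0"
      by (rule tendsto_mult_right_zero, rule powr_times_power_tendsto_0) (use \<delta> in auto)
    show "\<forall>\<^sub>F n in sequentially. 0 \<le> w n * \<tau> n ^ (2 * K) * test_prob \<mu> n"
      by (intro always_eventually allI mult_nonneg_nonneg zero_le_power)
        (auto simp: w_def \<tau>_def test_prob_def intro: add_nonneg_nonneg)
  qed simp
  moreover have "\<theta> \<longlonglongrightarrow> 1" unfolding \<theta>_def using \<gamma> by (rule rejection_factor_tendsto_1)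
  ultimately have "r \<longlonglongrightarrow> 1 - 1 ^ (2 * K) * (1 - 0) + 0"
    unfolding r_def by (intro tendsto_intros bad_prob_tendsto_0 \<gamma> \<mu>)
  then have "r \<longlonglongrightarrow> 0" by simp
  \<comment> \<open>The bound \<epsilon> is for \<alpha>, the bound 1 for \<open>w n\<close> *
    \<beta>.\<close>
  then have "\<forall>\<^sub>F n in sequentially. r n < min \<epsilon> 1"
    using \<epsilon> by (intro order_tendstoD) auto
  \<comment> \<open>From here on the \<open>4 * K\<close> bits for rounding and failure indices take
    at most \<open>\<delta> / 2\<close> per source letter.\<close>
  moreover have "\<forall>\<^sub>F n in sequentially. 8 * real K / \<delta> \<le> real n"
    by real_asymp
  moreover have "\<forall>\<^sub>F n :: nat in sequentially. n > 0" by (rule eventually_gt_at_top)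
  ultimately show "\<forall>\<^sub>F n in sequentially. \<exists>c :: ('x, 'y) code. is_code K n c \<and>
        neg_log_rate n (prob_decide K n c Q 0) \<ge> ereal (E - \<delta>) \<and>
        code_rate K n c \<le> R + \<delta> \<and> prob_decide K n c P 1 \<le> \<epsilon>"
  proof eventually_elim
    case (elim n)
    have w: "w n > 0" by (simp add: w_def)
    obtain C :: "('x, 'y) code" where C: "is_code K n C"
      and size: "\<And>k. log 2 (real (size_A C k * size_B C k)) \<le> real n * (infoA k + infoB k + 4 * \<gamma>) + 4"
      and gain: "\<theta> n ^ (2 * K) * (1 - bad_prob \<gamma> \<mu> n) - w n * \<tau> n ^ (2 * K) * test_prob \<mu> n
        \<le> 1 - prob_decide K n C P 1 - w n * prob_decide K n C Q 0"
      using exists_code_block[OF \<gamma> less_imp_le[OF w], of n \<mu>] unfolding \<theta>_def \<tau>_def by iprover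
    have nonneg: "prob_decide K n C P 1 \<ge> 0" "prob_decide K n C Q 0 \<ge> 0" by (simp_all add: prob_decide_def)
    have sum: "prob_decide K n C P 1 + w n * prob_decide K n C Q 0 \<le> r n"
      using gain unfolding r_def by linarith
    have "w n * prob_decide K n C Q 0 \<ge> 0" using w nonneg by simp
    then have \<alpha>: "prob_decide K n C P 1 \<le> \<epsilon>" using sum elim(1) by linarith
    have "neg_log_rate n (prob_decide K n C Q 0) \<ge> ereal (E - \<delta>)"
    proof (cases "prob_decide K n C Q 0 = 0")
      case False
      then have pos: "prob_decide K n C Q 0 > 0" using nonneg by simp
      have "w n * prob_decide K n C Q 0 \<le> 1" using sum nonneg elim(1) by linarith
      then have "log 2 (w n * prob_decide K n C Q 0) \<le> 0" using w pos by simp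
      then have "real n * (E - \<delta>) + log 2 (prob_decide K n C Q 0) \<le> 0"
        using w pos by (simp add: log_mult) (simp add: w_def)
      then have "E - \<delta> \<le> - (1 / real n) * log 2 (prob_decide K n C Q 0)"
        using elim(3) by (simp add: field_simps)
      then show ?thesis using False by (simp add: neg_log_rate_def)
    qed (simp add: neg_log_rate_def)
    moreover have "code_rate K n C \<le> R + \<delta>"
    proof -
      have "(\<Sum>k=1..K. log 2 (real (size_A C k * size_B C k)))
        \<le> (\<Sum>k=1..K. real n * (infoA k + infoB k) + (4 * (real n * \<gamma>) + 4))"
        using size by (intro sum_mono) (simp add: algebra_simps)
      also have "\<dots> = real n * exchange_rate K p + real n * (4 * (real K * \<gamma>)) + 4 * real K"
        unfolding sum_info[symmetric] by (simp add: sum.distrib sum_distrib_left algebra_simps)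
      finally have "code_rate K n C \<le> (real n * exchange_rate K p + real n * (4 * (real K * \<gamma>)) + 4 * real K) / real n"
        unfolding code_rate_def using elim(3) by (simp add: divide_right_mono)
      also have "\<dots> = exchange_rate K p + \<delta> / 2 + 4 * real K / real n"
        using elim(3) unfolding K\<gamma> by (simp add: add_divide_distrib)
      also have "4 * real K / real n \<le> \<delta> / 2"
        using elim(2,3) \<delta> by (simp add: field_simps)
      finally show ?thesis using rate by simp
    qed
    ultimately show ?case using C \<alpha> by (intro exI[of _ C] conjI)
  qed
qed

end

section \<open>Vanishing first-kind error and the supremum over auxiliary laws\<close>

lemma feasible_exponent_mono:
  assumes "\<epsilon> \<le> \<epsilon>'" "feasible_exponent P Q K R \<epsilon> E"
  shows "feasible_exponent P Q K R \<epsilon>' E"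
  unfolding feasible_exponent_def
proof (intro allI impI)
  fix \<delta> :: real assume "\<delta> > 0"
  with assms(2) show "\<forall>\<^sub>F n in sequentially. \<exists>c. is_code K n c \<and>
        neg_log_rate n (prob_decide K n c Q 0) \<ge> ereal (E - \<delta>) \<and>
        code_rate K n c \<le> R + \<delta> \<and> prob_decide K n c P 1 \<le> \<epsilon>'"
    unfolding feasible_exponent_def
    by (auto elim!: eventually_mono intro: order_trans[OF _ assms(1)] dest!: spec[of _ \<delta>])
qed

lemma optimal_exponent_mono: "\<epsilon> \<le> \<epsilon>' \<Longrightarrow> optimal_exponent P Q K R \<epsilon> \<le> optimal_exponent P Q K R \<epsilon>'"
  unfolding optimal_exponent_def by (intro SUP_subset_mono) (auto intro: feasible_exponent_mono)

text \<open>By monotonicity a value below \<open>a\<close> at one positive \<epsilon> persists at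
  all smaller ones, so the infimum is a limit.\<close>

lemma mono_tendsto_INF_at_right:
  fixes f :: "real \<Rightarrow> ereal"
  assumes "\<And>x y. x \<le> y \<Longrightarrow> f x \<le> f y"
  shows "(f \<longlongrightarrow> (INF \<epsilon>\<in>{0<..}. f \<epsilon>)) (at_right 0)"
proof (rule order_tendstoI)
  fix a assume "a < (INF \<epsilon>\<in>{0<..}. f \<epsilon>)"
  then have "a < f \<epsilon>" if "\<epsilon> > 0" for \<epsilon>
    using that by (meson INF_lower greaterThan_iff order_less_le_trans)
  then show "\<forall>\<^sub>F \<epsilon> in at_right 0. a < f \<epsilon>"
    using eventually_at_right_less[of "0 :: real"] by (auto elim: eventually_mono)
next
  fix a assume "(INF \<epsilon>\<in>{0<..}. f \<epsilon>) < a"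
  then obtain \<epsilon> where \<epsilon>: "\<epsilon> > 0" "f \<epsilon> < a" by (auto simp: INF_less_iff)
  then have "f \<epsilon>' < a" if "\<epsilon>' < \<epsilon>" for \<epsilon>'
    using assms[of \<epsilon>' \<epsilon>] that by auto
  then show "\<forall>\<^sub>F \<epsilon> in at_right 0. f \<epsilon> < a"
    using eventually_at_right_field[of _ "0 :: real"] \<epsilon>(1) by blast
qed

text \<open>Otherwise a real \<open>E\<close> fits strictly between the two sides and would be
  feasible. Arguing with such an \<open>E\<close> treats an infinite left side like a finite
  one.\<close>

lemma INF_divergence_le:
  fixes P Q :: "('x::finite \<times> 'y::finite) pmf"
  assumes K: "K \<ge> 1" and aux: "(\<U>, \<V>, p) \<in> aux_set P K R" and kernels: "(\<kappa>, \<eta>) \<in> cond_kernels K \<U> \<V> p"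
    and \<epsilon>: "\<epsilon> > 0"
  shows "(INF p' \<in> matching_laws K \<U> \<V> p. divergence p' (bar_law Q K \<kappa> \<eta>)) \<le> optimal_exponent P Q K R \<epsilon>"
proof (rule ccontr)
  \<comment> \<open>Outside rounds 1 to \<open>K\<close> the given kernels may have infinite
    support; a point mass there meets the finiteness assumptions and leaves the law with bars
    unchanged.\<close>
  define \<kappa>' where "\<kappa>' k b = (if k \<in> {1..K} then \<kappa> k b else return_pmf 0)" for k b
  define \<eta>' where "\<eta>' k b = (if k \<in> {1..K} then \<eta> k b else return_pmf 0)" for k b
  have sub: "set_pmf (\<kappa> k b) \<subseteq> \<U> k" "set_pmf (\<eta> k b') \<subseteq> \<V> k" "finite (\<U> k)" "finite (\<V> k)" if "k \<in> {1..K}" for k b b'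
  proof -
    show "set_pmf (\<kappa> k b) \<subseteq> \<U> k" "set_pmf (\<eta> k b') \<subseteq> \<V> k"
      using kernels that unfolding cond_kernels_def mem_Collect_eq prod.case by blast+
    show "finite (\<U> k)" "finite (\<V> k)" using aux that by (auto simp: aux_set_def)
  qed
  have bar: "bar_law Q K \<kappa> \<eta> = bar_law Q K \<kappa>' \<eta>'"
    by (rule bar_law_cong) (simp_all add: \<kappa>'_def \<eta>'_def)
  interpret auxiliary_law P Q K \<U> \<V> p \<kappa>' \<eta>'
  proof unfold_locales
    show "set_pmf (\<kappa>' k b) \<subseteq> \<U> k" if "k \<in> {1..K}" for k b
      unfolding \<kappa>'_def using sub(1)[OF that] that by (simp only: if_True)
    show "set_pmf (\<eta>' k b) \<subseteq> \<V> k" if "k \<in> {1..K}" for k b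
      unfolding \<eta>'_def using sub(2)[OF that] that by (simp only: if_True)
    show "finite (set_pmf (\<kappa>' k b))" for k b
    proof (cases "k \<in> {1..K}")
      case True
      then show ?thesis using finite_subset[OF sub(1)[OF True] sub(3)[OF True]] by (simp add: \<kappa>'_def)
    qed (auto simp: \<kappa>'_def)
    show "finite (set_pmf (\<eta>' k b))" for k b
    proof (cases "k \<in> {1..K}")
      case True
      then show ?thesis using finite_subset[OF sub(2)[OF True] sub(4)[OF True]] by (simp add: \<eta>'_def)
    qed (auto simp: \<eta>'_def)
  qed (use K aux kernels in \<open>auto simp: aux_set_def cond_kernels_def \<kappa>'_def \<eta>'_def is_cond_law_def\<close>)
  assume "\<not> ?thesis"
  then obtain E where less: "ereal E < (INF p' \<in> matching_laws K \<U> \<V> p. divergence p' (bar_law Q K \<kappa> \<eta>))"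
    and E: "optimal_exponent P Q K R \<epsilon> < ereal E"
    using ereal_dense2 by (auto simp: not_le)
  have "feasible_exponent P Q K R \<epsilon> E"
  proof (rule feasible_below_divergence[OF _ \<epsilon>])
    show "exchange_rate K p \<le> R" using aux by (simp add: aux_set_def)
    fix t assume t: "t \<in> matching_laws K \<U> \<V> p" "set_pmf t \<subseteq> set_pmf (bar_law Q K \<kappa>' \<eta>')"
    have "finite (set_pmf t)" using t(1) by (intro finite_laws) (simp add: matching_laws_def)
    \<comment> \<open>The laws of infinite divergence are exactly those excluded by the support
      condition \<open>t(2)\<close>, so \<open>rel_ent\<close> is the true divergence here.\<close>
    then have "divergence t (bar_law Q K \<kappa> \<eta>) = ereal (rel_ent t (bar_law Q K \<kappa>' \<eta>'))"
      using t(2) by (simp add: divergence_pmf bar)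
    moreover have "ereal E < divergence t (bar_law Q K \<kappa> \<eta>)"
      using less t(1) by (meson INF_lower order_less_le_trans)
    ultimately show "E < rel_ent t (bar_law Q K \<kappa>' \<eta>')" by simp
  qed
  then have "ereal E \<le> optimal_exponent P Q K R \<epsilon>"
    unfolding optimal_exponent_def by (intro SUP_upper) simp
  then show False using E by simp
qed

theorem proposition2:
  fixes P Q :: "('x::finite \<times> 'y::finite) pmf"
    and K :: nat and R :: real
  assumes "K \<ge> 1" and "R \<ge> 0"
  shows "\<exists>L :: ereal. ((\<lambda>\<epsilon>. optimal_exponent P Q K R \<epsilon>) \<longlongrightarrow> L) (at_right 0) \<and> L \<ge> exponent_bound P Q K R"
proof (intro exI conjI)
  show "((\<lambda>\<epsilon>. optimal_exponent P Q K R \<epsilon>) \<longlongrightarrow> (INF \<epsilon>\<in>{0<..}. optimal_exponent P Q K R \<epsilon>)) (at_right 0)"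
    by (rule mono_tendsto_INF_at_right) (rule optimal_exponent_mono)
  \<comment> \<open>The bound does not depend on \<epsilon>, so it suffices to stay below the
    optimal exponent at every positive \<epsilon>, for each tuple and each version of the
    kernels.\<close>
  show "exponent_bound P Q K R \<le> (INF \<epsilon>\<in>{0<..}. optimal_exponent P Q K R \<epsilon>)"
    unfolding exponent_bound_def
    by (intro SUP_least INF_greatest) (auto intro!: SUP_least INF_divergence_le[OF assms(1)])
qed

end
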